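(* Let $r,\mu,\rho\in\mathbb{R}$, $\sigma>0$, $\lambda=\frac{\mu-r}{\sigma}$, $\gamma>1$, and assume $\rho>(1-\gamma)\left(r+\frac{\lambda^2}{2\gamma}\right)$. Then the constant $a>0$ for which the value function satisfies $V(x)=a\,\frac{x^{1-\gamma}}{1-\gamma}$ for all $x>0$ is $$a=\left(\frac{\rho-(1-\gamma)\left(r+\frac{\lambda^2}{2\gamma}\right)}{\gamma}\right)^{-\gamma};$$ that is, $V(x)=a\,\frac{x^{1-\gamma}}{1-\gamma}$ for all $x>0$ with this value of $a$.
   Context: $W$ is a standard one-dimensional Brownian motion on a filtered probability space $(\Omega,\mathcal{F},\mathbb{F}=(\mathcal{F}_t)_{t\ge0},\mathbb{P})$ satisfying the usual conditions. $\mathbb{R}^+$ denotes the set of nonnegative reals. $L^{2,\mathbb{F}}_{\mathrm{loc}}(\Omega\times[0,\infty);\mathbb{R})$ is the space of $\mathbb{F}$-adapted real-valued (measurable in $(\omega,t)$) processes $Z$ with $\mathbb{E}\left[\int_0^R|Z_t|^2\mathrm{d}t\right]<\infty$ for every $R>0$; $L^{1,\mathbb{F}}_{\mathrm{loc}}(\Omega\times[0,\infty);\mathbb{R}^+)$ is the space of $\mathbb{F}$-adapted $\mathbb{R}^+$-valued (measurable) processes $Z$ with $\mathbb{E}\left[\int_0^R|Z_t|\mathrm{d}t\right]<\infty$ for every $R>0$. For $x>0$, $c\in L^{1,\mathbb{F}}_{\mathrm{loc}}(\Omega\times[0,\infty);\mathbb{R}^+)$ and $\pi\in L^{2,\mathbb{F}}_{\mathrm{loc}}(\Omega\times[0,\infty);\mathbb{R})$,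 the wealth process $X=X^{x;c,\pi}$ is the unique strong solution of $$\mathrm{d}X_t=(rX_t+\sigma\lambda\pi_t)\,\mathrm{d}t+\sigma\pi_t\,\mathrm{d}W_t-c_t\,\mathrm{d}t,\qquad X_0=x.$$ The set of admissible strategies is $$\mathcal{A}(x)=\{(c,\pi)\in L^{1,\mathbb{F}}_{\mathrm{loc}}(\Omega\times[0,\infty);\mathbb{R}^+)\times L^{2,\mathbb{F}}_{\mathrm{loc}}(\Omega\times[0,\infty);\mathbb{R}):\ X^{x;c,\pi}\ge0\}.$$ The objective functional is $J(c)=\mathbb{E}\left[\int_0^\infty e^{-\rho s}\frac{c_s^{1-\gamma}}{1-\gamma}\,\mathrm{d}s\right]\in[-\infty,0]$ (with the convention that $\frac{0^{1-\gamma}}{1-\gamma}=-\infty$), and the value function is $V(x)=\sup_{(c,\pi)\in\mathcal{A}(x)}J(c)\in[-\infty,0]$. *)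

theory Defs
  imports "HOL-Probability.Probability"
begin

text \<open>Stochastic processes are functions \<open>real \<Rightarrow> 'a \<Rightarrow> real\<close> (time first); only times
  \<open>t \<ge> 0\<close> are meaningful, and values at negative times are unconstrained. Of each \<open>F t\<close> only
  the underlying sigma-algebra matters, not the measure it carries.\<close>

locale usual_filtered_prob_space = prob_space M
  for M :: "'a measure" +
  fixes F :: "real \<Rightarrow> 'a measure"
  assumes subalgebra_F: "0 \<le> t \<Longrightarrow> subalgebra M (F t)"
    and mono_F: "0 \<le> s \<Longrightarrow> s \<le> t \<Longrightarrow> sets (F s) \<subseteq> sets (F t)"
    and complete_F: "N \<in> null_sets M \<Longrightarrow> A \<subseteq> N \<Longrightarrow> A \<in> sets (F 0)"
    and right_continuous_F: "0 \<le> t \<Longrightarrow> sets (F t) = (\<Inter>s\<in>{t<..}. sets (F s))"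

definition adapted :: "(real \<Rightarrow> 'a measure) \<Rightarrow> (real \<Rightarrow> 'a \<Rightarrow> real) \<Rightarrow> bool" where
  "adapted F Z \<longleftrightarrow> (\<forall>t\<ge>0. Z t \<in> borel_measurable (F t))"

definition jointly_measurable :: "'a measure \<Rightarrow> (real \<Rightarrow> 'a \<Rightarrow> real) \<Rightarrow> bool" where
  "jointly_measurable M Z \<longleftrightarrow>
     (\<lambda>(\<omega>, t). Z t \<omega>) \<in> borel_measurable (M \<Otimes>\<^sub>M restrict_space borel {0..})"

definition continuous_paths :: "'a measure \<Rightarrow> (real \<Rightarrow> 'a \<Rightarrow> real) \<Rightarrow> bool" where
  "continuous_paths M Z \<longleftrightarrow> (AE \<omega> in M. continuous_on {0..} (\<lambda>t. Z t \<omega>))"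

definition brownian_motion ::
  "'a measure \<Rightarrow> (real \<Rightarrow> 'a measure) \<Rightarrow> (real \<Rightarrow> 'a \<Rightarrow> real) \<Rightarrow> bool" where
  "brownian_motion M F W \<longleftrightarrow>
     adapted F W \<and> continuous_paths M W \<and> (AE \<omega> in M. W 0 \<omega> = 0) \<and>
     (\<forall>s t. 0 \<le> s \<and> s < t \<longrightarrow>
        distributed M lborel (\<lambda>\<omega>. W t \<omega> - W s \<omega>) (normal_density 0 (sqrt (t - s))) \<and>
        prob_space.indep_set M (sets (F s))
          {(\<lambda>\<omega>. W t \<omega> - W s \<omega>) -` B \<inter> space M | B. B \<in> sets borel})"

definition L1_loc :: "'a measure \<Rightarrow> (real \<Rightarrow> 'a measure) \<Rightarrow> (real \<Rightarrow> 'a \<Rightarrow> real) set" where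
  "L1_loc M F = {Z. adapted F Z \<and> jointly_measurable M Z \<and>
     (\<forall>R>0. (\<integral>\<^sup>+\<omega>. (\<integral>\<^sup>+t\<in>{0..R}. ennreal \<bar>Z t \<omega>\<bar> \<partial>lborel) \<partial>M) < \<infinity>)}"

definition L1_loc_nonneg :: "'a measure \<Rightarrow> (real \<Rightarrow> 'a measure) \<Rightarrow> (real \<Rightarrow> 'a \<Rightarrow> real) set" where
  "L1_loc_nonneg M F = {Z \<in> L1_loc M F. \<forall>t\<ge>0. \<forall>\<omega>\<in>space M. 0 \<le> Z t \<omega>}"

definition L2_loc :: "'a measure \<Rightarrow> (real \<Rightarrow> 'a measure) \<Rightarrow> (real \<Rightarrow> 'a \<Rightarrow> real) set" where
  "L2_loc M F = {Z. adapted F Z \<and> jointly_measurable M Z \<and>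
     (\<forall>R>0. (\<integral>\<^sup>+\<omega>. (\<integral>\<^sup>+t\<in>{0..R}. ennreal (\<bar>Z t \<omega>\<bar>\<^sup>2) \<partial>lborel) \<partial>M) < \<infinity>)}"

text \<open>The Ito integral is the usual one: step processes
  \<open>\<Sum>i<n. \<xi> i 1_(\<tau> i, \<tau> (i+1)]\<close> with square-integrable, \<open>F (\<tau> i)\<close>-measurable coefficients are
  integrated elementarily, and the integral of a general integrand is the continuous adapted process
  obtained as the mean-square limit (unique up to indistinguishability).\<close>

definition step_data ::
  "'a measure \<Rightarrow> (real \<Rightarrow> 'a measure) \<Rightarrow> nat \<Rightarrow> (nat \<Rightarrow> real) \<Rightarrow> (nat \<Rightarrow> 'a \<Rightarrow> real) \<Rightarrow> bool" where
  "step_data M F n \<tau> \<xi> \<longleftrightarrow> 0 \<le> \<tau> 0 \<and>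
     (\<forall>i<n. \<tau> i < \<tau> (Suc i) \<and> \<xi> i \<in> borel_measurable (F (\<tau> i)) \<and>
            integrable M (\<lambda>\<omega>. (\<xi> i \<omega>)\<^sup>2))"

definition step_process ::
  "nat \<Rightarrow> (nat \<Rightarrow> real) \<Rightarrow> (nat \<Rightarrow> 'a \<Rightarrow> real) \<Rightarrow> real \<Rightarrow> 'a \<Rightarrow> real" where
  "step_process n \<tau> \<xi> t \<omega> = (\<Sum>i<n. \<xi> i \<omega> * indicator {\<tau> i<..\<tau> (Suc i)} t)"

definition step_integral ::
  "(real \<Rightarrow> 'a \<Rightarrow> real) \<Rightarrow> nat \<Rightarrow> (nat \<Rightarrow> real) \<Rightarrow> (nat \<Rightarrow> 'a \<Rightarrow> real) \<Rightarrow> real \<Rightarrow> 'a \<Rightarrow> real" where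
  "step_integral W n \<tau> \<xi> t \<omega> =
     (\<Sum>i<n. \<xi> i \<omega> * (W (min t (\<tau> (Suc i))) \<omega> - W (min t (\<tau> i)) \<omega>))"

definition ito_integral ::
  "'a measure \<Rightarrow> (real \<Rightarrow> 'a measure) \<Rightarrow> (real \<Rightarrow> 'a \<Rightarrow> real) \<Rightarrow>
   (real \<Rightarrow> 'a \<Rightarrow> real) \<Rightarrow> (real \<Rightarrow> 'a \<Rightarrow> real) \<Rightarrow> bool" where
  "ito_integral M F W H I \<longleftrightarrow>
     H \<in> L2_loc M F \<and> adapted F I \<and> continuous_paths M I \<and>
     (\<forall>T\<ge>0. \<exists>n \<tau> \<xi>. (\<forall>k::nat. step_data M F (n k) (\<tau> k) (\<xi> k)) \<and>
        (\<lambda>k. \<integral>\<^sup>+\<omega>. (\<integral>\<^sup>+t\<in>{0..T}.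
               ennreal ((step_process (n k) (\<tau> k) (\<xi> k) t \<omega> - H t \<omega>)\<^sup>2) \<partial>lborel) \<partial>M)
          \<longlonglongrightarrow> 0 \<and>
        (\<lambda>k. \<integral>\<^sup>+\<omega>. ennreal ((step_integral W (n k) (\<tau> k) (\<xi> k) T \<omega> - I T \<omega>)\<^sup>2) \<partial>M)
          \<longlonglongrightarrow> 0)"

text \<open>\<open>X\<close> is a strong solution of
  \<open>dX = (r X + \<sigma> lam \<pi>) dt + \<sigma> \<pi> dW - c dt\<close>, \<open>X 0 = x\<close>, read in integrated form.\<close>

definition wealth_process ::
  "'a measure \<Rightarrow> (real \<Rightarrow> 'a measure) \<Rightarrow> (real \<Rightarrow> 'a \<Rightarrow> real) \<Rightarrow> real \<Rightarrow> real \<Rightarrow> real \<Rightarrow>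
   real \<Rightarrow> (real \<Rightarrow> 'a \<Rightarrow> real) \<Rightarrow> (real \<Rightarrow> 'a \<Rightarrow> real) \<Rightarrow> (real \<Rightarrow> 'a \<Rightarrow> real) \<Rightarrow> bool" where
  "wealth_process M F W r \<sigma> lam x c \<pi> X \<longleftrightarrow>
     adapted F X \<and> continuous_paths M X \<and>
     (\<exists>I. ito_integral M F W (\<lambda>t \<omega>. \<sigma> * \<pi> t \<omega>) I \<and>
        (AE \<omega> in M. \<forall>t\<ge>0.
           set_integrable lborel {0..t} (\<lambda>s. r * X s \<omega> + \<sigma> * lam * \<pi> s \<omega> - c s \<omega>) \<and>
           X t \<omega> = x + (LINT s:{0..t}|lborel. r * X s \<omega> + \<sigma> * lam * \<pi> s \<omega> - c s \<omega>) + I t \<omega>))"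

text \<open>Since the wealth process of a strategy exists and is unique up to indistinguishability,
  nonnegativity is expressed for some version of it.\<close>

definition admissible ::
  "'a measure \<Rightarrow> (real \<Rightarrow> 'a measure) \<Rightarrow> (real \<Rightarrow> 'a \<Rightarrow> real) \<Rightarrow> real \<Rightarrow> real \<Rightarrow> real \<Rightarrow>
   real \<Rightarrow> ((real \<Rightarrow> 'a \<Rightarrow> real) \<times> (real \<Rightarrow> 'a \<Rightarrow> real)) set" where
  "admissible M F W r \<sigma> lam x =
     {(c, \<pi>). c \<in> L1_loc_nonneg M F \<and> \<pi> \<in> L2_loc M F \<and>
        (\<exists>X. wealth_process M F W r \<sigma> lam x c \<pi> X \<and> (AE \<omega> in M. \<forall>t\<ge>0. 0 \<le> X t \<omega>))}"

text \<open>The case distinction is needed because \<open>0 powr (1 - \<gamma>) = 0\<close> in the library.\<close>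

definition utility :: "real \<Rightarrow> real \<Rightarrow> ereal" where
  "utility \<gamma> y = (if y = 0 then - \<infinity> else ereal (y powr (1 - \<gamma>) / (1 - \<gamma>)))"

text \<open>For \<open>\<gamma> > 1\<close> the integrand is nonpositive with values in \<open>[-\<infinity>, 0]\<close>, so its expected
  integral is minus the Lebesgue integral of its negation.\<close>

definition objective :: "'a measure \<Rightarrow> real \<Rightarrow> real \<Rightarrow> (real \<Rightarrow> 'a \<Rightarrow> real) \<Rightarrow> ereal" where
  "objective M \<rho> \<gamma> c =
     - enn2ereal (\<integral>\<^sup>+\<omega>. (\<integral>\<^sup>+s\<in>{0..}.
         e2ennreal (- (ereal (exp (- \<rho> * s)) * utility \<gamma> (c s \<omega>))) \<partial>lborel) \<partial>M)"

definition value_function ::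
  "'a measure \<Rightarrow> (real \<Rightarrow> 'a measure) \<Rightarrow> (real \<Rightarrow> 'a \<Rightarrow> real) \<Rightarrow> real \<Rightarrow> real \<Rightarrow> real \<Rightarrow>
   real \<Rightarrow> real \<Rightarrow> real \<Rightarrow> ereal" where
  "value_function M F W r \<sigma> lam \<rho> \<gamma> x =
     (SUP (c, \<pi>) \<in> admissible M F W r \<sigma> lam x. objective M \<rho> \<gamma> c)"

end

theory Submission
  imports Defs
begin

text \<open>
  Let \<open>Z t = exp (- lam W t - lam\<^sup>2 t / 2)\<close>, so that \<open>exp (- r t) Z t\<close> is the state price.
  Testing the wealth equation against \<open>Z\<close> gives the budget constraint
  \<open>E (\<integral> exp (- r s) Z s c s ds) \<le> x\<close> for every admissible consumption \<open>c\<close>. No Ito formula is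
  needed: pairing a step integral with \<open>Z\<close> turns \<open>dW\<close> into \<open>- lam dt\<close> by independence of
  increments, this passes to mean-square limits, and the linear drift is removed pathwise.

  The candidate optimum is \<open>c\<^sup>* = k X\<^sup>*\<close> for a geometric Brownian motion \<open>X\<^sup>*\<close>, where
  \<open>k = a powr (- 1 / \<gamma>)\<close>; it satisfies \<open>exp (- \<rho> s) (c\<^sup>* s) powr (- \<gamma>) = y exp (- r s) Z s\<close> with
  \<open>y = (k x) powr (- \<gamma>)\<close>. Hence the tangent inequality of the utility at \<open>c\<^sup>*\<close>, integrated
  against the budget constraint, bounds \<open>J(c)\<close> by \<open>J(c\<^sup>*)\<close>, which is a Gaussian integral. That \<open>X\<^sup>*\<close>
  solves the wealth equation is checked on uniform grids: the error of the left-endpoint sums is a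
  sum of orthogonal terms of variance \<open>O(h\<^sup>2)\<close> plus a Riemann sum error.
\<close>

section \<open>Square integrable functions\<close>

definition square_integrable :: "'a measure \<Rightarrow> ('a \<Rightarrow> real) \<Rightarrow> bool" where
  "square_integrable N f \<longleftrightarrow> f \<in> borel_measurable N \<and> integrable N (\<lambda>x. (f x)\<^sup>2)"

definition mean_square_tendsto ::
  "'a measure \<Rightarrow> (nat \<Rightarrow> 'a \<Rightarrow> real) \<Rightarrow> ('a \<Rightarrow> real) \<Rightarrow> bool" where
  "mean_square_tendsto N u f \<longleftrightarrow> (\<lambda>k. \<integral>\<^sup>+x. ennreal ((u k x - f x)\<^sup>2) \<partial>N) \<longlonglongrightarrow> 0"

lemma square_integrable_measurable [measurable_dest]: "square_integrable N f \<Longrightarrow> f \<in> borel_measurable N"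
  by (simp add: square_integrable_def)

lemma square_integrableI:
  assumes "f \<in> borel_measurable N" "(\<integral>\<^sup>+x. ennreal ((f x)\<^sup>2) \<partial>N) < \<infinity>"
  shows "square_integrable N f"
  using assms unfolding square_integrable_def by (auto intro!: integrableI_nonneg)

lemma nn_integral_square:
  "square_integrable N f \<Longrightarrow> (\<integral>\<^sup>+x. ennreal ((f x)\<^sup>2) \<partial>N) = ennreal (\<integral>x. (f x)\<^sup>2 \<partial>N)"
  by (intro nn_integral_eq_integral) (auto simp: square_integrable_def)

lemma square_integrable_bound:
  assumes "g \<in> borel_measurable N" "integrable N h" "\<And>x. x \<in> space N \<Longrightarrow> (g x)\<^sup>2 \<le> h x"
  shows "square_integrable N g"
  unfolding square_integrable_def
proof
  show "integrable N (\<lambda>x. (g x)\<^sup>2)"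
  proof (rule Bochner_Integration.integrable_bound)
    show "AE x in N. norm ((g x)\<^sup>2) \<le> norm (h x)"
      using assms(3) by (intro AE_I2) (force intro: order_trans)
  qed (use assms in auto)
qed fact

lemma square_integrable_cmult: "square_integrable N f \<Longrightarrow> square_integrable N (\<lambda>x. c * f x)"
  unfolding square_integrable_def power_mult_distrib by auto

lemma square_integrable_mult_bounded:
  assumes f [measurable]: "square_integrable N f" and [measurable]: "g \<in> borel_measurable N"
    and bound: "\<And>x. x \<in> space N \<Longrightarrow> \<bar>g x\<bar> \<le> C"
  shows "square_integrable N (\<lambda>x. g x * f x)"
proof (rule square_integrable_bound)
  show "integrable N (\<lambda>x. C\<^sup>2 * (f x)\<^sup>2)" using f by (simp add: square_integrable_def)
  show "(g x * f x)\<^sup>2 \<le> C\<^sup>2 * (f x)\<^sup>2" if "x \<in> space N" for x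
    unfolding power_mult_distrib using bound[OF that]
    by (intro mult_right_mono abs_le_square_iff[THEN iffD1]) auto
qed measurable

lemma square_integrable_diff:
  assumes f [measurable]: "square_integrable N f" and g [measurable]: "square_integrable N g"
  shows "square_integrable N (\<lambda>x. f x - g x)"
proof (rule square_integrable_bound)
  show "integrable N (\<lambda>x. 2 * (f x)\<^sup>2 + 2 * (g x)\<^sup>2)"
    using f g by (simp add: square_integrable_def)
  show "(f x - g x)\<^sup>2 \<le> 2 * (f x)\<^sup>2 + 2 * (g x)\<^sup>2" for x
    using zero_le_power2[of "f x + g x"] by (simp add: power2_eq_square algebra_simps)
qed measurable

lemma integrable_mult_square_integrable:
  assumes f [measurable]: "square_integrable N f" and g [measurable]: "square_integrable N g"
  shows "integrable N (\<lambda>x. f x * g x)"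
proof (rule Bochner_Integration.integrable_bound)
  show "integrable N (\<lambda>x. (f x)\<^sup>2 + (g x)\<^sup>2)" using f g by (simp add: square_integrable_def)
  have "\<bar>a * b\<bar> \<le> a\<^sup>2 + b\<^sup>2" for a b :: real
  proof -
    have "0 \<le> (\<bar>a\<bar> - \<bar>b\<bar>)\<^sup>2 + \<bar>a * b\<bar>" by simp
    then show ?thesis by (simp add: power2_diff abs_mult)
  qed
  then show "AE x in N. norm (f x * g x) \<le> norm ((f x)\<^sup>2 + (g x)\<^sup>2)" by simp
qed measurable

lemma Cauchy_Schwarz_integral:
  assumes f [measurable]: "square_integrable N f" and g [measurable]: "square_integrable N g"
  shows "\<bar>\<integral>x. f x * g x \<partial>N\<bar> \<le> sqrt ((\<integral>x. (f x)\<^sup>2 \<partial>N) * (\<integral>x. (g x)\<^sup>2 \<partial>N))"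
proof (rule real_le_rsqrt)
  let ?A = "\<integral>x. \<bar>f x * g x\<bar> \<partial>N"
  have "ennreal (?A\<^sup>2) = (\<integral>\<^sup>+x. ennreal \<bar>f x * g x\<bar> \<partial>N)\<^sup>2"
    using integrable_mult_square_integrable[OF f g]
    by (subst nn_integral_eq_integral) (auto simp: ennreal_power)
  also have "\<dots> \<le> (\<integral>\<^sup>+x. ennreal ((f x)\<^sup>2) \<partial>N) * (\<integral>\<^sup>+x. ennreal ((g x)\<^sup>2) \<partial>N)"
    using Cauchy_Schwarz_nn_integral[of "\<lambda>x. ennreal \<bar>f x\<bar>" N "\<lambda>x. ennreal \<bar>g x\<bar>"]
    by (simp add: abs_mult ennreal_mult ennreal_power)
  also have "\<dots> = ennreal ((\<integral>x. (f x)\<^sup>2 \<partial>N) * (\<integral>x. (g x)\<^sup>2 \<partial>N))"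
    by (simp add: nn_integral_square f g ennreal_mult)
  finally have "?A\<^sup>2 \<le> (\<integral>x. (f x)\<^sup>2 \<partial>N) * (\<integral>x. (g x)\<^sup>2 \<partial>N)"
    by (subst (asm) ennreal_le_iff) auto
  moreover have "\<bar>\<integral>x. f x * g x \<partial>N\<bar>\<^sup>2 \<le> ?A\<^sup>2" by (intro power_mono integral_abs_bound) auto
  ultimately show "\<bar>\<integral>x. f x * g x \<partial>N\<bar>\<^sup>2 \<le> (\<integral>x. (f x)\<^sup>2 \<partial>N) * (\<integral>x. (g x)\<^sup>2 \<partial>N)"
    by (rule order_trans[rotated])
qed

lemma nn_integral_square_integral_le:
  fixes g :: "'a \<Rightarrow> real"
  assumes [measurable]: "g \<in> borel_measurable N"
  shows "ennreal ((\<integral>y. g y \<partial>N)\<^sup>2) \<le> emeasure N (space N) * (\<integral>\<^sup>+y. ennreal ((g y)\<^sup>2) \<partial>N)"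
proof (cases "integrable N g")
  case True
  have "ennreal ((\<integral>y. g y \<partial>N)\<^sup>2) = (ennreal \<bar>\<integral>y. g y \<partial>N\<bar>)\<^sup>2"
    by (simp add: ennreal_power)
  also have "\<dots> \<le> (\<integral>\<^sup>+y. ennreal \<bar>g y\<bar> * 1 \<partial>N)\<^sup>2"
    using integral_norm_bound_ennreal[OF True] by (intro power_mono) auto
  also have "\<dots> \<le> (\<integral>\<^sup>+y. (ennreal \<bar>g y\<bar>)\<^sup>2 \<partial>N) * (\<integral>\<^sup>+y. 1\<^sup>2 \<partial>N)"
    by (rule Cauchy_Schwarz_nn_integral) auto
  also have "\<dots> = emeasure N (space N) * (\<integral>\<^sup>+y. ennreal ((g y)\<^sup>2) \<partial>N)"
    by (simp add: ennreal_power mult.commute)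
  finally show ?thesis .
qed (simp add: not_integrable_integral_eq)

context
  fixes N :: "'a measure" and f :: "'a \<Rightarrow> real" and u :: "nat \<Rightarrow> 'a \<Rightarrow> real"
  assumes f: "f \<in> borel_measurable N" and u: "\<And>k. square_integrable N (u k)"
    and u_tendsto_f: "mean_square_tendsto N u f"
begin

lemma mean_square_limit_square_integrable: "square_integrable N f"
proof -
  have "eventually (\<lambda>k. (\<integral>\<^sup>+x. ennreal ((u k x - f x)\<^sup>2) \<partial>N) < 1) sequentially"
    using u_tendsto_f by (intro order_tendstoD(2)) (auto simp: mean_square_tendsto_def)
  then obtain k where "(\<integral>\<^sup>+x. ennreal ((u k x - f x)\<^sup>2) \<partial>N) < 1"
    by (auto simp: eventually_sequentially)
  then have "(\<integral>\<^sup>+x. ennreal ((u k x - f x)\<^sup>2) \<partial>N) < \<infinity>"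
    by (rule order.strict_trans) simp
  then have "square_integrable N (\<lambda>x. u k x - f x)"
    using f square_integrable_measurable[OF u] by (intro square_integrableI) auto
  from square_integrable_diff[OF u[of k] this] show ?thesis by simp
qed

lemma integral_square_diff_tendsto_0: "(\<lambda>k. \<integral>x. (u k x - f x)\<^sup>2 \<partial>N) \<longlonglongrightarrow> 0"
proof -
  have "(\<lambda>k. ennreal (\<integral>x. (u k x - f x)\<^sup>2 \<partial>N)) \<longlonglongrightarrow> ennreal 0"
    using u_tendsto_f square_integrable_diff[OF u mean_square_limit_square_integrable]
    by (simp add: mean_square_tendsto_def nn_integral_square)
  then show ?thesis by (subst (asm) tendsto_ennreal_iff) auto
qed

lemma tendsto_integral_mult_mean_square:
  assumes g: "square_integrable N g"
  shows "(\<lambda>k. \<integral>x. g x * u k x \<partial>N) \<longlonglongrightarrow> (\<integral>x. g x * f x \<partial>N)"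
proof (rule LIM_zero_cancel[OF Lim_null_comparison])
  note fL = mean_square_limit_square_integrable
  let ?d = "\<lambda>k. sqrt ((\<integral>x. (g x)\<^sup>2 \<partial>N) * (\<integral>x. (u k x - f x)\<^sup>2 \<partial>N))"
  have "(\<integral>x. g x * u k x \<partial>N) - (\<integral>x. g x * f x \<partial>N) = (\<integral>x. g x * (u k x - f x) \<partial>N)" for k
    using integrable_mult_square_integrable[OF g] u fL by (simp add: right_diff_distrib)
  then show "\<forall>\<^sub>F k in sequentially. norm ((\<integral>x. g x * u k x \<partial>N) - (\<integral>x. g x * f x \<partial>N)) \<le> ?d k"
    using Cauchy_Schwarz_integral[OF g square_integrable_diff[OF u fL]] by simp
  have "?d \<longlonglongrightarrow> sqrt ((\<integral>x. (g x)\<^sup>2 \<partial>N) * 0)"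
    by (intro tendsto_intros integral_square_diff_tendsto_0)
  then show "?d \<longlonglongrightarrow> 0" by simp
qed

lemma tendsto_integral_square_mean_square:
  "(\<lambda>k. \<integral>x. (u k x)\<^sup>2 \<partial>N) \<longlonglongrightarrow> (\<integral>x. (f x)\<^sup>2 \<partial>N)"
proof -
  note fL = mean_square_limit_square_integrable
  have "(\<integral>x. (u k x)\<^sup>2 \<partial>N)
      = (\<integral>x. (u k x - f x)\<^sup>2 \<partial>N) + 2 * (\<integral>x. f x * u k x \<partial>N) - (\<integral>x. f x * f x \<partial>N)" for k
  proof -
    have "(\<integral>x. (u k x)\<^sup>2 \<partial>N) = (\<integral>x. (u k x - f x)\<^sup>2 + 2 * (f x * u k x) - f x * f x \<partial>N)"
      by (rule Bochner_Integration.integral_cong) (auto simp: power2_eq_square algebra_simps)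
    also have "\<dots> = (\<integral>x. (u k x - f x)\<^sup>2 \<partial>N) + 2 * (\<integral>x. f x * u k x \<partial>N) - (\<integral>x. f x * f x \<partial>N)"
      using square_integrable_diff[OF u fL, of k] integrable_mult_square_integrable[OF fL] u fL
      by (simp add: square_integrable_def)
    finally show ?thesis .
  qed
  moreover have "(\<lambda>k. (\<integral>x. (u k x - f x)\<^sup>2 \<partial>N) + 2 * (\<integral>x. f x * u k x \<partial>N) - (\<integral>x. f x * f x \<partial>N))
      \<longlonglongrightarrow> 0 + 2 * (\<integral>x. f x * f x \<partial>N) - (\<integral>x. f x * f x \<partial>N)"
    by (intro tendsto_intros integral_square_diff_tendsto_0 tendsto_integral_mult_mean_square fL)
  ultimately show ?thesis by (simp add: power2_eq_square)
qed

end

lemma (in pair_sigma_finite) has_bochner_integral_mult_prod: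
  fixes f :: "'a \<Rightarrow> real" and g :: "'b \<Rightarrow> real"
  assumes f: "has_bochner_integral M1 f a" and g: "has_bochner_integral M2 g b"
  shows "has_bochner_integral (M1 \<Otimes>\<^sub>M M2) (\<lambda>(x, y). f x * g y) (a * b)"
proof -
  have factors: "integrable M1 f" "integrable M2 g" "integral\<^sup>L M1 f = a" "integral\<^sup>L M2 g = b"
    using f g by (auto simp: has_bochner_integral_iff)
  then have "integrable (M1 \<Otimes>\<^sub>M M2) (\<lambda>(x, y). f x * g y)"
    by (intro Fubini_integrable) (auto simp: abs_mult)
  moreover from integral_fst[OF this] have "(\<integral>(x, y). f x * g y \<partial>(M1 \<Otimes>\<^sub>M M2)) = a * b"
    using factors by simp
  ultimately show ?thesis by (simp add: has_bochner_integral_iff)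
qed

lemma (in pair_sigma_finite) square_integrable_fst:
  assumes "square_integrable M1 f" "finite_measure M2"
  shows "square_integrable (M1 \<Otimes>\<^sub>M M2) (\<lambda>(x, y). f x)"
proof -
  interpret M2: finite_measure M2 by fact
  have "has_bochner_integral M2 (\<lambda>y. 1) (measure M2 (space M2))"
    by (simp add: has_bochner_integral_iff)
  from has_bochner_integral_mult_prod[OF has_bochner_integral_integrable this, of "\<lambda>x. (f x)\<^sup>2"]
  show ?thesis using assms(1)
    by (auto simp: square_integrable_def has_bochner_integral_iff split_beta')
qed

lemma (in pair_sigma_finite) square_integrable_slices:
  assumes f_measurable: "case_prod f \<in> borel_measurable (M1 \<Otimes>\<^sub>M M2)" and "finite_measure M2"
    and slice: "\<And>y. y \<in> space M2 \<Longrightarrow> square_integrable M1 (\<lambda>x. f x y)"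
    and bound: "\<And>y. y \<in> space M2 \<Longrightarrow> (\<integral>x. (f x y)\<^sup>2 \<partial>M1) \<le> B"
  shows "square_integrable (M1 \<Otimes>\<^sub>M M2) (case_prod f)"
proof (rule square_integrableI)
  interpret M2: finite_measure M2 by fact
  have "(\<integral>\<^sup>+p. ennreal ((case_prod f p)\<^sup>2) \<partial>(M1 \<Otimes>\<^sub>M M2))
      = (\<integral>\<^sup>+y. (\<integral>\<^sup>+x. ennreal ((f x y)\<^sup>2) \<partial>M1) \<partial>M2)"
    using f_measurable by (subst nn_integral_snd[symmetric]) auto
  also have "\<dots> \<le> (\<integral>\<^sup>+y. ennreal B \<partial>M2)"
    by (intro nn_integral_mono) (simp add: nn_integral_square slice bound ennreal_leI)
  also have "\<dots> < \<infinity>" by (simp add: ennreal_mult_less_top M2.emeasure_eq_measure)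
  finally show "(\<integral>\<^sup>+p. ennreal ((case_prod f p)\<^sup>2) \<partial>(M1 \<Otimes>\<^sub>M M2)) < \<infinity>" .
qed (use f_measurable in auto)

section \<open>Integration over time intervals\<close>

abbreviation lborel_on :: "real set \<Rightarrow> real measure" where
  "lborel_on A \<equiv> restrict_space lborel A"

lemma finite_measure_lborel_on_Icc: "finite_measure (lborel_on {a..b})"
  by (intro finite_measureI) (simp add: emeasure_restrict_space emeasure_lborel_Icc_eq)

lemma sigma_finite_measure_lborel_on: "A \<in> sets borel \<Longrightarrow> sigma_finite_measure (lborel_on A)"
  by (rule sigma_finite_measure_restrict_space[OF sigma_finite_lborel]) simp

lemma measurable_lborel_on: "measurable (lborel_on A) N = measurable (restrict_space borel A) N"
  by (intro measurable_cong_sets sets_restrict_space_cong) auto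

lemma measurable_ident_lborel_on: "(\<lambda>s. s) \<in> borel_measurable (lborel_on A)"
  by (simp add: measurable_restrict_space1)

lemma set_lebesgue_integral_lborel_on:
  fixes f :: "real \<Rightarrow> real"
  assumes "A \<in> sets borel"
  shows "(LINT s:A|lborel. f s) = (\<integral>s. f s \<partial>lborel_on A)"
    and "set_integrable lborel A f \<longleftrightarrow> integrable (lborel_on A) f"
  using assms by (simp_all add: set_lebesgue_integral_def integral_restrict_space
      set_integrable_def integrable_restrict_space)

lemma set_nn_integral_lborel_on:
  assumes "A \<in> sets borel"
  shows "(\<integral>\<^sup>+s\<in>A. f s \<partial>lborel) = (\<integral>\<^sup>+s. f s \<partial>lborel_on A)"
  using assms by (simp add: nn_integral_restrict_space)

lemma set_nn_integral_atLeast_le: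
  fixes f :: "real \<Rightarrow> ennreal"
  assumes f: "f \<in> borel_measurable (lborel_on {0..})"
    and bound: "\<And>t. 0 \<le> t \<Longrightarrow> (\<integral>\<^sup>+s\<in>{0..t}. f s \<partial>lborel) \<le> C"
  shows "(\<integral>\<^sup>+s\<in>{0..}. f s \<partial>lborel) \<le> C"
proof -
  let ?D = "density lborel (\<lambda>s. f s * indicator {0..} s)"
  have "(\<lambda>s. f s * indicator {0..} s) \<in> borel_measurable lborel"
    using f by (simp add: borel_measurable_restrict_space_iff_ennreal)
  then have D: "emeasure ?D A = (\<integral>\<^sup>+s\<in>A. f s \<partial>lborel)" if "A \<in> sets borel" "A \<subseteq> {0..}" for A
    using that by (auto simp: emeasure_density indicator_def intro!: nn_integral_cong)
  have union: "(\<Union>n. {0..real n}) = {0..}" using real_arch_simple by auto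
  have "(SUP n. emeasure ?D {0..real n}) = emeasure ?D (\<Union>n. {0..real n})"
    by (rule SUP_emeasure_incseq) (auto simp: incseq_def)
  moreover have "(SUP n. emeasure ?D {0..real n}) \<le> C" by (intro SUP_least) (simp add: D bound)
  ultimately show ?thesis by (simp add: union D)
qed

lemma integral_has_real_derivative_Icc:
  fixes g g' :: "real \<Rightarrow> real"
  assumes "a \<le> b" "\<And>s. (g has_real_derivative g' s) (at s)" "continuous_on UNIV g'"
  shows "has_bochner_integral (lborel_on {a..b}) g' (g b - g a)"
proof -
  have "has_bochner_integral lborel (\<lambda>s. g' s * indicator {a..b} s) (g b - g a)"
    using assms by (intro has_bochner_integral_FTC_Icc_real)
      (auto simp: continuous_on_eq_continuous_at)
  then show ?thesis by (simp add: has_bochner_integral_restrict_space mult.commute)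
qed

lemma continuous_on_Icc_bounded_measurable:
  fixes g :: "real \<Rightarrow> real"
  assumes g: "continuous_on {a..b} g"
  obtains B where "g \<in> borel_measurable (lborel_on {a..b})" "\<And>s. s \<in> {a..b} \<Longrightarrow> \<bar>g s\<bar> \<le> B"
proof -
  obtain B where "\<And>s. s \<in> {a..b} \<Longrightarrow> \<bar>g s\<bar> \<le> B"
    using compact_imp_bounded[OF compact_continuous_image[OF g compact_Icc]]
    unfolding bounded_iff by (metis image_eqI real_norm_def)
  moreover have "g \<in> borel_measurable (lborel_on {a..b})"
    unfolding measurable_lborel_on by (rule borel_measurable_continuous_on_restrict[OF g])
  ultimately show thesis by (intro that)
qed

lemma set_integrable_continuous_mult:
  fixes f g :: "real \<Rightarrow> real"
  assumes f: "set_integrable lborel {a..b} f" and g: "continuous_on {a..b} g"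
  shows "set_integrable lborel {a..b} (\<lambda>s. g s * f s)"
proof -
  obtain B where [measurable]: "g \<in> borel_measurable (lborel_on {a..b})"
    and B: "\<And>s. s \<in> {a..b} \<Longrightarrow> \<bar>g s\<bar> \<le> B"
    using continuous_on_Icc_bounded_measurable[OF g] by blast
  have f_L [measurable]: "integrable (lborel_on {a..b}) f"
    using f by (simp add: set_lebesgue_integral_lborel_on)
  have "integrable (lborel_on {a..b}) (\<lambda>s. g s * f s)"
  proof (rule Bochner_Integration.integrable_bound)
    show "integrable (lborel_on {a..b}) (\<lambda>s. B * f s)" using f_L by simp
    have "\<bar>g s\<bar> * \<bar>f s\<bar> \<le> \<bar>B\<bar> * \<bar>f s\<bar>" if "s \<in> {a..b}" for s
      using B[OF that] by (intro mult_right_mono) auto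
    then show "AE s in lborel_on {a..b}. norm (g s * f s) \<le> norm (B * f s)"
      by (intro AE_I2) (auto simp: abs_mult)
  qed measurable
  then show ?thesis by (simp add: set_lebesgue_integral_lborel_on)
qed

lemma Fubini_triangle:
  fixes f h :: "real \<Rightarrow> real"
  assumes f: "set_integrable lborel {a..b} f" and h: "set_integrable lborel {a..b} h"
  shows "(LINT s:{a..b}|lborel. h s * (LINT u:{a..s}|lborel. f u))
    = (LINT u:{a..b}|lborel. (LINT s:{u..b}|lborel. h s) * f u)"
proof -
  let ?L = "lborel_on {a..b}"
  interpret L: sigma_finite_measure ?L by (rule sigma_finite_measure_lborel_on) simp
  interpret P: pair_sigma_finite ?L ?L ..
  have f_L [measurable]: "integrable ?L f" and h_L [measurable]: "integrable ?L h"
    using f h by (simp_all add: set_lebesgue_integral_lborel_on)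
  let ?k = "\<lambda>s u. if u \<le> s then h s * f u else 0"
  have k: "integrable (?L \<Otimes>\<^sub>M ?L) (\<lambda>(s, u). ?k s u)"
  proof (rule Bochner_Integration.integrable_bound)
    show "integrable (?L \<Otimes>\<^sub>M ?L) (\<lambda>(s, u). h s * f u)"
      using P.has_bochner_integral_mult_prod[OF h_L[THEN has_bochner_integral_integrable]
          f_L[THEN has_bochner_integral_integrable]] by (simp add: has_bochner_integral_iff)
    have [measurable]: "fst \<in> borel_measurable (?L \<Otimes>\<^sub>M ?L)" "snd \<in> borel_measurable (?L \<Otimes>\<^sub>M ?L)"
      using measurable_compose[OF measurable_fst measurable_ident_lborel_on]
        measurable_compose[OF measurable_snd measurable_ident_lborel_on] by auto
    show "(\<lambda>(s, u). ?k s u) \<in> borel_measurable (?L \<Otimes>\<^sub>M ?L)" by measurable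
  qed auto
  note on_interval = set_lebesgue_integral_lborel_on(1)[of "{a..b}", simplified]
    integral_restrict_space[of "{a..b}" lborel, simplified]
  have inner: "(\<integral>u. ?k s u \<partial>?L) = h s * (LINT u:{a..s}|lborel. f u)" if "s \<in> {a..b}" for s
  proof -
    have "(\<integral>u. ?k s u \<partial>?L) = (\<integral>u. h s * (indicator {a..s} u * f u) \<partial>lborel)"
      using that unfolding on_interval(2)
      by (intro Bochner_Integration.integral_cong) (auto simp: indicator_def)
    then show ?thesis by (simp add: set_lebesgue_integral_def)
  qed
  have outer: "(\<integral>s. ?k s u \<partial>?L) = (LINT s:{u..b}|lborel. h s) * f u" if "u \<in> {a..b}" for u
  proof -
    have "(\<integral>s. ?k s u \<partial>?L) = (\<integral>s. (indicator {u..b} s * h s) * f u \<partial>lborel)"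
      using that unfolding on_interval(2)
      by (intro Bochner_Integration.integral_cong) (auto simp: indicator_def)
    then show ?thesis by (simp add: set_lebesgue_integral_def)
  qed
  have "(LINT s:{a..b}|lborel. h s * (LINT u:{a..s}|lborel. f u)) = (\<integral>s. (\<integral>u. ?k s u \<partial>?L) \<partial>?L)"
    unfolding on_interval(1) by (intro Bochner_Integration.integral_cong) (simp_all add: inner)
  also have "\<dots> = (LINT u:{a..b}|lborel. (LINT s:{u..b}|lborel. h s) * f u)"
    unfolding P.Fubini_integral[OF k, symmetric] on_interval(1)
    by (intro Bochner_Integration.integral_cong) (simp_all add: outer)
  finally show ?thesis .
qed

text \<open>The primitive of an integrable function need not be differentiable everywhere, so the
  integration by parts is an application of Fubini's theorem.\<close>

lemma integration_by_parts_primitive: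
  fixes f g g' :: "real \<Rightarrow> real"
  assumes ab: "a \<le> b" and f: "set_integrable lborel {a..b} f"
    and g: "\<And>s. (g has_real_derivative g' s) (at s)" "continuous_on UNIV g'"
  shows "g b * (LINT s:{a..b}|lborel. f s)
    = (LINT s:{a..b}|lborel. g s * f s) + (LINT s:{a..b}|lborel. g' s * (LINT u:{a..s}|lborel. f u))"
proof -
  have increment: "(LINT s:{u..b}|lborel. g' s) = g b - g u" if "u \<le> b" for u
    using integral_has_real_derivative_Icc[OF that g]
    by (simp add: set_lebesgue_integral_lborel_on has_bochner_integral_iff)
  have "set_integrable lborel {a..b} g'"
    using integral_has_real_derivative_Icc[OF ab g]
    by (simp add: set_lebesgue_integral_lborel_on has_bochner_integral_iff)
  then have "(LINT s:{a..b}|lborel. g' s * (LINT u:{a..s}|lborel. f u))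
      = (LINT u:{a..b}|lborel. (LINT s:{u..b}|lborel. g' s) * f u)"
    by (rule Fubini_triangle[OF f])
  also have "\<dots> = (LINT u:{a..b}|lborel. g b * f u - g u * f u)"
    by (intro set_lebesgue_integral_cong) (auto simp: increment left_diff_distrib)
  also have "\<dots> = g b * (LINT u:{a..b}|lborel. f u) - (LINT u:{a..b}|lborel. g u * f u)"
  proof -
    have "continuous_on {a..b} g"
      by (intro continuous_at_imp_continuous_on ballI) (rule DERIV_isCont[OF g(1)])
    then show ?thesis
      using f set_integrable_continuous_mult[OF f] by (simp add: set_integral_diff)
  qed
  finally show ?thesis by simp
qed

lemma set_integral_exp_neg:
  fixes r :: real
  assumes "0 \<le> t"
  shows "r * (LINT s:{0..t}|lborel. exp (- r * s)) = 1 - exp (- r * t)"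
proof -
  have "has_bochner_integral (lborel_on {0..t}) (\<lambda>s. r * exp (- r * s))
      (- exp (- r * t) - - exp (- r * 0))"
    by (intro integral_has_real_derivative_Icc assms)
      (auto intro!: derivative_eq_intros continuous_intros)
  then show ?thesis by (auto simp: set_lebesgue_integral_lborel_on has_bochner_integral_iff)
qed

lemma linear_integral_equation:
  fixes X f J :: "real \<Rightarrow> real"
  assumes X: "continuous_on {0..} X" and J: "continuous_on {0..} J" and t: "0 \<le> t"
    and drift_integrable: "\<And>s. 0 \<le> s \<Longrightarrow> set_integrable lborel {0..s} (\<lambda>u. r * X u + f u)"
    and equation: "\<And>s. 0 \<le> s \<Longrightarrow> X s = x + (LINT u:{0..s}|lborel. r * X u + f u) + J s"
  shows "set_integrable lborel {0..t} f"
    and "exp (- r * t) * X t = x + (LINT s:{0..t}|lborel. exp (- r * s) * f s)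
      + (exp (- r * t) * J t + r * (LINT s:{0..t}|lborel. exp (- r * s) * J s))"
proof -
  let ?L = "\<lambda>h. LINT s:{0..t}|lborel. exp (- r * s) * h s"
  have exp_cont: "continuous_on A (\<lambda>s. exp (- r * s))" for A by (intro continuous_intros)
  have XJ: "set_integrable lborel {0..t} X" "set_integrable lborel {0..t} J"
    using X J by (auto intro!: borel_integrable_atLeastAtMost' intro: continuous_on_subset)
  show f: "set_integrable lborel {0..t} f"
    using set_integral_diff(1)[OF drift_integrable[OF t]
        set_integrable_mult_right[OF XJ(1), of r]] by simp
  note discounted = set_integrable_continuous_mult[OF _ exp_cont]
  have exp_integrable: "set_integrable lborel {0..t} (\<lambda>s. exp (- r * s))"
    by (rule borel_integrable_atLeastAtMost'[OF exp_cont])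
  have "exp (- r * t) * (LINT s:{0..t}|lborel. r * X s + f s)
      = ?L (\<lambda>s. r * X s + f s)
        + (LINT s:{0..t}|lborel. - r * exp (- r * s) * (LINT u:{0..s}|lborel. r * X u + f u))"
    using drift_integrable[OF t] by (intro integration_by_parts_primitive t)
      (auto intro!: derivative_eq_intros continuous_intros)
  also have "(LINT s:{0..t}|lborel. - r * exp (- r * s) * (LINT u:{0..s}|lborel. r * X u + f u))
      = (LINT s:{0..t}|lborel. - r * exp (- r * s) * (X s - x - J s))"
    by (intro set_lebesgue_integral_cong) (auto simp: equation)
  also have "?L (\<lambda>s. r * X s + f s) + \<dots>
      = (LINT s:{0..t}|lborel. exp (- r * s) * (r * X s + f s) + - r * exp (- r * s) * (X s - x - J s))"
    using X J
    by (intro set_integral_add(2)[symmetric] discounted drift_integrable t borel_integrable_atLeastAtMost')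
      (auto intro!: continuous_intros intro: continuous_on_subset)
  also have "\<dots> = (LINT s:{0..t}|lborel. exp (- r * s) * f s + x * (r * exp (- r * s))
      + r * (exp (- r * s) * J s))"
    by (simp add: algebra_simps)
  also have "\<dots> = ?L f + x * (1 - exp (- r * t)) + r * ?L J"
    unfolding set_integral_exp_neg[OF t, symmetric]
    using discounted[OF f] discounted[OF XJ(2)] exp_integrable
    by (simp add: set_integral_add)
  finally show "exp (- r * t) * X t = x + ?L f + (exp (- r * t) * J t + r * ?L J)"
    using equation[OF t] by (simp add: algebra_simps)
qed

lemma discounted_linear_integral_equation:
  fixes X J h c :: "real \<Rightarrow> real"
  assumes X: "continuous_on {0..} X" and J: "continuous_on {0..} J" and t: "0 \<le> t"
    and h: "set_integrable lborel {0..t} h"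
    and drift_integrable: "\<And>s. 0 \<le> s \<Longrightarrow> set_integrable lborel {0..s} (\<lambda>u. r * X u + (b * h u - c u))"
    and equation: "\<And>s. 0 \<le> s \<Longrightarrow> X s = x + (LINT u:{0..s}|lborel. r * X u + (b * h u - c u)) + J s"
  shows "set_integrable lborel {0..t} c"
    and "exp (- r * t) * X t + (LINT s:{0..t}|lborel. exp (- r * s) * c s)
      = x + b * (LINT s:{0..t}|lborel. exp (- r * s) * h s)
        + (exp (- r * t) * J t + r * (LINT s:{0..t}|lborel. exp (- r * s) * J s))"
proof -
  let ?L = "\<lambda>f. LINT s:{0..t}|lborel. exp (- r * s) * f s"
  note solution = linear_integral_equation[OF X J t drift_integrable equation]
  have exp_cont: "continuous_on {0..t} (\<lambda>s. exp (- r * s))" by (intro continuous_intros)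
  show c: "set_integrable lborel {0..t} c"
    using set_integral_diff(1)[OF set_integrable_mult_right[OF h, of b] solution(1)] by simp
  have "?L (\<lambda>s. b * h s - c s)
      = (LINT s:{0..t}|lborel. b * (exp (- r * s) * h s) - exp (- r * s) * c s)"
    by (simp add: algebra_simps)
  also have "\<dots> = b * ?L h - ?L c"
    by (simp only: set_integral_diff(2)[OF set_integrable_mult_right[OF
          set_integrable_continuous_mult[OF h exp_cont]] set_integrable_continuous_mult[OF c exp_cont]]
        set_integral_mult_right)
  finally show "exp (- r * t) * X t + ?L c
      = x + b * ?L h + (exp (- r * t) * J t + r * ?L J)"
    using solution(2) by simp
qed

lemma set_integral_continuous_eq_integral:
  fixes f :: "real \<Rightarrow> real"
  assumes "continuous_on {0..} f" "0 \<le> a"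
  shows "(LINT s:{a..b}|lborel. f s) = integral {a..b} f"
  using assms by (intro set_borel_integral_eq_integral(2) borel_integrable_atLeastAtMost')
    (auto intro: continuous_on_subset)

lemma set_integral_continuous_combine:
  fixes f :: "real \<Rightarrow> real"
  assumes f: "continuous_on {0..} f" and "0 \<le> a" "a \<le> b"
  shows "(LINT s:{0..b}|lborel. f s) = (LINT s:{0..a}|lborel. f s) + (LINT s:{a..b}|lborel. f s)"
proof -
  have "integral {0..a} f + integral {a..b} f = integral {0..b} f"
    using assms by (intro Henstock_Kurzweil_Integration.integral_combine integrable_continuous_interval)
      (auto intro: continuous_on_subset)
  then show ?thesis using assms by (simp add: set_integral_continuous_eq_integral)
qed

lemma continuous_on_set_integral_atLeast:
  fixes f :: "real \<Rightarrow> real"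
  assumes f: "continuous_on {0..} f"
  shows "continuous_on {0..} (\<lambda>t. LINT s:{0..t}|lborel. f s)"
proof -
  have "continuous (at t within {0..}) (\<lambda>t. integral {0..t} f)" if "0 \<le> t" for t
  proof -
    have "continuous_on {0..t + 1} (\<lambda>t. integral {0..t} f)"
      using f by (intro indefinite_integral_continuous_1 integrable_continuous_interval)
        (auto intro: continuous_on_subset)
    then have "continuous (at t within {0..t + 1}) (\<lambda>t. integral {0..t} f)"
      using that by (simp add: continuous_on_eq_continuous_within)
    moreover have "at t within {0..t + 1} = at t within {0..}"
      by (rule at_within_nhd[of t "{..<t + 1}"]) (use that in auto)
    ultimately show ?thesis by simp
  qed
  then show ?thesis
    by (simp add: continuous_on_eq_continuous_within set_integral_continuous_eq_integral[OF f])
qed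

section \<open>Measurability of processes\<close>

lemma jointly_measurable_lborel_on:
  assumes "jointly_measurable M Z" "A \<subseteq> {0..}"
  shows "(\<lambda>(w, t). Z t w) \<in> borel_measurable (M \<Otimes>\<^sub>M lborel_on A)"
proof -
  have "snd \<in> measurable (M \<Otimes>\<^sub>M lborel_on A) (restrict_space borel {0..})"
    using assms(2) measurable_compose[OF measurable_snd measurable_ident_lborel_on[of A]]
    by (intro measurable_restrict_space2) (auto simp: space_pair_measure space_restrict_space)
  then have "(\<lambda>p. (fst p, snd p)) \<in> measurable (M \<Otimes>\<^sub>M lborel_on A) (M \<Otimes>\<^sub>M restrict_space borel {0..})"
    by (intro measurable_Pair measurable_fst)
  from measurable_compose[OF this assms(1)[unfolded jointly_measurable_def]]
  show ?thesis by (simp add: split_beta')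
qed

lemma grid_floor_tendsto:
  fixes t :: real
  assumes "0 \<le> t"
  shows "(\<lambda>n. real (nat \<lfloor>t * real (Suc n)\<rfloor>) / real (Suc n)) \<longlonglongrightarrow> t"
proof (rule LIM_zero_cancel[OF Lim_null_comparison[OF _ LIMSEQ_inverse_real_of_nat]])
  have "\<bar>real (nat \<lfloor>t * real (Suc n)\<rfloor>) - t * real (Suc n)\<bar> / real (Suc n)
      \<le> inverse (real (Suc n))" for n
    unfolding inverse_eq_divide using assms
    by (intro divide_right_mono) (auto simp: abs_le_iff, linarith+)
  then show "\<forall>\<^sub>F n in sequentially.
      norm (real (nat \<lfloor>t * real (Suc n)\<rfloor>) / real (Suc n) - t) \<le> inverse (real (Suc n))"
    by (simp add: field_simps del: of_nat_Suc)
qed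

lemma continuous_imp_jointly_measurable:
  assumes Z: "\<And>t. 0 \<le> t \<Longrightarrow> Z t \<in> borel_measurable M"
    and cont: "\<And>w. w \<in> space M \<Longrightarrow> continuous_on {0..} (\<lambda>t. Z t w)"
  shows "jointly_measurable M Z"
  unfolding jointly_measurable_def
proof (rule borel_measurable_LIMSEQ_real)
  let ?P = "M \<Otimes>\<^sub>M restrict_space borel {0::real..}"
  let ?u = "\<lambda>n (x :: 'a \<times> real). Z (real (nat \<lfloor>snd x * real (Suc n)\<rfloor>) / real (Suc n)) (fst x)"
  show "?u n \<in> borel_measurable ?P" for n
  proof (rule measurable_compose_countable[where f="\<lambda>i x. Z (real i / real (Suc n)) (fst x)"])
    show "(\<lambda>x. Z (real i / real (Suc n)) (fst x)) \<in> borel_measurable ?P" for i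
      using measurable_compose[OF measurable_fst Z[of "real i / real (Suc n)"]] by simp
    have [measurable]: "(\<lambda>x. snd x) \<in> borel_measurable ?P"
      by (rule measurable_compose[OF measurable_snd, where g="\<lambda>x. x"])
        (simp add: measurable_restrict_space1)
    show "(\<lambda>x. nat \<lfloor>snd x * real (Suc n)\<rfloor>) \<in> measurable ?P (count_space UNIV)"
      by measurable
  qed
  fix x assume "x \<in> space ?P"
  then obtain w t where x: "x = (w, t)" "w \<in> space M" "0 \<le> t"
    by (cases x) (auto simp: space_pair_measure space_restrict_space)
  from continuous_on_tendsto_compose[OF cont[OF x(2)] grid_floor_tendsto[OF x(3)]]
  show "(\<lambda>n. ?u n x) \<longlonglongrightarrow> (case x of (w, t) \<Rightarrow> Z t w)"
    using x by simp
qed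

context usual_filtered_prob_space
begin

lemma space_F: "0 \<le> t \<Longrightarrow> space (F t) = space M"
  using subalgebra_F by (simp add: subalgebra_def)

lemma measurable_F_le:
  assumes "0 \<le> s" "s \<le> t" "f \<in> measurable (F s) N"
  shows "f \<in> measurable (F t) N"
  using assms space_F[of s] space_F[of t] mono_F[of s t] by (auto simp: measurable_def)

lemma measurable_F_M:
  assumes "0 \<le> s" "f \<in> measurable (F s) N"
  shows "f \<in> measurable M N"
  using assms subalgebra_F measurable_from_subalg by blast

lemma adapted_measurable_F:
  "adapted F Z \<Longrightarrow> 0 \<le> s \<Longrightarrow> s \<le> t \<Longrightarrow> Z s \<in> borel_measurable (F t)"
  by (rule measurable_F_le[of s]) (auto simp: adapted_def)

lemma adapted_measurable_M: "adapted F Z \<Longrightarrow> 0 \<le> t \<Longrightarrow> Z t \<in> borel_measurable M"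
  using measurable_F_M by (auto simp: adapted_def)

lemma adapted_AE_modification:
  assumes Z: "adapted F Z" and AE_P: "AE w in M. P (\<lambda>t. Z t w)" and zero: "P (\<lambda>_. 0)"
  obtains Z' where "adapted F Z'" "\<And>w. w \<in> space M \<Longrightarrow> P (\<lambda>t. Z' t w)"
    and "AE w in M. \<forall>t. Z t w = Z' t w"
proof -
  obtain N where N: "N \<in> null_sets M" "{w \<in> space M. \<not> P (\<lambda>t. Z t w)} \<subseteq> N"
    using AE_P unfolding eventually_ae_filter by blast
  define Z' where "Z' t w = (if w \<in> N then 0 else Z t w)" for t w
  show thesis
  proof (rule that)
    have "N \<in> sets (F t)" if "0 \<le> t" for t
      using complete_F[OF N(1) order.refl] mono_F[OF order.refl that] by blast
    then show "adapted F Z'"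
      using Z unfolding adapted_def Z'_def
      by (auto intro!: measurable_If_set simp: sets.Int_space_eq1)
    show "P (\<lambda>t. Z' t w)" if "w \<in> space M" for w
      using that N(2) zero by (cases "w \<in> N") (auto simp: Z'_def)
    show "AE w in M. \<forall>t. Z t w = Z' t w"
      using AE_not_in[OF N(1)] by eventually_elim (simp add: Z'_def)
  qed
qed

lemma adapted_set_integral:
  assumes Z: "adapted F Z" and cont: "\<And>w. w \<in> space M \<Longrightarrow> continuous_on {0..} (\<lambda>t. Z t w)"
    and t: "0 \<le> t"
  shows "(\<lambda>w. LINT s:{0..t}|lborel. Z s w) \<in> borel_measurable (F t)"
proof -
  have "jointly_measurable (F t) (\<lambda>s. Z (min s t))"
  proof (rule continuous_imp_jointly_measurable)
    show "Z (min s t) \<in> borel_measurable (F t)" if "0 \<le> s" for s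
      using Z t that by (intro adapted_measurable_F) auto
    show "continuous_on {0..} (\<lambda>s. Z (min s t) w)" if "w \<in> space (F t)" for w
      using that t by (intro continuous_on_compose2[OF cont])
        (auto simp: space_F intro!: continuous_intros)
  qed
  from jointly_measurable_lborel_on[OF this, of "{0..t}"]
  have "(\<lambda>w. \<integral>s. Z (min s t) w \<partial>lborel_on {0..t}) \<in> borel_measurable (F t)"
    by (intro sigma_finite_measure.borel_measurable_lebesgue_integral
        sigma_finite_measure_lborel_on) auto
  moreover have "(\<integral>s. Z (min s t) w \<partial>lborel_on {0..t}) = (LINT s:{0..t}|lborel. Z s w)" for w
    unfolding set_lebesgue_integral_lborel_on(1)[of "{0..t}", simplified]
    by (rule Bochner_Integration.integral_cong) auto
  ultimately show ?thesis by simp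
qed

end

section \<open>Brownian increments and the exponential martingale\<close>

lemma (in prob_space) indep_var_nn_integral:
  fixes X Y :: "'a \<Rightarrow> ennreal"
  assumes "indep_var borel X borel Y"
  shows "(\<integral>\<^sup>+w. X w * Y w \<partial>M) = (\<integral>\<^sup>+w. X w \<partial>M) * (\<integral>\<^sup>+w. Y w \<partial>M)"
proof -
  have borel: "case_bool borel borel = (\<lambda>_. borel)"
    by (rule ext) (simp split: bool.split)
  have "indep_vars (\<lambda>_. borel) (case_bool X Y) UNIV"
    using assms unfolding indep_var_def borel .
  from indep_vars_nn_integral[OF _ this] show ?thesis
    by (simp add: UNIV_bool mult.commute)
qed

definition exp_tilt :: "real \<Rightarrow> real \<Rightarrow> real \<Rightarrow> real" where
  "exp_tilt \<theta> v x = exp (\<theta> * x - \<theta>\<^sup>2 * v / 2)"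

lemma exp_tilt_measurable [measurable]: "exp_tilt \<theta> v \<in> borel_measurable borel"
  unfolding exp_tilt_def by measurable

lemma exp_tilt_pos [simp]: "0 < exp_tilt \<theta> v x"
  by (simp add: exp_tilt_def)

lemma exp_tilt_add: "exp_tilt \<theta> (u + v) (x + y) = exp_tilt \<theta> u x * exp_tilt \<theta> v y"
  unfolding exp_tilt_def by (simp add: algebra_simps add_divide_distrib flip: exp_add)

lemma exp_tilt_square: "(exp_tilt \<theta> v x)\<^sup>2 = exp (\<theta>\<^sup>2 * v) * exp_tilt (2 * \<theta>) v x"
proof -
  have "2 * (\<theta> * x - \<theta>\<^sup>2 * v / 2) = \<theta>\<^sup>2 * v + (2 * \<theta> * x - (2 * \<theta>)\<^sup>2 * v / 2)"
    by (simp add: power2_eq_square algebra_simps)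
  then show ?thesis unfolding exp_tilt_def by (simp only: exp_add[symmetric] exp_double[symmetric])
qed

lemma normal_density_exp_tilt:
  assumes "\<sigma> > 0"
  shows "normal_density 0 \<sigma> x * exp_tilt \<theta> (\<sigma>\<^sup>2) x = normal_density (\<theta> * \<sigma>\<^sup>2) \<sigma> x"
proof -
  have "- (x\<^sup>2) / (2 * \<sigma>\<^sup>2) + (\<theta> * x - \<theta>\<^sup>2 * \<sigma>\<^sup>2 / 2) = - ((x - \<theta> * \<sigma>\<^sup>2)\<^sup>2) / (2 * \<sigma>\<^sup>2)"
    using assms by (simp add: field_simps power2_eq_square)
  then show ?thesis
    unfolding normal_density_def exp_tilt_def by (simp add: mult.assoc flip: exp_add)
qed

locale brownian = usual_filtered_prob_space M F
  for M :: "'a measure" and F :: "real \<Rightarrow> 'a measure" +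
  fixes W :: "real \<Rightarrow> 'a \<Rightarrow> real"
  assumes W_adapted: "adapted F W"
    and W_continuous: "w \<in> space M \<Longrightarrow> continuous_on {0..} (\<lambda>t. W t w)"
    and W_0: "w \<in> space M \<Longrightarrow> W 0 w = 0"
    and W_distributed: "0 \<le> s \<Longrightarrow> s < t \<Longrightarrow>
      distributed M lborel (\<lambda>w. W t w - W s w) (normal_density 0 (sqrt (t - s)))"
    and W_indep: "0 \<le> s \<Longrightarrow> s < t \<Longrightarrow>
      indep_set (sets (F s)) {(\<lambda>w. W t w - W s w) -` B \<inter> space M | B. B \<in> sets borel}"
begin

lemma W_measurable_F: "0 \<le> s \<Longrightarrow> s \<le> t \<Longrightarrow> W s \<in> borel_measurable (F t)"
  by (rule adapted_measurable_F[OF W_adapted])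

lemma W_measurable_M: "0 \<le> s \<Longrightarrow> W s \<in> borel_measurable M"
  by (rule adapted_measurable_M[OF W_adapted])

lemma indep_var_increment:
  fixes A :: "'a \<Rightarrow> real"
  assumes "0 \<le> s" "s < t" and A: "A \<in> measurable (F s) N"
  shows "indep_var N A borel (\<lambda>w. W t w - W s w)"
proof -
  let ?D = "\<lambda>w. W t w - W s w"
  let ?events_D = "{?D -` B \<inter> space M | B. B \<in> sets borel}"
  let ?events_A = "{A -` B \<inter> space M | B. B \<in> sets N}"
  have "Int_stable ?events_D"
  proof (rule Int_stableI)
    fix a b assume "a \<in> ?events_D" "b \<in> ?events_D"
    then obtain B C where "a = ?D -` B \<inter> space M" "b = ?D -` C \<inter> space M"
      "B \<in> sets borel" "C \<in> sets borel" by blast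
    then show "a \<inter> b \<in> ?events_D" by (auto intro!: exI[of _ "B \<inter> C"])
  qed
  then have "indep_set (sigma_sets (space M) (sets (F s))) (sigma_sets (space M) ?events_D)"
    using W_indep[OF assms(1,2)] by (intro indep_set_sigma_sets) (auto simp: Int_stable_def)
  moreover have "sigma_sets (space M) (sets (F s)) = sets (F s)"
    using sets.sigma_sets_eq[of "F s"] space_F[OF assms(1)] by simp
  moreover have "sigma_sets (space M) ?events_A \<subseteq> sets (F s)"
    unfolding space_F[OF assms(1), symmetric]
    using measurable_sets[OF A] by (intro sets.sigma_sets_subset) auto
  ultimately have "indep_set (sigma_sets (space M) ?events_A) (sigma_sets (space M) ?events_D)"
    unfolding indep_sets2_eq by blast
  moreover have "?D \<in> borel_measurable M"
    using assms by (intro borel_measurable_diff W_measurable_M) auto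
  ultimately show ?thesis
    unfolding indep_var_eq using measurable_F_M[OF assms(1) A] by blast
qed

lemma indep_var_function_of_increment:
  fixes A :: "'a \<Rightarrow> real" and f :: "real \<Rightarrow> 'b" and g :: "real \<Rightarrow> 'b"
  assumes "0 \<le> s" "s < t" "A \<in> borel_measurable (F s)" "f \<in> measurable borel N" "g \<in> measurable borel L"
  shows "indep_var N (\<lambda>w. f (A w)) L (\<lambda>w. g (W t w - W s w))"
  using indep_var_compose[OF indep_var_increment[OF assms(1-3)] assms(4,5)]
  by (simp add: comp_def)

lemma nn_integral_mult_increment:
  fixes A :: "'a \<Rightarrow> real" and g :: "real \<Rightarrow> real"
  assumes "0 \<le> s" "s \<le> t" and A: "A \<in> borel_measurable (F s)" and g: "g \<in> borel_measurable borel"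
  shows "(\<integral>\<^sup>+w. ennreal (A w) * ennreal (g (W t w - W s w)) \<partial>M)
    = (\<integral>\<^sup>+w. ennreal (A w) \<partial>M) * (\<integral>\<^sup>+w. ennreal (g (W t w - W s w)) \<partial>M)"
proof (cases "s = t")
  case True
  then show ?thesis
    using measurable_F_M[OF assms(1) A] by (simp add: nn_integral_multc emeasure_space_1)
next
  case False
  then show ?thesis
    using assms by (intro indep_var_nn_integral indep_var_function_of_increment) auto
qed

lemma has_bochner_integral_mult_increment:
  fixes A :: "'a \<Rightarrow> real" and g :: "real \<Rightarrow> real"
  assumes "0 \<le> s" "s \<le> t" and A: "A \<in> borel_measurable (F s)" and g: "g \<in> borel_measurable borel"
    and a: "has_bochner_integral M A a" and b: "has_bochner_integral M (\<lambda>w. g (W t w - W s w)) b"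
  shows "has_bochner_integral M (\<lambda>w. A w * g (W t w - W s w)) (a * b)"
proof (cases "s = t")
  case True
  then show ?thesis using a b by (simp add: has_bochner_integral_iff prob_space)
next
  case False
  then have "indep_var borel A borel (\<lambda>w. g (W t w - W s w))"
    using assms indep_var_function_of_increment[of s t A "\<lambda>x. x" borel g borel] by simp
  from indep_var_lebesgue_integral[OF this] indep_var_integrable[OF this]
  show ?thesis using a b by (simp add: has_bochner_integral_iff)
qed

lemma tilted_increment_integral:
  assumes "0 \<le> s" "s < t" and g: "g \<in> borel_measurable borel"
    and tilted_integral: "has_bochner_integral lborel
      (\<lambda>x. normal_density (\<theta> * (t - s)) (sqrt (t - s)) x * g x) v"
  shows "has_bochner_integral M
    (\<lambda>w. exp_tilt \<theta> (t - s) (W t w - W s w) * g (W t w - W s w)) v"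
proof -
  let ?g = "\<lambda>x. exp_tilt \<theta> (t - s) x * g x"
  note dist = W_distributed[OF assms(1,2)]
  have tilted_measurable: "?g \<in> borel_measurable lborel" using g by measurable
  have density: "normal_density 0 (sqrt (t - s)) x * ?g x
      = normal_density (\<theta> * (t - s)) (sqrt (t - s)) x * g x" for x
    using normal_density_exp_tilt[of "sqrt (t - s)" x \<theta>] assms(1,2) by (simp flip: mult.assoc)
  show ?thesis
    using distributed_integral[OF dist tilted_measurable] distributed_integrable[OF dist tilted_measurable] tilted_integral
    unfolding has_bochner_integral_iff density by simp
qed

lemma
  assumes "0 \<le> s" "s \<le> t"
  shows exp_tilt_increment_mean:
      "has_bochner_integral M (\<lambda>w. exp_tilt \<theta> (t - s) (W t w - W s w)) 1"
    and exp_tilt_increment_mult_mean: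
      "has_bochner_integral M (\<lambda>w. exp_tilt \<theta> (t - s) (W t w - W s w) * (W t w - W s w)) (\<theta> * (t - s))"
    and increment_second_moment:
      "has_bochner_integral M (\<lambda>w. (W t w - W s w)\<^sup>2) (t - s)"
proof -
  let ?density = "normal_density (\<theta> * (t - s)) (sqrt (t - s))"
  have "has_bochner_integral M (\<lambda>w. exp_tilt \<theta> (t - s) (W t w - W s w)) 1
    \<and> has_bochner_integral M (\<lambda>w. exp_tilt \<theta> (t - s) (W t w - W s w) * (W t w - W s w)) (\<theta> * (t - s))
    \<and> has_bochner_integral M (\<lambda>w. (W t w - W s w)\<^sup>2) (t - s)"
  proof (cases "s = t")
    case True
    then show ?thesis by (simp add: has_bochner_integral_iff prob_space exp_tilt_def)
  next
    case False
    then have st: "0 \<le> s" "s < t" using assms by auto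
    have mass: "has_bochner_integral lborel (\<lambda>x. ?density x * 1) 1"
      using st by (simp add: has_bochner_integral_iff)
    have mean: "has_bochner_integral lborel (\<lambda>x. ?density x * x) (\<theta> * (t - s))"
      using normal_moment_nz_1 st by simp
    have "has_bochner_integral lborel (\<lambda>x. normal_density (0 * (t - s)) (sqrt (t - s)) x * x\<^sup>2) (t - s)"
      using normal_moment_even[of "sqrt (t - s)" 0 1] st
      by (simp add: eval_nat_numeral diff_divide_distrib)
    from tilted_increment_integral[OF st _ mass] tilted_increment_integral[OF st _ mean]
      tilted_increment_integral[OF st _ this]
    show ?thesis by (simp add: exp_tilt_def)
  qed
  then show "has_bochner_integral M (\<lambda>w. exp_tilt \<theta> (t - s) (W t w - W s w)) 1"
    "has_bochner_integral M (\<lambda>w. exp_tilt \<theta> (t - s) (W t w - W s w) * (W t w - W s w)) (\<theta> * (t - s))"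
    "has_bochner_integral M (\<lambda>w. (W t w - W s w)\<^sup>2) (t - s)"
    by auto
qed

lemma increment_mean:
  assumes "0 \<le> s" "s \<le> t"
  shows "has_bochner_integral M (\<lambda>w. W t w - W s w) 0"
  using exp_tilt_increment_mult_mean[OF assms, of 0] by (simp add: exp_tilt_def)

lemma exp_tilt_increment_square_mean:
  assumes "0 \<le> s" "s \<le> t"
  shows "has_bochner_integral M (\<lambda>w. (exp_tilt \<theta> (t - s) (W t w - W s w))\<^sup>2) (exp (\<theta>\<^sup>2 * (t - s)))"
  unfolding exp_tilt_square
  using has_bochner_integral_mult_right[OF exp_tilt_increment_mean[OF assms, of "2 * \<theta>"]] by simp

definition exp_martingale :: "real \<Rightarrow> real \<Rightarrow> 'a \<Rightarrow> real" where
  "exp_martingale \<theta> t w = exp_tilt \<theta> t (W t w)"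

lemma exp_martingale_pos [simp]: "0 < exp_martingale \<theta> t w"
  by (simp add: exp_martingale_def)

lemma exp_martingale_nonneg [simp]: "0 \<le> exp_martingale \<theta> t w"
  by (rule less_imp_le) simp

lemma exp_martingale_0: "w \<in> space M \<Longrightarrow> exp_martingale \<theta> 0 w = 1"
  by (simp add: exp_martingale_def exp_tilt_def W_0)

lemma exp_martingale_split:
  "exp_martingale \<theta> t w = exp_martingale \<theta> s w * exp_tilt \<theta> (t - s) (W t w - W s w)"
  using exp_tilt_add[of \<theta> s "t - s" "W s w" "W t w - W s w"] by (simp add: exp_martingale_def)

lemma exp_martingale_adapted: "adapted F (exp_martingale \<theta>)"
  using W_adapted unfolding adapted_def exp_martingale_def by auto

lemma exp_martingale_measurable_F:
  "0 \<le> s \<Longrightarrow> s \<le> t \<Longrightarrow> exp_martingale \<theta> s \<in> borel_measurable (F t)"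
  by (rule adapted_measurable_F[OF exp_martingale_adapted])

lemma exp_martingale_measurable_M: "0 \<le> s \<Longrightarrow> exp_martingale \<theta> s \<in> borel_measurable M"
  by (rule adapted_measurable_M[OF exp_martingale_adapted])

lemma exp_martingale_continuous:
  "w \<in> space M \<Longrightarrow> continuous_on {0..} (\<lambda>t. exp_martingale \<theta> t w)"
  unfolding exp_martingale_def exp_tilt_def by (intro continuous_intros W_continuous) auto

lemma exp_martingale_jointly_measurable: "jointly_measurable M (exp_martingale \<theta>)"
  by (intro continuous_imp_jointly_measurable exp_martingale_measurable_M exp_martingale_continuous)

lemma nn_integral_mult_exp_martingale:
  assumes "0 \<le> s" "s \<le> t" and A: "A \<in> borel_measurable (F s)"
  shows "(\<integral>\<^sup>+w. ennreal (A w * exp_martingale \<theta> t w) \<partial>M)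
    = (\<integral>\<^sup>+w. ennreal (A w * exp_martingale \<theta> s w) \<partial>M)"
proof -
  have [measurable]: "A \<in> borel_measurable (F s)" "exp_martingale \<theta> s \<in> borel_measurable (F s)"
    using A exp_martingale_measurable_F[OF assms(1) order.refl] by auto
  have "(\<integral>\<^sup>+w. ennreal (A w * exp_martingale \<theta> t w) \<partial>M)
      = (\<integral>\<^sup>+w. ennreal (A w * exp_martingale \<theta> s w) * ennreal (exp_tilt \<theta> (t - s) (W t w - W s w)) \<partial>M)"
    by (subst exp_martingale_split[of \<theta> t _ s])
      (simp add: mult.assoc[symmetric] ennreal_mult'' less_imp_le)
  also have "\<dots> = (\<integral>\<^sup>+w. ennreal (A w * exp_martingale \<theta> s w) \<partial>M)"
    using exp_tilt_increment_mean[OF assms(1,2), of \<theta>]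
    by (subst nn_integral_mult_increment[OF assms(1,2)])
      (auto simp: nn_integral_eq_integral has_bochner_integral_iff less_imp_le)
  finally show ?thesis .
qed

lemma has_bochner_integral_mult_exp_martingale:
  assumes "0 \<le> s" "s \<le> t" and A: "A \<in> borel_measurable (F s)"
    and martingale_integral: "has_bochner_integral M (\<lambda>w. A w * exp_martingale \<theta> s w) v"
  shows "has_bochner_integral M (\<lambda>w. A w * exp_martingale \<theta> t w) v"
proof -
  have "(\<lambda>w. A w * exp_martingale \<theta> s w) \<in> borel_measurable (F s)"
    using A exp_martingale_measurable_F[OF assms(1) order.refl] by measurable
  from has_bochner_integral_mult_increment[OF assms(1,2) this exp_tilt_measurable martingale_integral
      exp_tilt_increment_mean[OF assms(1,2)]]
  show ?thesis by (simp add: exp_martingale_split[of \<theta> t _ s] mult.assoc)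
qed

lemma exp_W_mean:
  assumes "0 \<le> t"
  shows "has_bochner_integral M (\<lambda>w. exp (\<theta> * W t w)) (exp (\<theta>\<^sup>2 * t / 2))"
proof -
  have "has_bochner_integral M
      (\<lambda>w. exp (\<theta>\<^sup>2 * t / 2) * exp_tilt \<theta> (t - 0) (W t w - W 0 w)) (exp (\<theta>\<^sup>2 * t / 2) * 1)"
    using assms by (intro has_bochner_integral_mult_right exp_tilt_increment_mean) auto
  then show ?thesis
    by (subst (asm) has_bochner_integral_cong[OF refl _ refl, where g="\<lambda>w. exp (\<theta> * W t w)"])
      (auto simp: W_0 exp_tilt_def simp flip: exp_add)
qed

lemma exp_martingale_mean:
  assumes "0 \<le> t"
  shows "has_bochner_integral M (exp_martingale \<theta> t) 1"
proof -
  from has_bochner_integral_mult_left[OF exp_W_mean[OF assms, of \<theta>], of "exp (- \<theta>\<^sup>2 * t / 2)"]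
  show ?thesis unfolding exp_martingale_def exp_tilt_def by (simp flip: exp_add)
qed

lemma exp_martingale_square_mean:
  assumes "0 \<le> t"
  shows "has_bochner_integral M (\<lambda>w. (exp_martingale \<theta> t w)\<^sup>2) (exp (\<theta>\<^sup>2 * t))"
  using has_bochner_integral_mult_right[OF exp_martingale_mean[OF assms, of "2 * \<theta>"],
      of "exp (\<theta>\<^sup>2 * t)"]
  by (simp add: exp_martingale_def exp_tilt_square)

lemma exp_martingale_square_integrable:
  "0 \<le> t \<Longrightarrow> square_integrable M (exp_martingale \<theta> t)"
  using exp_martingale_square_mean[of t \<theta>] exp_martingale_measurable_M[of t \<theta>]
  by (simp add: square_integrable_def has_bochner_integral_iff)

lemma exp_martingale_mult_mean:
  assumes "0 \<le> s" "s \<le> t"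
  shows "has_bochner_integral M (\<lambda>w. exp_martingale \<theta> s w * exp_martingale \<theta> t w) (exp (\<theta>\<^sup>2 * s))"
  using exp_martingale_square_mean[OF assms(1)] exp_martingale_measurable_F[OF assms(1) order.refl]
  by (intro has_bochner_integral_mult_exp_martingale[OF assms]) (auto simp: power2_eq_square)

lemma exp_martingale_difference_square_mean:
  assumes "0 \<le> s" "s \<le> t"
  shows "has_bochner_integral M (\<lambda>w. (a * exp_martingale \<theta> t w - b * exp_martingale \<theta> s w)\<^sup>2)
    (exp (\<theta>\<^sup>2 * s) * (a\<^sup>2 * (exp (\<theta>\<^sup>2 * (t - s)) - 1) + (a - b)\<^sup>2))"
proof -
  have "has_bochner_integral M
      (\<lambda>w. a\<^sup>2 * (exp_martingale \<theta> t w)\<^sup>2 - 2 * a * b * (exp_martingale \<theta> s w * exp_martingale \<theta> t w)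
        + b\<^sup>2 * (exp_martingale \<theta> s w)\<^sup>2)
      (a\<^sup>2 * exp (\<theta>\<^sup>2 * t) - 2 * a * b * exp (\<theta>\<^sup>2 * s) + b\<^sup>2 * exp (\<theta>\<^sup>2 * s))"
    using assms
    by (intro has_bochner_integral_add has_bochner_integral_diff has_bochner_integral_mult_right
        exp_martingale_square_mean exp_martingale_mult_mean) auto
  moreover have "exp (\<theta>\<^sup>2 * t) = exp (\<theta>\<^sup>2 * s) * exp (\<theta>\<^sup>2 * (t - s))"
    by (simp add: algebra_simps flip: exp_add)
  ultimately show ?thesis
    by (simp add: power2_diff power_mult_distrib algebra_simps)
qed

end

section \<open>Step processes and the Ito isometry\<close>

lemma step_data_mono:
  assumes "step_data M F n \<tau> \<xi>" "i \<le> j" "j \<le> n"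
  shows "\<tau> i \<le> \<tau> j"
  using assms(2,3)
proof (induction j)
  case (Suc j)
  moreover have "\<tau> j < \<tau> (Suc j)" if "j < n" using assms(1) that by (simp add: step_data_def)
  ultimately show ?case by (cases "i = Suc j") auto
qed simp

lemma step_data_nonneg:
  assumes "step_data M F n \<tau> \<xi>" "i \<le> n"
  shows "0 \<le> \<tau> i"
  using step_data_mono[OF assms(1) _ assms(2), of 0] assms(1) by (simp add: step_data_def)

lemma step_process_eq_coefficient:
  assumes steps: "step_data M F n \<tau> \<xi>" and i: "i < n" "\<tau> i < u" "u \<le> \<tau> (Suc i)"
  shows "step_process n \<tau> \<eta> u w = \<eta> i w"
proof -
  have "\<eta> j w * indicator {\<tau> j<..\<tau> (Suc j)} u = (if j = i then \<eta> i w else 0)" if "j < n" for j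
  proof (cases j i rule: linorder_cases)
    case less
    then have "\<tau> (Suc j) \<le> \<tau> i" using i by (intro step_data_mono[OF steps]) auto
    then show ?thesis using i less by (auto simp: indicator_def)
  next
    case greater
    then have "\<tau> (Suc i) \<le> \<tau> j" using that by (intro step_data_mono[OF steps]) auto
    then show ?thesis using i greater by (auto simp: indicator_def)
  qed (use i in \<open>auto simp: indicator_def\<close>)
  then show ?thesis unfolding step_process_def using i by (simp add: sum.delta')
qed

lemma step_process_square:
  assumes steps: "step_data M F n \<tau> \<xi>"
  shows "(step_process n \<tau> \<xi> u w)\<^sup>2 = step_process n \<tau> (\<lambda>i w. (\<xi> i w)\<^sup>2) u w"
proof (cases "\<exists>i<n. \<tau> i < u \<and> u \<le> \<tau> (Suc i)")
  case True
  then obtain i where "i < n" "\<tau> i < u" "u \<le> \<tau> (Suc i)" by blast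
  note coefficient = step_process_eq_coefficient[OF steps this]
  show ?thesis unfolding coefficient[of \<xi>] coefficient[of "\<lambda>i w. (\<xi> i w)\<^sup>2"] ..
next
  case False
  then have "step_process n \<tau> \<eta> u w = 0" for \<eta>
    unfolding step_process_def by (intro sum.neutral) (auto simp: indicator_def)
  then show ?thesis by simp
qed

lemma has_bochner_integral_indicator_Ioc:
  assumes "0 \<le> T" "0 \<le> a" "a \<le> b"
  shows "has_bochner_integral (lborel_on {0..T}) (indicator {a<..b}) (min T b - min T a)"
proof -
  have "(\<lambda>s. indicator {0..T} s *\<^sub>R indicator {a<..b} s)
      = (indicator {min T a<..min T b} :: real \<Rightarrow> real)"
    using assms by (auto simp: fun_eq_iff indicator_def)
  moreover have "has_bochner_integral lborel (indicator {min T a<..min T b}) (min T b - min T a)"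
    using assms by (simp add: has_bochner_integral_iff min.mono)
  ultimately show ?thesis by (simp add: has_bochner_integral_restrict_space)
qed

lemma (in prob_space) pair_sigma_finite_lborel_on:
  "A \<in> sets borel \<Longrightarrow> pair_sigma_finite M (lborel_on A)"
  by (intro pair_sigma_finite.intro sigma_finite_measure_axioms sigma_finite_measure_lborel_on)

lemma (in prob_space) nn_integral_pair_lborel_on:
  assumes "(\<lambda>(w, t). f w t) \<in> borel_measurable (M \<Otimes>\<^sub>M lborel_on A)" "A \<in> sets borel"
  shows "(\<integral>\<^sup>+w. (\<integral>\<^sup>+t\<in>A. f w t \<partial>lborel) \<partial>M) = (\<integral>\<^sup>+(w, t). f w t \<partial>(M \<Otimes>\<^sub>M lborel_on A))"
    and "(\<integral>\<^sup>+w. (\<integral>\<^sup>+t\<in>A. f w t \<partial>lborel) \<partial>M) = (\<integral>\<^sup>+t\<in>A. (\<integral>\<^sup>+w. f w t \<partial>M) \<partial>lborel)"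
proof -
  interpret P: pair_sigma_finite M "lborel_on A"
    by (rule pair_sigma_finite_lborel_on[OF assms(2)])
  show "(\<integral>\<^sup>+w. (\<integral>\<^sup>+t\<in>A. f w t \<partial>lborel) \<partial>M) = (\<integral>\<^sup>+(w, t). f w t \<partial>(M \<Otimes>\<^sub>M lborel_on A))"
    using P.M2.nn_integral_fst[OF assms(1)] by (simp add: set_nn_integral_lborel_on assms)
  show "(\<integral>\<^sup>+w. (\<integral>\<^sup>+t\<in>A. f w t \<partial>lborel) \<partial>M) = (\<integral>\<^sup>+t\<in>A. (\<integral>\<^sup>+w. f w t \<partial>M) \<partial>lborel)"
    using P.Fubini'[OF assms(1)] by (simp add: set_nn_integral_lborel_on assms)
qed

lemma (in prob_space) step_process_has_integral:
  assumes T: "0 \<le> T" and \<tau>: "\<And>i. i < n \<Longrightarrow> 0 \<le> \<tau> i \<and> \<tau> i \<le> \<tau> (Suc i)"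
    and \<xi>: "\<And>i. i < n \<Longrightarrow> integrable M (\<xi> i)"
  shows "has_bochner_integral (M \<Otimes>\<^sub>M lborel_on {0..T}) (\<lambda>(w, u). step_process n \<tau> \<xi> u w)
    (\<Sum>i<n. expectation (\<xi> i) * (min T (\<tau> (Suc i)) - min T (\<tau> i)))"
proof -
  interpret P: pair_sigma_finite M "lborel_on {0..T}" by (rule pair_sigma_finite_lborel_on) simp
  have "has_bochner_integral (M \<Otimes>\<^sub>M lborel_on {0..T})
      (\<lambda>p. \<Sum>i<n. case p of (w, u) \<Rightarrow> \<xi> i w * indicator {\<tau> i<..\<tau> (Suc i)} u)
      (\<Sum>i<n. expectation (\<xi> i) * (min T (\<tau> (Suc i)) - min T (\<tau> i)))"
    using T \<tau> \<xi>
    by (intro has_bochner_integral_sum P.has_bochner_integral_mult_prod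
        has_bochner_integral_integrable has_bochner_integral_indicator_Ioc) auto
  then show ?thesis by (simp add: step_process_def split_beta')
qed

lemma (in usual_filtered_prob_space) L2_loc_square_integrable:
  assumes "H \<in> L2_loc M F"
  shows "square_integrable (M \<Otimes>\<^sub>M lborel_on {0..T}) (\<lambda>(w, u). H u w)"
proof (rule square_integrableI)
  show m: "(\<lambda>(w, u). H u w) \<in> borel_measurable (M \<Otimes>\<^sub>M lborel_on {0..T})"
    using assms by (intro jointly_measurable_lborel_on) (auto simp: L2_loc_def)
  then have "(\<lambda>(w, u). ennreal ((H u w)\<^sup>2)) \<in> borel_measurable (M \<Otimes>\<^sub>M lborel_on {0..T})"
    by (simp add: split_beta')
  then have "(\<integral>\<^sup>+p. ennreal ((case p of (w, u) \<Rightarrow> H u w)\<^sup>2) \<partial>(M \<Otimes>\<^sub>M lborel_on {0..T}))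
      = (\<integral>\<^sup>+w. (\<integral>\<^sup>+u\<in>{0..T}. ennreal ((H u w)\<^sup>2) \<partial>lborel) \<partial>M)"
    by (subst nn_integral_pair_lborel_on(1)) (auto simp: split_beta')
  also have "\<dots> \<le> (\<integral>\<^sup>+w. (\<integral>\<^sup>+u\<in>{0..max T 1}. ennreal (\<bar>H u w\<bar>\<^sup>2) \<partial>lborel) \<partial>M)"
    by (intro nn_integral_mono) (auto simp: indicator_def)
  also have "\<dots> < \<infinity>" using assms by (auto simp: L2_loc_def)
  finally show "(\<integral>\<^sup>+p. ennreal ((case p of (w, u) \<Rightarrow> H u w)\<^sup>2) \<partial>(M \<Otimes>\<^sub>M lborel_on {0..T})) < \<infinity>" .
qed

context usual_filtered_prob_space
begin

context
  fixes n :: nat and \<tau> :: "nat \<Rightarrow> real" and \<xi> :: "nat \<Rightarrow> 'a \<Rightarrow> real"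
  assumes steps: "step_data M F n \<tau> \<xi>"
begin

lemma step_data_times: "i < n \<Longrightarrow> 0 \<le> \<tau> i \<and> \<tau> i \<le> \<tau> (Suc i)"
  using step_data_nonneg[OF steps, of i] step_data_mono[OF steps, of i "Suc i"] by simp

lemma step_data_square_integrable:
  assumes "i < n"
  shows "square_integrable M (\<xi> i)"
  using assms steps step_data_times[OF assms] measurable_F_M[of "\<tau> i" "\<xi> i" borel]
  by (auto simp: square_integrable_def step_data_def)

lemma step_process_measurable:
  "(\<lambda>(w, u). step_process n \<tau> \<xi> u w) \<in> borel_measurable (M \<Otimes>\<^sub>M lborel_on {0..T})"
proof -
  have "\<xi> i \<in> borel_measurable M" if "i < n" for i
    using step_data_square_integrable[OF that] by (simp add: square_integrable_def)
  then show ?thesis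
    unfolding step_process_def split_beta'
    by (intro borel_measurable_sum borel_measurable_times measurable_compose[OF measurable_fst]
        measurable_compose[OF measurable_snd]) (auto intro: measurable_restrict_space1)
qed

lemma step_process_square_mean:
  assumes T: "0 \<le> T"
  shows "has_bochner_integral (M \<Otimes>\<^sub>M lborel_on {0..T}) (\<lambda>(w, u). (step_process n \<tau> \<xi> u w)\<^sup>2)
    (\<Sum>i<n. expectation (\<lambda>w. (\<xi> i w)\<^sup>2) * (min T (\<tau> (Suc i)) - min T (\<tau> i)))"
  unfolding step_process_square[OF steps]
  using step_data_square_integrable step_data_times
  by (intro step_process_has_integral T) (auto simp: square_integrable_def)

lemma step_process_square_integrable:
  assumes T: "0 \<le> T"
  shows "square_integrable (M \<Otimes>\<^sub>M lborel_on {0..T}) (\<lambda>(w, u). step_process n \<tau> \<xi> u w)"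
  using step_process_measurable step_process_square_mean[OF T]
  by (simp add: square_integrable_def has_bochner_integral_iff split_beta')

end

end

context brownian
begin

lemma add_increment_square_mean:
  fixes S \<xi> :: "'a \<Rightarrow> real" and g :: "real \<Rightarrow> real"
  assumes ab: "0 \<le> a" "a \<le> b"
    and S: "S \<in> borel_measurable (F a)" and \<xi>: "\<xi> \<in> borel_measurable (F a)"
    and g [measurable]: "g \<in> borel_measurable borel"
    and "has_bochner_integral M (\<lambda>w. (S w)\<^sup>2) p" "has_bochner_integral M (\<lambda>w. (\<xi> w)\<^sup>2) q"
    and "has_bochner_integral M (\<lambda>w. g (W b w - W a w)) 0"
    and "has_bochner_integral M (\<lambda>w. (g (W b w - W a w))\<^sup>2) v"
  shows "has_bochner_integral M (\<lambda>w. (S w + \<xi> w * g (W b w - W a w))\<^sup>2) (p + q * v)"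
proof -
  let ?g = "\<lambda>w. g (W b w - W a w)"
  have "square_integrable M S" "square_integrable M \<xi>"
    using assms measurable_F_M[OF ab(1) S] measurable_F_M[OF ab(1) \<xi>]
    by (auto simp: square_integrable_def has_bochner_integral_iff)
  then have "integrable M (\<lambda>w. S w * \<xi> w)" by (rule integrable_mult_square_integrable)
  then have "has_bochner_integral M (\<lambda>w. S w * \<xi> w * ?g w) (expectation (\<lambda>w. S w * \<xi> w) * 0)"
    using S \<xi> by (intro has_bochner_integral_mult_increment[OF ab]
        has_bochner_integral_integrable assms)
      auto
  moreover have "has_bochner_integral M (\<lambda>w. (\<xi> w)\<^sup>2 * (?g w)\<^sup>2) (q * v)"
    using \<xi> assms by (intro has_bochner_integral_mult_increment[OF ab, of _ "\<lambda>x. (g x)\<^sup>2"]) auto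
  ultimately have "has_bochner_integral M
      (\<lambda>w. (S w)\<^sup>2 + 2 * (S w * \<xi> w * ?g w) + (\<xi> w)\<^sup>2 * (?g w)\<^sup>2) (p + 2 * 0 + q * v)"
    by (intro has_bochner_integral_add has_bochner_integral_mult_right assms) auto
  moreover have "(S w)\<^sup>2 + 2 * (S w * \<xi> w * ?g w) + (\<xi> w)\<^sup>2 * (?g w)\<^sup>2 = (S w + \<xi> w * ?g w)\<^sup>2" for w
    by (simp add: power2_eq_square algebra_simps)
  ultimately show ?thesis by simp
qed

lemma sum_orthogonal_increments_square_mean:
  fixes \<tau> :: "nat \<Rightarrow> real" and \<xi> :: "nat \<Rightarrow> 'a \<Rightarrow> real" and g :: "nat \<Rightarrow> real \<Rightarrow> real"
  assumes "0 \<le> \<tau> 0"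
    and "\<And>i. i < n \<Longrightarrow> \<tau> i \<le> \<tau> (Suc i)"
    and "\<And>i. i < n \<Longrightarrow> \<xi> i \<in> borel_measurable (F (\<tau> i))"
    and "\<And>i. i < n \<Longrightarrow> integrable M (\<lambda>w. (\<xi> i w)\<^sup>2)"
    and g [measurable]: "\<And>i. g i \<in> borel_measurable borel"
    and "\<And>i. i < n \<Longrightarrow> has_bochner_integral M (\<lambda>w. g i (W (\<tau> (Suc i)) w - W (\<tau> i) w)) 0"
    and "\<And>i. i < n \<Longrightarrow> has_bochner_integral M (\<lambda>w. (g i (W (\<tau> (Suc i)) w - W (\<tau> i) w))\<^sup>2) (v i)"
  shows "has_bochner_integral M (\<lambda>w. (\<Sum>i<n. \<xi> i w * g i (W (\<tau> (Suc i)) w - W (\<tau> i) w))\<^sup>2)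
      (\<Sum>i<n. expectation (\<lambda>w. (\<xi> i w)\<^sup>2) * v i)"
proof -
  let ?S = "\<lambda>n w. \<Sum>i<n. \<xi> i w * g i (W (\<tau> (Suc i)) w - W (\<tau> i) w)"
  have "0 \<le> \<tau> n \<and> ?S n \<in> borel_measurable (F (\<tau> n)) \<and>
    has_bochner_integral M (\<lambda>w. (?S n w)\<^sup>2) (\<Sum>i<n. expectation (\<lambda>w. (\<xi> i w)\<^sup>2) * v i)"
    using assms(2,3,4,6,7)
  proof (induction n)
    case 0
    then show ?case using assms(1) by (simp add: has_bochner_integral_zero)
  next
    case (Suc n)
    have \<tau>: "0 \<le> \<tau> n" "\<tau> n \<le> \<tau> (Suc n)" and S: "?S n \<in> borel_measurable (F (\<tau> n))"
      and \<xi>: "\<xi> n \<in> borel_measurable (F (\<tau> n))"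
      and square: "has_bochner_integral M (\<lambda>w. (?S n w)\<^sup>2) (\<Sum>i<n. expectation (\<lambda>w. (\<xi> i w)\<^sup>2) * v i)"
      using Suc.IH Suc.prems by auto
    have [measurable]: "?S n \<in> borel_measurable (F (\<tau> (Suc n)))"
      "\<xi> n \<in> borel_measurable (F (\<tau> (Suc n)))"
      "W (\<tau> n) \<in> borel_measurable (F (\<tau> (Suc n)))" "W (\<tau> (Suc n)) \<in> borel_measurable (F (\<tau> (Suc n)))"
      using measurable_F_le[OF \<tau> S] measurable_F_le[OF \<tau> \<xi>] W_measurable_F \<tau> by auto
    have "?S (Suc n) \<in> borel_measurable (F (\<tau> (Suc n)))" by simp
    moreover have "has_bochner_integral M (\<lambda>w. (?S (Suc n) w)\<^sup>2)
        (\<Sum>i<Suc n. expectation (\<lambda>w. (\<xi> i w)\<^sup>2) * v i)"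
      using add_increment_square_mean[OF \<tau> S \<xi> g square has_bochner_integral_integrable]
        Suc.prems by simp
    ultimately show ?case using \<tau> by simp
  qed
  then show ?thesis by blast
qed

lemma exp_martingale_mult_increment_mean:
  assumes ab: "0 \<le> a" "a \<le> b" "b \<le> t"
    and A: "A \<in> borel_measurable (F a)" "integrable M (\<lambda>w. (A w)\<^sup>2)"
  shows "has_bochner_integral M (\<lambda>w. exp_martingale \<theta> t w * (A w * (W b w - W a w)))
    (\<theta> * (expectation (\<lambda>w. exp_martingale \<theta> t w * A w) * (b - a)))"
proof -
  let ?G = "exp_martingale \<theta>"
  define m where "m = expectation (\<lambda>w. A w * ?G a w)"
  have [measurable]: "A \<in> borel_measurable (F b)" "W a \<in> borel_measurable (F b)"
      "W b \<in> borel_measurable (F b)"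
    using measurable_F_le[OF ab(1,2) A(1)] W_measurable_F ab by auto
  have AG: "has_bochner_integral M (\<lambda>w. A w * ?G a w) m"
    unfolding m_def using A ab measurable_F_M[OF ab(1) A(1)]
    by (intro has_bochner_integral_integrable integrable_mult_square_integrable
        exp_martingale_square_integrable) (auto simp: square_integrable_def)
  have "(\<lambda>w. A w * ?G a w) \<in> borel_measurable (F a)"
    using A(1) exp_martingale_measurable_F[OF ab(1) order.refl] by measurable
  then have "has_bochner_integral M
      (\<lambda>w. (A w * ?G a w) * (exp_tilt \<theta> (b - a) (W b w - W a w) * (W b w - W a w))) (m * (\<theta> * (b - a)))"
    by (rule has_bochner_integral_mult_increment[OF ab(1,2) _ _ AG
        exp_tilt_increment_mult_mean[OF ab(1,2)]])
      measurable
  then have "has_bochner_integral M (\<lambda>w. (A w * (W b w - W a w)) * ?G b w) (m * (\<theta> * (b - a)))"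
    by (simp add: exp_martingale_split[of \<theta> b _ a] mult_ac)
  then have "has_bochner_integral M (\<lambda>w. (A w * (W b w - W a w)) * ?G t w) (m * (\<theta> * (b - a)))"
    using ab by (intro has_bochner_integral_mult_exp_martingale[of b t]) auto
  moreover have "has_bochner_integral M (\<lambda>w. A w * ?G t w) m"
    using ab by (intro has_bochner_integral_mult_exp_martingale[OF _ _ A(1) AG]) auto
  ultimately show ?thesis
    by (simp add: has_bochner_integral_iff mult_ac)
qed

context
  fixes n :: nat and \<tau> :: "nat \<Rightarrow> real" and \<xi> :: "nat \<Rightarrow> 'a \<Rightarrow> real" and T :: real
  assumes steps: "step_data M F n \<tau> \<xi>" and T: "0 \<le> T"
begin

lemma step_integral_measurable: "step_integral W n \<tau> \<xi> T \<in> borel_measurable M"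
  unfolding step_integral_def
  using step_data_square_integrable[OF steps] step_data_nonneg[OF steps] T
  by (intro borel_measurable_sum borel_measurable_times borel_measurable_diff W_measurable_M)
    (auto simp: square_integrable_def)

lemma step_integral_square_mean:
  "has_bochner_integral M (\<lambda>w. (step_integral W n \<tau> \<xi> T w)\<^sup>2)
     (\<Sum>i<n. expectation (\<lambda>w. (\<xi> i w)\<^sup>2) * (min T (\<tau> (Suc i)) - min T (\<tau> i)))"
proof -
  let ?t = "\<lambda>i. min T (\<tau> i)"
  let ?\<xi> = "\<lambda>i w. if \<tau> i \<le> T then \<xi> i w else 0"
  have clipped: "0 \<le> ?t i" "?t i \<le> ?t (Suc i)" if "i < n" for i
    using T step_data_times[OF steps that] by (auto intro: min.mono)
  have "has_bochner_integral M (\<lambda>w. (\<Sum>i<n. ?\<xi> i w * (\<lambda>x. x) (W (?t (Suc i)) w - W (?t i) w))\<^sup>2)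
      (\<Sum>i<n. expectation (\<lambda>w. (?\<xi> i w)\<^sup>2) * (?t (Suc i) - ?t i))"
  proof (rule sum_orthogonal_increments_square_mean)
    fix i assume i: "i < n"
    show "?\<xi> i \<in> borel_measurable (F (?t i))" "integrable M (\<lambda>w. (?\<xi> i w)\<^sup>2)"
      using steps i by (cases "\<tau> i \<le> T"; auto simp: step_data_def min_def)+
    show "has_bochner_integral M (\<lambda>w. W (?t (Suc i)) w - W (?t i) w) 0"
      "has_bochner_integral M (\<lambda>w. (W (?t (Suc i)) w - W (?t i) w)\<^sup>2) (?t (Suc i) - ?t i)"
      by (intro increment_mean increment_second_moment clipped i)+
  qed (use T step_data_nonneg[OF steps, of 0] clipped in auto)
  moreover have "\<tau> i \<le> T \<or> ?t (Suc i) = ?t i" if "i < n" for i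
    using step_data_times[OF steps that] by auto
  then have "(\<Sum>i<n. ?\<xi> i w * (W (?t (Suc i)) w - W (?t i) w)) = step_integral W n \<tau> \<xi> T w"
    "(\<Sum>i<n. expectation (\<lambda>w. (?\<xi> i w)\<^sup>2) * (?t (Suc i) - ?t i))
      = (\<Sum>i<n. expectation (\<lambda>w. (\<xi> i w)\<^sup>2) * (?t (Suc i) - ?t i))" for w
    unfolding step_integral_def by (auto intro!: sum.cong) force+
  ultimately show ?thesis by simp
qed

lemma step_integral_square_integrable: "square_integrable M (step_integral W n \<tau> \<xi> T)"
  using step_integral_measurable step_integral_square_mean
  by (simp add: square_integrable_def has_bochner_integral_iff)

lemma step_integral_exp_martingale_pairing:
  assumes t: "T \<le> t"
  shows "expectation (\<lambda>w. exp_martingale \<theta> t w * step_integral W n \<tau> \<xi> T w)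
    = \<theta> * (\<integral>(w, u). exp_martingale \<theta> t w * step_process n \<tau> \<xi> u w \<partial>(M \<Otimes>\<^sub>M lborel_on {0..T}))"
proof -
  let ?G = "exp_martingale \<theta> t"
  let ?E = "\<lambda>i. expectation (\<lambda>w. ?G w * \<xi> i w) * (min T (\<tau> (Suc i)) - min T (\<tau> i))"
  have "has_bochner_integral M
      (\<lambda>w. ?G w * (\<xi> i w * (W (min T (\<tau> (Suc i))) w - W (min T (\<tau> i)) w))) (\<theta> * ?E i)"
    if i: "i < n" for i
  proof (cases "\<tau> i \<le> T")
    case True
    then have "min T (\<tau> i) = \<tau> i" by simp
    then show ?thesis
      using steps i T t True step_data_times[OF steps i]
      by (simp only:) (intro exp_martingale_mult_increment_mean, auto simp: step_data_def)
  next
    case False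
    then show ?thesis using step_data_times[OF steps i] by (simp add: has_bochner_integral_zero)
  qed
  then have "has_bochner_integral M
      (\<lambda>w. \<Sum>i<n. ?G w * (\<xi> i w * (W (min T (\<tau> (Suc i))) w - W (min T (\<tau> i)) w))) (\<Sum>i<n. \<theta> * ?E i)"
    by (intro has_bochner_integral_sum) auto
  then have "expectation (\<lambda>w. ?G w * step_integral W n \<tau> \<xi> T w) = \<theta> * (\<Sum>i<n. ?E i)"
    by (simp add: step_integral_def sum_distrib_left has_bochner_integral_iff)
  moreover have "has_bochner_integral (M \<Otimes>\<^sub>M lborel_on {0..T})
      (\<lambda>(w, u). step_process n \<tau> (\<lambda>i w. ?G w * \<xi> i w) u w) (\<Sum>i<n. ?E i)"
    using T t step_data_times[OF steps] step_data_square_integrable[OF steps]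
    by (intro step_process_has_integral integrable_mult_square_integrable
        exp_martingale_square_integrable) auto
  moreover have "step_process n \<tau> (\<lambda>i w. ?G w * \<xi> i w) u w = ?G w * step_process n \<tau> \<xi> u w" for u w
    by (simp only: step_process_def sum_distrib_left mult.assoc)
  ultimately show ?thesis by (simp add: has_bochner_integral_iff)
qed

end

lemma ito_integral_approximation:
  assumes I: "ito_integral M F W H I" and T: "0 \<le> T"
  obtains n \<tau> \<xi> where "\<And>k::nat. step_data M F (n k) (\<tau> k) (\<xi> k)"
    and "mean_square_tendsto (M \<Otimes>\<^sub>M lborel_on {0..T})
      (\<lambda>k (w, u). step_process (n k) (\<tau> k) (\<xi> k) u w) (\<lambda>(w, u). H u w)"
    and "mean_square_tendsto M (\<lambda>k. step_integral W (n k) (\<tau> k) (\<xi> k) T) (I T)"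
proof -
  let ?Q = "M \<Otimes>\<^sub>M lborel_on {0..T}"
  obtain n \<tau> \<xi> where steps: "\<And>k::nat. step_data M F (n k) (\<tau> k) (\<xi> k)"
    and process: "(\<lambda>k. \<integral>\<^sup>+w. (\<integral>\<^sup>+u\<in>{0..T}.
        ennreal ((step_process (n k) (\<tau> k) (\<xi> k) u w - H u w)\<^sup>2) \<partial>lborel) \<partial>M) \<longlonglongrightarrow> 0"
    and integral: "(\<lambda>k. \<integral>\<^sup>+w. ennreal ((step_integral W (n k) (\<tau> k) (\<xi> k) T w - I T w)\<^sup>2) \<partial>M)
      \<longlonglongrightarrow> 0"
    using I T unfolding ito_integral_def by blast
  have "(\<lambda>(w, u). H u w) \<in> borel_measurable ?Q"
    using I L2_loc_square_integrable by (simp add: ito_integral_def square_integrable_def)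
  then have "(\<integral>\<^sup>+w. (\<integral>\<^sup>+u\<in>{0..T}. ennreal ((step_process (n k) (\<tau> k) (\<xi> k) u w - H u w)\<^sup>2) \<partial>lborel) \<partial>M)
    = (\<integral>\<^sup>+p. ennreal (((\<lambda>(w, u). step_process (n k) (\<tau> k) (\<xi> k) u w) p
        - (\<lambda>(w, u). H u w) p)\<^sup>2) \<partial>?Q)" for k
    using step_process_measurable[OF steps, of k]
    by (subst nn_integral_pair_lborel_on(1)) (auto simp: split_beta')
  with process have "mean_square_tendsto ?Q
      (\<lambda>k (w, u). step_process (n k) (\<tau> k) (\<xi> k) u w) (\<lambda>(w, u). H u w)"
    by (simp add: mean_square_tendsto_def)
  with steps integral show thesis by (intro that) (auto simp: mean_square_tendsto_def)
qed

context
  fixes H I :: "real \<Rightarrow> 'a \<Rightarrow> real" and T :: real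
  assumes I: "ito_integral M F W H I" and T: "0 \<le> T"
begin

lemma ito_integrand_measurable: "(\<lambda>(w, u). H u w) \<in> borel_measurable (M \<Otimes>\<^sub>M lborel_on {0..T})"
  using I L2_loc_square_integrable by (simp add: ito_integral_def square_integrable_def)

lemma ito_integral_measurable: "I T \<in> borel_measurable M"
  using I by (intro adapted_measurable_M T) (simp add: ito_integral_def)

lemma ito_integral_square_integrable: "square_integrable M (I T)"
proof -
  obtain n \<tau> \<xi> where steps: "\<And>k::nat. step_data M F (n k) (\<tau> k) (\<xi> k)"
    and integral: "mean_square_tendsto M (\<lambda>k. step_integral W (n k) (\<tau> k) (\<xi> k) T) (I T)"
    by (rule ito_integral_approximation[OF I T]) (rule that)
  show ?thesis
    by (rule mean_square_limit_square_integrable[OF ito_integral_measurable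
          step_integral_square_integrable[OF steps T] integral])
qed

lemma ito_isometry:
  "expectation (\<lambda>w. (I T w)\<^sup>2) = (\<integral>(w, u). (H u w)\<^sup>2 \<partial>(M \<Otimes>\<^sub>M lborel_on {0..T}))"
proof -
  let ?Q = "M \<Otimes>\<^sub>M lborel_on {0..T}"
  obtain n \<tau> \<xi> where steps: "\<And>k::nat. step_data M F (n k) (\<tau> k) (\<xi> k)"
    and process: "mean_square_tendsto ?Q
      (\<lambda>k (w, u). step_process (n k) (\<tau> k) (\<xi> k) u w) (\<lambda>(w, u). H u w)"
    and integral: "mean_square_tendsto M (\<lambda>k. step_integral W (n k) (\<tau> k) (\<xi> k) T) (I T)"
    by (rule ito_integral_approximation[OF I T]) (rule that)
  have isometry: "(\<integral>p. ((\<lambda>(w, u). step_process (n k) (\<tau> k) (\<xi> k) u w) p)\<^sup>2 \<partial>?Q)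
      = expectation (\<lambda>w. (step_integral W (n k) (\<tau> k) (\<xi> k) T w)\<^sup>2)" for k
    using step_process_square_mean[OF steps T, of k] step_integral_square_mean[OF steps T, of k]
    by (simp add: has_bochner_integral_iff split_beta')
  have processes: "(\<lambda>k. expectation (\<lambda>w. (step_integral W (n k) (\<tau> k) (\<xi> k) T w)\<^sup>2))
      \<longlonglongrightarrow> (\<integral>p. ((\<lambda>(w, u). H u w) p)\<^sup>2 \<partial>?Q)"
    using tendsto_integral_square_mean_square[OF ito_integrand_measurable
        step_process_square_integrable[OF steps T] process]
    unfolding isometry .
  have "(\<lambda>k. expectation (\<lambda>w. (step_integral W (n k) (\<tau> k) (\<xi> k) T w)\<^sup>2))
      \<longlonglongrightarrow> expectation (\<lambda>w. (I T w)\<^sup>2)"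
    by (rule tendsto_integral_square_mean_square[OF ito_integral_measurable
          step_integral_square_integrable[OF steps T] integral])
  from LIMSEQ_unique[OF this processes] show ?thesis by (simp add: split_beta')
qed

lemma ito_integral_exp_martingale_pairing:
  assumes t: "T \<le> t"
  shows "expectation (\<lambda>w. exp_martingale \<theta> t w * I T w)
    = \<theta> * (\<integral>(w, u). exp_martingale \<theta> t w * H u w \<partial>(M \<Otimes>\<^sub>M lborel_on {0..T}))"
proof -
  let ?Q = "M \<Otimes>\<^sub>M lborel_on {0..T}" and ?Z = "exp_martingale \<theta> t"
  interpret P: pair_sigma_finite M "lborel_on {0..T}" by (rule pair_sigma_finite_lborel_on) simp
  obtain n \<tau> \<xi> where steps: "\<And>k::nat. step_data M F (n k) (\<tau> k) (\<xi> k)"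
    and process: "mean_square_tendsto ?Q
      (\<lambda>k (w, u). step_process (n k) (\<tau> k) (\<xi> k) u w) (\<lambda>(w, u). H u w)"
    and integral: "mean_square_tendsto M (\<lambda>k. step_integral W (n k) (\<tau> k) (\<xi> k) T) (I T)"
    by (rule ito_integral_approximation[OF I T]) (rule that)
  have Z: "square_integrable M ?Z" using T t by (intro exp_martingale_square_integrable) simp
  have integrals: "(\<lambda>k. expectation (\<lambda>w. ?Z w * step_integral W (n k) (\<tau> k) (\<xi> k) T w))
      \<longlonglongrightarrow> expectation (\<lambda>w. ?Z w * I T w)"
    by (rule tendsto_integral_mult_mean_square[OF ito_integral_measurable
          step_integral_square_integrable[OF steps T] integral Z])
  have "(\<lambda>k. \<theta> * (\<integral>p. (\<lambda>(w, u). ?Z w) p * (\<lambda>(w, u). step_process (n k) (\<tau> k) (\<xi> k) u w) p \<partial>?Q))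
      \<longlonglongrightarrow> \<theta> * (\<integral>p. (\<lambda>(w, u). ?Z w) p * (\<lambda>(w, u). H u w) p \<partial>?Q)"
    by (intro tendsto_intros tendsto_integral_mult_mean_square[OF ito_integrand_measurable
          step_process_square_integrable[OF steps T] process]
        P.square_integrable_fst Z finite_measure_lborel_on_Icc)
  then have "(\<lambda>k. expectation (\<lambda>w. ?Z w * step_integral W (n k) (\<tau> k) (\<xi> k) T w))
      \<longlonglongrightarrow> \<theta> * (\<integral>(w, u). ?Z w * H u w \<partial>?Q)"
    unfolding step_integral_exp_martingale_pairing[OF steps T t] by (simp add: split_beta')
  with integrals show ?thesis by (rule LIMSEQ_unique)
qed

end

end

section \<open>The budget constraint\<close>

lemma
  fixes f :: "'a \<Rightarrow> real"
  assumes f: "set_integrable N A f" and nonneg: "\<And>x. x \<in> A \<Longrightarrow> 0 \<le> f x"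
  shows set_integral_nonneg: "0 \<le> (LINT x:A|N. f x)"
    and set_nn_integral_eq_set_integral: "(\<integral>\<^sup>+x\<in>A. ennreal (f x) \<partial>N) = ennreal (LINT x:A|N. f x)"
proof -
  have "0 \<le> indicator A x * f x" for x using nonneg by (simp add: indicator_def)
  moreover have "(\<integral>\<^sup>+x\<in>A. ennreal (f x) \<partial>N) = (\<integral>\<^sup>+x. ennreal (indicator A x * f x) \<partial>N)"
    by (intro nn_integral_cong) (simp add: indicator_def)
  ultimately show "0 \<le> (LINT x:A|N. f x)"
    "(\<integral>\<^sup>+x\<in>A. ennreal (f x) \<partial>N) = ennreal (LINT x:A|N. f x)"
    using f by (simp_all add: set_integrable_def set_lebesgue_integral_def nn_integral_eq_integral)
qed

lemma ito_integral_cong_AE: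
  assumes I: "ito_integral M F W H I" and eq: "AE w in M. \<forall>t. W t w = W' t w \<and> I t w = I' t w"
    and "adapted F I'" "continuous_paths M I'"
  shows "ito_integral M F W' H I'"
proof -
  have "(\<integral>\<^sup>+w. ennreal ((step_integral W n \<tau> \<xi> T w - I T w)\<^sup>2) \<partial>M)
    = (\<integral>\<^sup>+w. ennreal ((step_integral W' n \<tau> \<xi> T w - I' T w)\<^sup>2) \<partial>M)" for n \<tau> \<xi> T
    by (rule nn_integral_cong_AE, rule eventually_mono[OF eq]) (simp add: step_integral_def)
  with assms show ?thesis unfolding ito_integral_def by simp
qed

lemma (in usual_filtered_prob_space) ito_integral_continuous_version:
  assumes I: "ito_integral M F W H I"
  obtains J where "ito_integral M F W H J" "\<And>w. w \<in> space M \<Longrightarrow> continuous_on {0..} (\<lambda>t. J t w)"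
    and "AE w in M. \<forall>t. I t w = J t w"
proof -
  obtain J where J: "adapted F J" "\<And>w. w \<in> space M \<Longrightarrow> continuous_on {0..} (\<lambda>t. J t w)"
    and I_eq_J: "AE w in M. \<forall>t. I t w = J t w"
    using adapted_AE_modification[of I "continuous_on {0..}"] I
    by (auto simp: ito_integral_def continuous_paths_def)
  have "continuous_paths M J" unfolding continuous_paths_def using J(2) by (rule AE_I2)
  then have "ito_integral M F W H J" using I_eq_J J(1) by (intro ito_integral_cong_AE[OF I]) auto
  with J(2) I_eq_J show thesis by (intro that)
qed

lemma (in usual_filtered_prob_space) L2_loc_integral_square_mono:
  assumes H: "H \<in> L2_loc M F" and "s \<le> t"
  shows "(\<integral>(w, u). (H u w)\<^sup>2 \<partial>(M \<Otimes>\<^sub>M lborel_on {0..s}))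
      \<le> (\<integral>(w, u). (H u w)\<^sup>2 \<partial>(M \<Otimes>\<^sub>M lborel_on {0..t}))"
proof -
  note sq = L2_loc_square_integrable[OF H]
  have "ennreal (\<integral>(w, u). (H u w)\<^sup>2 \<partial>(M \<Otimes>\<^sub>M lborel_on {0..T}))
      = (\<integral>\<^sup>+w. (\<integral>\<^sup>+u\<in>{0..T}. ennreal ((H u w)\<^sup>2) \<partial>lborel) \<partial>M)" for T
    using nn_integral_square[OF sq[of T]] square_integrable_measurable[OF sq[of T]]
    by (subst nn_integral_pair_lborel_on(1)) (auto simp: split_beta')
  moreover have "(\<integral>\<^sup>+w. (\<integral>\<^sup>+u\<in>{0..s}. ennreal ((H u w)\<^sup>2) \<partial>lborel) \<partial>M)
      \<le> (\<integral>\<^sup>+w. (\<integral>\<^sup>+u\<in>{0..t}. ennreal ((H u w)\<^sup>2) \<partial>lborel) \<partial>M)"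
    using assms(2) by (intro nn_integral_mono) (auto simp: indicator_def)
  ultimately show ?thesis
    by (subst ennreal_le_iff[symmetric]) (auto simp: split_beta' intro!: integral_nonneg_AE)
qed

context prob_space
begin

context
  fixes Y :: "'a \<Rightarrow> real" and f :: "real \<Rightarrow> 'a \<Rightarrow> real" and g :: "real \<Rightarrow> real" and t :: real
  assumes Y: "square_integrable M Y"
    and f: "square_integrable (M \<Otimes>\<^sub>M lborel_on {0..t}) (\<lambda>(w, u). f u w)"
    and g: "continuous_on {0..t} g"
begin

lemma integrable_mult_weighted_process:
  "integrable (M \<Otimes>\<^sub>M lborel_on {0..t}) (\<lambda>(w, u). Y w * (g u * f u w))"
proof -
  interpret P: pair_sigma_finite M "lborel_on {0..t}" by (rule pair_sigma_finite_lborel_on) simp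
  obtain B where [measurable]: "g \<in> borel_measurable (lborel_on {0..t})"
    and B: "\<And>s. s \<in> {0..t} \<Longrightarrow> \<bar>g s\<bar> \<le> B"
    using continuous_on_Icc_bounded_measurable[OF g] by blast
  have "square_integrable (M \<Otimes>\<^sub>M lborel_on {0..t}) (\<lambda>p. g (snd p) * (\<lambda>(w, u). f u w) p)"
    using B by (intro square_integrable_mult_bounded[OF f, where C=B]) (auto simp: space_pair_measure)
  from integrable_mult_square_integrable[OF P.square_integrable_fst[OF Y
      finite_measure_lborel_on_Icc] this]
  show ?thesis by (simp add: split_beta')
qed

lemma integrable_mult_weighted_time_integral:
  "integrable M (\<lambda>w. Y w * (LINT u:{0..t}|lborel. g u * f u w))"
proof -
  interpret P: pair_sigma_finite M "lborel_on {0..t}" by (rule pair_sigma_finite_lborel_on) simp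
  show ?thesis
    using P.integrable_fst[OF integrable_mult_weighted_process]
    by (simp add: set_lebesgue_integral_lborel_on)
qed

lemma expectation_mult_weighted_time_integral:
  "expectation (\<lambda>w. Y w * (LINT u:{0..t}|lborel. g u * f u w))
    = (LINT u:{0..t}|lborel. g u * expectation (\<lambda>w. Y w * f u w))"
proof -
  interpret P: pair_sigma_finite M "lborel_on {0..t}" by (rule pair_sigma_finite_lborel_on) simp
  have "expectation (\<lambda>w. Y w * (g u * f u w)) = g u * expectation (\<lambda>w. Y w * f u w)" for u
    by (simp only: mult.left_commute[of _ "g u"] integral_mult_right_zero)
  then show ?thesis
    using P.Fubini_integral[OF integrable_mult_weighted_process]
    by (simp add: set_lebesgue_integral_lborel_on)
qed

end

lemma square_integrable_process_expectation:
  assumes Y: "square_integrable M Y"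
    and f: "square_integrable (M \<Otimes>\<^sub>M lborel_on {0..t}) (\<lambda>(w, u). f u w)"
  shows "set_integrable lborel {0..t} (\<lambda>u. expectation (\<lambda>w. Y w * f u w))"
    and "(\<integral>(w, u). Y w * f u w \<partial>(M \<Otimes>\<^sub>M lborel_on {0..t}))
      = (LINT u:{0..t}|lborel. expectation (\<lambda>w. Y w * f u w))"
proof -
  interpret P: pair_sigma_finite M "lborel_on {0..t}" by (rule pair_sigma_finite_lborel_on) simp
  have product_integrable: "integrable (M \<Otimes>\<^sub>M lborel_on {0..t}) (\<lambda>(w, u). Y w * f u w)"
    using integrable_mult_weighted_process[OF Y f continuous_on_const[of _ 1]] by simp
  show "set_integrable lborel {0..t} (\<lambda>u. expectation (\<lambda>w. Y w * f u w))"
    using P.integrable_snd[OF product_integrable] by (simp add: set_lebesgue_integral_lborel_on)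
  show "(\<integral>(w, u). Y w * f u w \<partial>(M \<Otimes>\<^sub>M lborel_on {0..t}))
      = (LINT u:{0..t}|lborel. expectation (\<lambda>w. Y w * f u w))"
    using P.integral_snd[OF product_integrable] by (simp add: set_lebesgue_integral_lborel_on)
qed

lemma square_integrable_process_AE_integrable:
  assumes f: "square_integrable (M \<Otimes>\<^sub>M lborel_on {0..t}) (\<lambda>(w, u). f u w)"
  shows "AE w in M. set_integrable lborel {0..t} (\<lambda>u. f u w)"
proof -
  interpret P: pair_sigma_finite M "lborel_on {0..t}" by (rule pair_sigma_finite_lborel_on) simp
  have "square_integrable M (\<lambda>_. 1)" by (simp add: square_integrable_def)
  from P.AE_integrable_fst[OF integrable_mult_weighted_process[OF this f continuous_on_const[of _ 1]]]
  show ?thesis by (simp add: set_lebesgue_integral_lborel_on)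
qed

end

context brownian
begin

context
  fixes H J :: "real \<Rightarrow> 'a \<Rightarrow> real"
  assumes J: "ito_integral M F W H J"
    and J_continuous: "\<And>w. w \<in> space M \<Longrightarrow> continuous_on {0..} (\<lambda>t. J t w)"
begin

lemma ito_integral_process_square_integrable:
  "square_integrable (M \<Otimes>\<^sub>M lborel_on {0..t}) (\<lambda>(w, u). J u w)"
proof -
  interpret P: pair_sigma_finite M "lborel_on {0..t}" by (rule pair_sigma_finite_lborel_on) simp
  have "J u \<in> borel_measurable M" if "0 \<le> u" for u
    using J that by (auto simp: ito_integral_def intro: adapted_measurable_M)
  then have "jointly_measurable M J" by (intro continuous_imp_jointly_measurable J_continuous)
  moreover have "(\<integral>w. (J u w)\<^sup>2 \<partial>M) \<le> (\<integral>(w, u). (H u w)\<^sup>2 \<partial>(M \<Otimes>\<^sub>M lborel_on {0..t}))"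
    if "u \<in> {0..t}" for u
    using ito_isometry[OF J] L2_loc_integral_square_mono[of H u t] J that
    by (auto simp: ito_integral_def)
  ultimately show ?thesis
    by (intro P.square_integrable_slices finite_measure_lborel_on_Icc
        ito_integral_square_integrable[OF J] jointly_measurable_lborel_on) auto
qed

lemma expectation_exp_martingale_mult_ito_integral:
  assumes "0 \<le> s" "s \<le> t"
  shows "expectation (\<lambda>w. exp_martingale \<theta> t w * J s w)
    = \<theta> * (LINT u:{0..s}|lborel. expectation (\<lambda>w. exp_martingale \<theta> t w * H u w))"
proof -
  have "square_integrable (M \<Otimes>\<^sub>M lborel_on {0..s}) (\<lambda>(w, u). H u w)"
    using J by (intro L2_loc_square_integrable) (simp add: ito_integral_def)
  then show ?thesis
    using assms ito_integral_exp_martingale_pairing[OF J assms]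
      square_integrable_process_expectation(2)[OF exp_martingale_square_integrable]
    by simp
qed

lemma ito_integral_discounted_pairing:
  assumes t: "0 \<le> t"
  shows "expectation (\<lambda>w. exp_martingale \<theta> t w
      * (exp (- r * t) * J t w + r * (LINT u:{0..t}|lborel. exp (- r * u) * J u w)))
    = \<theta> * expectation (\<lambda>w. exp_martingale \<theta> t w * (LINT u:{0..t}|lborel. exp (- r * u) * H u w))"
proof -
  let ?Z = "exp_martingale \<theta> t"
  define p where "p u = expectation (\<lambda>w. ?Z w * H u w)" for u
  have Z: "square_integrable M ?Z" by (rule exp_martingale_square_integrable[OF t])
  have H: "square_integrable (M \<Otimes>\<^sub>M lborel_on {0..t}) (\<lambda>(w, u). H u w)"
    using J by (intro L2_loc_square_integrable) (simp add: ito_integral_def)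
  note J_process = ito_integral_process_square_integrable[of t]
  have exp_cont: "continuous_on A (\<lambda>s. exp (- r * s))" for A by (intro continuous_intros)
  note pairing = expectation_exp_martingale_mult_ito_integral[of _ t \<theta>, folded p_def]
  have ZJ_integrable: "integrable M (\<lambda>w. ?Z w * J t w)"
    by (intro integrable_mult_square_integrable Z ito_integral_square_integrable[OF J t])
  have "expectation (\<lambda>w. ?Z w
      * (exp (- r * t) * J t w + r * (LINT u:{0..t}|lborel. exp (- r * u) * J u w)))
    = exp (- r * t) * expectation (\<lambda>w. ?Z w * J t w)
      + r * expectation (\<lambda>w. ?Z w * (LINT u:{0..t}|lborel. exp (- r * u) * J u w))"
    using ZJ_integrable integrable_mult_weighted_time_integral[OF Z J_process exp_cont]
    by (simp only: distrib_left mult.left_commute[of "?Z _"] integral_mult_right_zero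
        integrable_mult_right Bochner_Integration.integral_add)
  also have "expectation (\<lambda>w. ?Z w * (LINT u:{0..t}|lborel. exp (- r * u) * J u w))
      = (LINT u:{0..t}|lborel. \<theta> * (exp (- r * u) * (LINT v:{0..u}|lborel. p v)))"
    unfolding expectation_mult_weighted_time_integral[OF Z J_process exp_cont]
    by (intro set_lebesgue_integral_cong) (auto simp: pairing)
  also have "exp (- r * t) * expectation (\<lambda>w. ?Z w * J t w) + r * \<dots>
      = \<theta> * (exp (- r * t) * (LINT u:{0..t}|lborel. p u)
        + r * (LINT u:{0..t}|lborel. exp (- r * u) * (LINT v:{0..u}|lborel. p v)))"
    by (simp only: pairing[OF t order.refl] set_integral_mult_right) (simp only: algebra_simps)
  also have "\<dots> = \<theta> * (LINT u:{0..t}|lborel. exp (- r * u) * p u)"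
  proof -
    have "set_integrable lborel {0..t} p"
      unfolding p_def by (rule square_integrable_process_expectation(1)[OF Z H])
    then have "exp (- r * t) * (LINT u:{0..t}|lborel. p u) = (LINT u:{0..t}|lborel. exp (- r * u) * p u)
        + (LINT u:{0..t}|lborel. - r * exp (- r * u) * (LINT v:{0..u}|lborel. p v))"
      by (intro integration_by_parts_primitive t)
        (auto intro!: derivative_eq_intros continuous_intros)
    then show ?thesis by (simp only: mult.assoc set_integral_mult_right) simp
  qed
  also have "(LINT u:{0..t}|lborel. exp (- r * u) * p u)
      = expectation (\<lambda>w. ?Z w * (LINT u:{0..t}|lborel. exp (- r * u) * H u w))"
    unfolding p_def by (rule expectation_mult_weighted_time_integral[OF Z H exp_cont, symmetric])
  finally show ?thesis .
qed

lemma ito_integral_financing_mean: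
  assumes t: "0 \<le> t"
  shows "has_bochner_integral M (\<lambda>w. exp_martingale \<theta> t w
    * (x - \<theta> * (LINT u:{0..t}|lborel. exp (- r * u) * H u w)
      + (exp (- r * t) * J t w + r * (LINT u:{0..t}|lborel. exp (- r * u) * J u w)))) x"
proof -
  let ?Z = "exp_martingale \<theta> t"
  let ?A = "\<lambda>w. LINT u:{0..t}|lborel. exp (- r * u) * H u w"
  let ?D = "\<lambda>w. exp (- r * t) * J t w + r * (LINT u:{0..t}|lborel. exp (- r * u) * J u w)"
  have exp_cont: "continuous_on {0..t} (\<lambda>s. exp (- r * s))" by (intro continuous_intros)
  have Z: "square_integrable M ?Z" by (rule exp_martingale_square_integrable[OF t])
  have H: "square_integrable (M \<Otimes>\<^sub>M lborel_on {0..t}) (\<lambda>(w, u). H u w)"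
    using J by (intro L2_loc_square_integrable) (simp add: ito_integral_def)
  have ZA: "integrable M (\<lambda>w. ?Z w * ?A w)"
    by (rule integrable_mult_weighted_time_integral[OF Z H exp_cont])
  have "integrable M (\<lambda>w. exp (- r * t) * (?Z w * J t w)
      + r * (?Z w * (LINT u:{0..t}|lborel. exp (- r * u) * J u w)))"
    by (intro Bochner_Integration.integrable_add integrable_mult_right
        integrable_mult_square_integrable[OF Z ito_integral_square_integrable[OF J t]]
        integrable_mult_weighted_time_integral[OF Z ito_integral_process_square_integrable exp_cont])
  then have "integrable M (\<lambda>w. ?Z w * ?D w)"
    by (simp only: distrib_left mult.left_commute[of "?Z _"])
  then have "has_bochner_integral M (\<lambda>w. ?Z w * ?D w) (\<theta> * expectation (\<lambda>w. ?Z w * ?A w))"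
    using ito_integral_discounted_pairing[OF t, of \<theta> r] by (simp only: has_bochner_integral_iff)
  then have "has_bochner_integral M (\<lambda>w. x * ?Z w - \<theta> * (?Z w * ?A w) + ?Z w * ?D w)
      (x * 1 - \<theta> * expectation (\<lambda>w. ?Z w * ?A w) + \<theta> * expectation (\<lambda>w. ?Z w * ?A w))"
    by (intro has_bochner_integral_add has_bochner_integral_diff has_bochner_integral_mult_right
        exp_martingale_mean t has_bochner_integral_integrable ZA)
  then show ?thesis by (simp add: algebra_simps)
qed

end

lemma discounted_wealth_equation:
  assumes wealth_X: "wealth_process M F W r \<sigma> lam x c \<pi> X" and t: "0 \<le> t"
  obtains J where "ito_integral M F W (\<lambda>t w. \<sigma> * \<pi> t w) J"
    and "\<And>w. w \<in> space M \<Longrightarrow> continuous_on {0..} (\<lambda>t. J t w)"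
    and "AE w in M. set_integrable lborel {0..t} (\<lambda>u. c u w) \<and>
      exp (- r * t) * X t w + (LINT u:{0..t}|lborel. exp (- r * u) * c u w)
        = x + lam * (LINT u:{0..t}|lborel. exp (- r * u) * (\<sigma> * \<pi> u w))
          + (exp (- r * t) * J t w + r * (LINT u:{0..t}|lborel. exp (- r * u) * J u w))"
proof -
  let ?H = "\<lambda>t w. \<sigma> * \<pi> t w"
  obtain I where I: "ito_integral M F W ?H I"
    and X: "continuous_paths M X" "AE w in M. \<forall>t\<ge>0.
      set_integrable lborel {0..t} (\<lambda>s. r * X s w + \<sigma> * lam * \<pi> s w - c s w) \<and>
      X t w = x + (LINT s:{0..t}|lborel. r * X s w + \<sigma> * lam * \<pi> s w - c s w) + I t w"
    using wealth_X unfolding wealth_process_def by blast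
  obtain J where J: "ito_integral M F W ?H J"
      "\<And>w. w \<in> space M \<Longrightarrow> continuous_on {0..} (\<lambda>t. J t w)"
    and I_eq_J: "AE w in M. \<forall>t. I t w = J t w"
    using ito_integral_continuous_version[OF I] by blast
  have "square_integrable (M \<Otimes>\<^sub>M lborel_on {0..t}) (\<lambda>(w, u). ?H u w)"
    using J(1) by (intro L2_loc_square_integrable) (simp add: ito_integral_def)
  from X(2) X(1)[unfolded continuous_paths_def] I_eq_J square_integrable_process_AE_integrable[OF this]
    AE_space
  have "AE w in M. set_integrable lborel {0..t} (\<lambda>u. c u w) \<and>
      exp (- r * t) * X t w + (LINT u:{0..t}|lborel. exp (- r * u) * c u w)
        = x + lam * (LINT u:{0..t}|lborel. exp (- r * u) * ?H u w)
          + (exp (- r * t) * J t w + r * (LINT u:{0..t}|lborel. exp (- r * u) * J u w))"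
  proof eventually_elim
    case (elim w)
    have "r * X s w + \<sigma> * lam * \<pi> s w - c s w = r * X s w + (lam * ?H s w - c s w)" for s by simp
    with elim(1,3) show ?case
      by (intro conjI discounted_linear_integral_equation[OF elim(2) J(2)[OF elim(5)] t elim(4)]; simp)
  qed
  with J show thesis by (intro that)
qed

lemma nn_integral_discounted_consumption_le:
  fixes c :: "real \<Rightarrow> real"
  assumes c: "set_integrable lborel {0..t} c" "\<And>u. u \<in> {0..t} \<Longrightarrow> 0 \<le> c u"
    and y: "0 \<le> y" "y + (LINT u:{0..t}|lborel. exp (- r * u) * c u) = R"
  shows "0 \<le> R" and "(\<integral>\<^sup>+u\<in>{0..t}. ennreal (exp (- r * u) * c u) \<partial>lborel) \<le> ennreal R"
proof -
  have consumption: "set_integrable lborel {0..t} (\<lambda>u. exp (- r * u) * c u)"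
    by (intro set_integrable_continuous_mult c continuous_intros)
  have nonneg: "0 \<le> exp (- r * u) * c u" if "u \<in> {0..t}" for u using c(2)[OF that] by simp
  show "0 \<le> R" using set_integral_nonneg[OF consumption nonneg] y by linarith
  have "(\<integral>\<^sup>+u\<in>{0..t}. ennreal (exp (- r * u) * c u) \<partial>lborel)
      = ennreal (LINT u:{0..t}|lborel. exp (- r * u) * c u)"
    using nonneg by (intro set_nn_integral_eq_set_integral[OF consumption]) auto
  also have "\<dots> \<le> ennreal R" using y by (intro ennreal_leI) linarith
  finally show "(\<integral>\<^sup>+u\<in>{0..t}. ennreal (exp (- r * u) * c u) \<partial>lborel) \<le> ennreal R" .
qed

lemma terminal_budget_constraint:
  assumes wealth_X: "wealth_process M F W r \<sigma> lam x c \<pi> X" and X: "AE w in M. \<forall>t\<ge>0. 0 \<le> X t w"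
    and c: "c \<in> L1_loc_nonneg M F" and t: "0 \<le> t"
  shows "(\<integral>\<^sup>+w. ennreal (exp_martingale (- lam) t w)
      * (\<integral>\<^sup>+u\<in>{0..t}. ennreal (exp (- r * u) * c u w) \<partial>lborel) \<partial>M) \<le> ennreal x"
proof -
  let ?Z = "exp_martingale (- lam) t" and ?H = "\<lambda>t w. \<sigma> * \<pi> t w"
  obtain J where J: "ito_integral M F W ?H J"
      "\<And>w. w \<in> space M \<Longrightarrow> continuous_on {0..} (\<lambda>t. J t w)"
    and wealth: "AE w in M. set_integrable lborel {0..t} (\<lambda>u. c u w) \<and>
      exp (- r * t) * X t w + (LINT u:{0..t}|lborel. exp (- r * u) * c u w)
        = x + lam * (LINT u:{0..t}|lborel. exp (- r * u) * ?H u w)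
          + (exp (- r * t) * J t w + r * (LINT u:{0..t}|lborel. exp (- r * u) * J u w))"
    using discounted_wealth_equation[OF wealth_X t] by blast
  let ?A = "\<lambda>w. LINT u:{0..t}|lborel. exp (- r * u) * ?H u w"
  let ?D = "\<lambda>w. exp (- r * t) * J t w + r * (LINT u:{0..t}|lborel. exp (- r * u) * J u w)"
  let ?R = "\<lambda>w. ?Z w * (x + lam * ?A w + ?D w)"
  have R: "has_bochner_integral M ?R x"
    using ito_integral_financing_mean[OF J t, of "- lam" x r] by simp
  have dominated: "AE w in M. 0 \<le> ?R w \<and> ennreal (?Z w)
      * (\<integral>\<^sup>+u\<in>{0..t}. ennreal (exp (- r * u) * c u w) \<partial>lborel) \<le> ennreal (?R w)"
    using wealth X AE_space
  proof eventually_elim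
    case (elim w)
    have wealth_nonneg: "0 \<le> exp (- r * t) * X t w" using elim(2) t by simp
    have consumption_nonneg: "0 \<le> c u w" if "u \<in> {0..t}" for u
      using c elim(3) that by (simp add: L1_loc_nonneg_def)
    note nn_integral_discounted_consumption_le[OF conjunct1[OF elim(1)] consumption_nonneg
      wealth_nonneg conjunct2[OF elim(1)]]
    then show ?case by (simp add: ennreal_mult' mult_left_mono)
  qed
  have "(\<integral>\<^sup>+w. ennreal (?Z w) * (\<integral>\<^sup>+u\<in>{0..t}. ennreal (exp (- r * u) * c u w) \<partial>lborel) \<partial>M)
      \<le> (\<integral>\<^sup>+w. ennreal (?R w) \<partial>M)"
    using dominated by (intro nn_integral_mono_AE) auto
  also have "\<dots> = ennreal x"
    using R dominated by (subst nn_integral_eq_integral) (auto simp: has_bochner_integral_iff)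
  finally show ?thesis .
qed

definition state_price :: "real \<Rightarrow> real \<Rightarrow> real \<Rightarrow> 'a \<Rightarrow> real" where
  "state_price r lam t w = exp (- r * t) * exp_martingale (- lam) t w"

lemma state_price_mult_measurable:
  assumes c: "jointly_measurable M c" and "A \<subseteq> {0..}"
  shows "(\<lambda>(w, u). ennreal (state_price r lam u w * c u w)) \<in> borel_measurable (M \<Otimes>\<^sub>M lborel_on A)"
proof -
  note [measurable] = jointly_measurable_lborel_on[OF c assms(2)]
    jointly_measurable_lborel_on[OF exp_martingale_jointly_measurable assms(2), of "- lam"]
    measurable_compose[OF measurable_snd measurable_ident_lborel_on, of M A]
  have "(\<lambda>p. ennreal (exp (- r * snd p) * (\<lambda>(w, u). exp_martingale (- lam) u w) p * (\<lambda>(w, u). c u w) p))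
      \<in> borel_measurable (M \<Otimes>\<^sub>M lborel_on A)"
    by measurable
  then show ?thesis by (simp add: state_price_def split_beta')
qed

lemma state_price_consumption_terminal:
  assumes c: "adapted F c" "jointly_measurable M c" and t: "0 \<le> t"
  shows "(\<integral>\<^sup>+u\<in>{0..t}. (\<integral>\<^sup>+w. ennreal (state_price r lam u w * c u w) \<partial>M) \<partial>lborel)
    = (\<integral>\<^sup>+w. ennreal (exp_martingale (- lam) t w)
      * (\<integral>\<^sup>+u\<in>{0..t}. ennreal (exp (- r * u) * c u w) \<partial>lborel) \<partial>M)"
proof -
  let ?Z = "exp_martingale (- lam)"
  let ?f = "\<lambda>w u. ennreal (?Z t w * (exp (- r * u) * c u w))"
  note c_measurable [measurable] = jointly_measurable_lborel_on[OF c(2), of "{0..t}"]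
  note [measurable] = exp_martingale_measurable_M[OF t, of "- lam"]
    measurable_compose[OF measurable_snd measurable_ident_lborel_on, of M "{0..t}"]
  have "(\<lambda>p. ennreal (?Z t (fst p) * (exp (- r * snd p) * (\<lambda>(w, u). c u w) p)))
      \<in> borel_measurable (M \<Otimes>\<^sub>M lborel_on {0..t})"
    by measurable
  then have f: "(\<lambda>(w, u). ?f w u) \<in> borel_measurable (M \<Otimes>\<^sub>M lborel_on {0..t})"
    by (simp add: split_beta')
  have "(\<integral>\<^sup>+w. ennreal (state_price r lam u w * c u w) \<partial>M) = (\<integral>\<^sup>+w. ?f w u \<partial>M)"
    if "u \<in> {0..t}" for u
  proof -
    have "(\<lambda>w. exp (- r * u) * c u w) \<in> borel_measurable (F u)"
      using c(1) that by (auto simp: adapted_def)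
    from nn_integral_mult_exp_martingale[OF _ _ this, of t "- lam"] that show ?thesis
      by (simp add: state_price_def mult_ac)
  qed
  then have "(\<integral>\<^sup>+u\<in>{0..t}. (\<integral>\<^sup>+w. ennreal (state_price r lam u w * c u w) \<partial>M) \<partial>lborel)
      = (\<integral>\<^sup>+u\<in>{0..t}. (\<integral>\<^sup>+w. ?f w u \<partial>M) \<partial>lborel)"
    by (intro nn_integral_cong) (auto simp: indicator_def)
  also have "\<dots> = (\<integral>\<^sup>+w. (\<integral>\<^sup>+u\<in>{0..t}. ?f w u \<partial>lborel) \<partial>M)"
    by (rule nn_integral_pair_lborel_on(2)[OF f, symmetric]) simp
  also have "\<dots> = (\<integral>\<^sup>+w. ennreal (?Z t w) * (\<integral>\<^sup>+u\<in>{0..t}. ennreal (exp (- r * u) * c u w) \<partial>lborel) \<partial>M)"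
  proof (rule nn_integral_cong)
    fix w assume "w \<in> space M"
    have [measurable]: "(\<lambda>u. c u w) \<in> borel_measurable (lborel_on {0..t})"
      using measurable_Pair2[OF c_measurable \<open>w \<in> space M\<close>] by simp
    note [measurable] = measurable_ident_lborel_on[of "{0..t}"]
    show "(\<integral>\<^sup>+u\<in>{0..t}. ?f w u \<partial>lborel)
        = ennreal (?Z t w) * (\<integral>\<^sup>+u\<in>{0..t}. ennreal (exp (- r * u) * c u w) \<partial>lborel)"
      by (simp add: set_nn_integral_lborel_on ennreal_mult' nn_integral_cmult)
  qed
  finally show ?thesis .
qed

theorem budget_constraint:
  assumes wealth_X: "wealth_process M F W r \<sigma> lam x c \<pi> X" and X: "AE w in M. \<forall>t\<ge>0. 0 \<le> X t w"
    and c: "c \<in> L1_loc_nonneg M F"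
  shows "(\<integral>\<^sup>+w. (\<integral>\<^sup>+u\<in>{0..}. ennreal (state_price r lam u w * c u w) \<partial>lborel) \<partial>M) \<le> ennreal x"
proof -
  interpret P: pair_sigma_finite M "lborel_on {0..}" by (rule pair_sigma_finite_lborel_on) simp
  have c': "adapted F c" "jointly_measurable M c"
    using c by (auto simp: L1_loc_nonneg_def L1_loc_def)
  note price = state_price_mult_measurable[OF c'(2) order.refl, of r lam]
  have "(\<integral>\<^sup>+u\<in>{0..}. (\<integral>\<^sup>+w. ennreal (state_price r lam u w * c u w) \<partial>M) \<partial>lborel) \<le> ennreal x"
  proof (rule set_nn_integral_atLeast_le)
    show "(\<lambda>u. \<integral>\<^sup>+w. ennreal (state_price r lam u w * c u w) \<partial>M) \<in> borel_measurable (lborel_on {0..})"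
      using borel_measurable_nn_integral_fst[OF measurable_pair_swap[OF price]]
      by simp
    show "(\<integral>\<^sup>+u\<in>{0..t}. (\<integral>\<^sup>+w. ennreal (state_price r lam u w * c u w) \<partial>M) \<partial>lborel) \<le> ennreal x"
      if "0 \<le> t" for t
      unfolding state_price_consumption_terminal[OF c' that]
      by (rule terminal_budget_constraint[OF wealth_X X c that])
  qed
  then show ?thesis using nn_integral_pair_lborel_on(2)[OF price] by simp
qed

end

section \<open>Left-endpoint approximation\<close>

lemma abs_exp_minus_one_le: "\<bar>exp z - 1\<bar> \<le> \<bar>z\<bar> * exp \<bar>z\<bar>" for z :: real
proof (cases "0 \<le> z")
  case True
  have "exp z * (1 - z) \<le> exp z * exp (- z)"
    using exp_ge_add_one_self[of "- z"] by (intro mult_left_mono) auto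
  with True show ?thesis by (simp add: algebra_simps flip: exp_add)
next
  case False
  have "- z * 1 \<le> - z * exp (- z)" using False by (intro mult_left_mono) auto
  moreover have "1 + z \<le> exp z" by (rule exp_ge_add_one_self)
  ultimately have "1 - exp z \<le> - z * exp (- z)" by linarith
  then show ?thesis using False by simp
qed

lemma exp_minus_one_le:
  fixes y :: real
  assumes "0 \<le> y" "y \<le> Y"
  shows "exp y - 1 \<le> y * exp Y"
proof -
  have "exp y - 1 \<le> y * exp y" using abs_exp_minus_one_le[of y] assms by simp
  also have "\<dots> \<le> y * exp Y" using assms by (intro mult_left_mono) auto
  finally show ?thesis .
qed

lemma exp_second_order_remainder_le:
  fixes y :: real
  assumes "0 \<le> y" "y \<le> Y"
  shows "exp y - 1 - y \<le> y\<^sup>2 * exp Y"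
proof -
  have "exp y * (1 - y) \<le> exp y * exp (- y)"
    using exp_ge_add_one_self[of "- y"] by (intro mult_left_mono) auto
  then have "exp y - 1 - y \<le> y * (exp y - 1)" by (simp add: algebra_simps flip: exp_add)
  also have "\<dots> \<le> y * (y * exp Y)" using assms by (intro mult_left_mono exp_minus_one_le)
  finally show ?thesis by (simp add: power2_eq_square mult.assoc)
qed

lemma abs_exp_mult_diff_le:
  fixes \<delta> :: real
  assumes "0 \<le> s" "s \<le> t" "t \<le> T"
  shows "\<bar>exp (\<delta> * t) - exp (\<delta> * s)\<bar> \<le> \<bar>\<delta>\<bar> * (t - s) * exp (\<bar>\<delta>\<bar> * T)"
proof -
  let ?z = "\<delta> * (t - s)"
  have "\<delta> * s + \<bar>\<delta>\<bar> * (t - s) \<le> \<bar>\<delta>\<bar> * s + \<bar>\<delta>\<bar> * (t - s)"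
    using assms by (intro add_right_mono mult_right_mono) auto
  also have "\<dots> \<le> \<bar>\<delta>\<bar> * T"
    using mult_left_mono[OF assms(3), of "\<bar>\<delta>\<bar>"] by (simp add: algebra_simps)
  finally have exponent: "\<delta> * s + \<bar>\<delta>\<bar> * (t - s) \<le> \<bar>\<delta>\<bar> * T" .
  have "exp (\<delta> * t) - exp (\<delta> * s) = exp (\<delta> * s) * (exp ?z - 1)"
    by (simp add: algebra_simps flip: exp_add)
  then have "\<bar>exp (\<delta> * t) - exp (\<delta> * s)\<bar> = exp (\<delta> * s) * \<bar>exp ?z - 1\<bar>"
    by (simp add: abs_mult)
  also have "\<dots> \<le> exp (\<delta> * s) * (\<bar>?z\<bar> * exp \<bar>?z\<bar>)"
    by (intro mult_left_mono abs_exp_minus_one_le) simp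
  also have "\<dots> = \<bar>\<delta>\<bar> * (t - s) * exp (\<delta> * s + \<bar>\<delta>\<bar> * (t - s))"
    using assms by (simp add: abs_mult exp_add)
  also have "\<dots> \<le> \<bar>\<delta>\<bar> * (t - s) * exp (\<bar>\<delta>\<bar> * T)"
    using assms exponent by (intro mult_left_mono) auto
  finally show ?thesis .
qed

lemma square_mult_exp_le:
  fixes x \<delta> :: real
  assumes "0 \<le> t" "t \<le> T"
  shows "(x * exp (\<delta> * t))\<^sup>2 \<le> (x * exp (\<bar>\<delta>\<bar> * T))\<^sup>2"
proof -
  have "\<delta> * t \<le> \<bar>\<delta>\<bar> * T" using assms by (intro mult_mono) auto
  then show ?thesis unfolding power_mult_distrib by (intro mult_left_mono power_mono) auto
qed

lemma nn_integral_square_sum_le: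
  fixes f :: "nat \<Rightarrow> 'a \<Rightarrow> real"
  assumes f: "\<And>i. i < n \<Longrightarrow> f i \<in> borel_measurable N" and C: "0 \<le> C"
    and bound: "\<And>i. i < n \<Longrightarrow> (\<integral>\<^sup>+x. ennreal ((f i x)\<^sup>2) \<partial>N) \<le> ennreal C"
  shows "(\<integral>\<^sup>+x. ennreal ((\<Sum>i<n. f i x)\<^sup>2) \<partial>N) \<le> ennreal ((real n)\<^sup>2 * C)"
proof -
  have "(\<integral>\<^sup>+x. ennreal ((\<Sum>i<n. f i x)\<^sup>2) \<partial>N)
      \<le> (\<integral>\<^sup>+x. ennreal (real n) * (\<Sum>i<n. ennreal ((f i x)\<^sup>2)) \<partial>N)"
  proof (rule nn_integral_mono)
    fix x
    have "(\<Sum>i<n. f i x)\<^sup>2 \<le> real n * (\<Sum>i<n. (f i x)\<^sup>2)"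
      using sum_squared_le_sum_of_squares[of "\<lambda>i. f i x" "{..<n}"] by (simp add: mult.commute)
    then show "ennreal ((\<Sum>i<n. f i x)\<^sup>2) \<le> ennreal (real n) * (\<Sum>i<n. ennreal ((f i x)\<^sup>2))"
      by (simp add: ennreal_mult[symmetric] sum_nonneg ennreal_leI)
  qed
  also have "\<dots> = ennreal (real n) * (\<Sum>i<n. \<integral>\<^sup>+x. ennreal ((f i x)\<^sup>2) \<partial>N)"
  proof -
    have square_measurable: "(\<lambda>x. ennreal ((f i x)\<^sup>2)) \<in> borel_measurable N" if "i \<in> {..<n}" for i
      using f that by simp
    have "(\<integral>\<^sup>+x. (\<Sum>i<n. ennreal ((f i x)\<^sup>2)) \<partial>N) = (\<Sum>i<n. \<integral>\<^sup>+x. ennreal ((f i x)\<^sup>2) \<partial>N)"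
      by (rule nn_integral_sum[OF square_measurable])
    moreover have "(\<lambda>x. \<Sum>i<n. ennreal ((f i x)\<^sup>2)) \<in> borel_measurable N"
      by (rule borel_measurable_sum[OF square_measurable])
    ultimately show ?thesis by (simp only: nn_integral_cmult)
  qed
  also have "\<dots> \<le> ennreal (real n) * (\<Sum>i<n. ennreal C)"
    using bound by (intro mult_left_mono sum_mono) auto
  also have "\<dots> = ennreal ((real n)\<^sup>2 * C)"
    using C by (simp add: ennreal_mult[symmetric] ennreal_of_nat_eq_real_of_nat
        power2_eq_square mult.assoc)
  finally show ?thesis .
qed

lemma nn_integral_square_add_le:
  fixes f g :: "'a \<Rightarrow> real"
  assumes [measurable]: "f \<in> borel_measurable N" "g \<in> borel_measurable N" and "0 \<le> A" "0 \<le> B"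
    and "(\<integral>\<^sup>+x. ennreal ((f x)\<^sup>2) \<partial>N) \<le> ennreal A" "(\<integral>\<^sup>+x. ennreal ((g x)\<^sup>2) \<partial>N) \<le> ennreal B"
  shows "(\<integral>\<^sup>+x. ennreal ((f x + g x)\<^sup>2) \<partial>N) \<le> ennreal (2 * (A + B))"
proof -
  have square: "(a + b)\<^sup>2 \<le> 2 * (a\<^sup>2 + b\<^sup>2)" for a b :: real
    using zero_le_power2[of "a - b"] by (simp add: power2_eq_square algebra_simps)
  have "(\<integral>\<^sup>+x. ennreal ((f x + g x)\<^sup>2) \<partial>N)
      \<le> (\<integral>\<^sup>+x. ennreal 2 * (ennreal ((f x)\<^sup>2) + ennreal ((g x)\<^sup>2)) \<partial>N)"
  proof (rule nn_integral_mono)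
    fix x
    show "ennreal ((f x + g x)\<^sup>2) \<le> ennreal 2 * (ennreal ((f x)\<^sup>2) + ennreal ((g x)\<^sup>2))"
      using ennreal_leI[OF square[of "f x" "g x"]]
      by (subst ennreal_plus[symmetric]) (auto simp: ennreal_mult')
  qed
  also have "\<dots> = ennreal 2 * ((\<integral>\<^sup>+x. ennreal ((f x)\<^sup>2) \<partial>N) + (\<integral>\<^sup>+x. ennreal ((g x)\<^sup>2) \<partial>N))"
    by (simp add: nn_integral_cmult nn_integral_add del: ennreal_numeral)
  also have "\<dots> \<le> ennreal 2 * (ennreal A + ennreal B)"
    using assms by (intro mult_left_mono add_mono) auto
  also have "\<dots> = ennreal (2 * (A + B))"
    using assms by (subst ennreal_plus[symmetric]) (auto simp: ennreal_mult')
  finally show ?thesis .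
qed

lemma tendsto_0_of_le_divide:
  fixes f :: "nat \<Rightarrow> ennreal"
  assumes "\<And>n. 0 < n \<Longrightarrow> f n \<le> ennreal (C / real n)"
  shows "(\<lambda>k. f (Suc k)) \<longlonglongrightarrow> 0"
proof (rule tendsto_sandwich[OF _ _ tendsto_const])
  have "(\<lambda>k. ennreal (C * inverse (real (Suc k)))) \<longlonglongrightarrow> ennreal 0"
    by (intro tendsto_ennrealI tendsto_mult_right_zero LIMSEQ_inverse_real_of_nat)
  then show "(\<lambda>k. ennreal (C / real (Suc k))) \<longlonglongrightarrow> 0" by (simp add: divide_inverse)
  show "\<forall>\<^sub>F k in sequentially. f (Suc k) \<le> ennreal (C / real (Suc k))"
    by (intro always_eventually allI assms zero_less_Suc)
qed simp

lemma (in prob_space) nn_integral_time_le: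
  assumes f: "(\<lambda>(w, t). f w t) \<in> borel_measurable (M \<Otimes>\<^sub>M lborel_on {a..b})"
    and "a \<le> b" "0 \<le> C"
    and bound: "\<And>t. a < t \<Longrightarrow> t \<le> b \<Longrightarrow> (\<integral>\<^sup>+w. f w t \<partial>M) \<le> ennreal C"
  shows "(\<integral>\<^sup>+w. (\<integral>\<^sup>+t\<in>{a..b}. f w t \<partial>lborel) \<partial>M) \<le> ennreal (C * (b - a))"
proof -
  have "(\<integral>\<^sup>+w. (\<integral>\<^sup>+t\<in>{a..b}. f w t \<partial>lborel) \<partial>M) = (\<integral>\<^sup>+t\<in>{a..b}. (\<integral>\<^sup>+w. f w t \<partial>M) \<partial>lborel)"
    using f by (rule nn_integral_pair_lborel_on(2)) simp
  also have "\<dots> \<le> (\<integral>\<^sup>+t. ennreal C * indicator {a..b} t \<partial>lborel)"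
    by (rule nn_integral_mono_AE, rule eventually_mono[OF AE_lborel_singleton[of a]])
      (auto simp: indicator_def bound)
  also have "\<dots> = ennreal (C * (b - a))"
    using assms by (simp add: nn_integral_cmult ennreal_mult)
  finally show ?thesis .
qed

lemma (in prob_space) nn_integral_square_time_integral_le:
  fixes f :: "'a \<Rightarrow> real \<Rightarrow> real"
  assumes f: "(\<lambda>(w, t). f w t) \<in> borel_measurable (M \<Otimes>\<^sub>M lborel_on {a..b})"
    and ab: "a \<le> b" "0 \<le> C"
    and bound: "\<And>t. a < t \<Longrightarrow> t \<le> b \<Longrightarrow> (\<integral>\<^sup>+w. ennreal ((f w t)\<^sup>2) \<partial>M) \<le> ennreal C"
  shows "(\<integral>\<^sup>+w. ennreal ((LINT t:{a..b}|lborel. f w t)\<^sup>2) \<partial>M) \<le> ennreal (C * (b - a)\<^sup>2)"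
proof -
  have square_measurable: "(\<lambda>(w, t). ennreal ((f w t)\<^sup>2)) \<in> borel_measurable (M \<Otimes>\<^sub>M lborel_on {a..b})"
    using f by (simp add: split_beta')
  have "(\<integral>\<^sup>+w. ennreal ((LINT t:{a..b}|lborel. f w t)\<^sup>2) \<partial>M)
      \<le> (\<integral>\<^sup>+w. ennreal (b - a) * (\<integral>\<^sup>+t\<in>{a..b}. ennreal ((f w t)\<^sup>2) \<partial>lborel) \<partial>M)"
  proof (rule nn_integral_mono)
    fix w assume "w \<in> space M"
    then have "(\<lambda>t. f w t) \<in> borel_measurable (lborel_on {a..b})"
      using measurable_Pair2[OF f] by simp
    from nn_integral_square_integral_le[OF this] ab
    show "ennreal ((LINT t:{a..b}|lborel. f w t)\<^sup>2)
        \<le> ennreal (b - a) * (\<integral>\<^sup>+t\<in>{a..b}. ennreal ((f w t)\<^sup>2) \<partial>lborel)"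
      by (simp add: set_lebesgue_integral_lborel_on set_nn_integral_lborel_on emeasure_restrict_space)
  qed
  also have "\<dots> = ennreal (b - a) * (\<integral>\<^sup>+w. (\<integral>\<^sup>+t\<in>{a..b}. ennreal ((f w t)\<^sup>2) \<partial>lborel) \<partial>M)"
    using sigma_finite_measure.borel_measurable_nn_integral_fst[OF sigma_finite_measure_lborel_on square_measurable]
    by (intro nn_integral_cmult) (simp add: set_nn_integral_lborel_on)
  also have "\<dots> \<le> ennreal (b - a) * ennreal (C * (b - a))"
    using nn_integral_time_le[OF square_measurable ab] bound by (intro mult_left_mono) auto
  also have "\<dots> = ennreal (C * (b - a)\<^sup>2)"
    using ab by (simp add: ennreal_mult'[symmetric] power2_eq_square mult_ac)
  finally show ?thesis .
qed

lemma grid_cell: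
  fixes \<tau> :: "nat \<Rightarrow> real"
  assumes "\<tau> 0 < u" "u \<le> \<tau> n"
  obtains i where "i < n" "\<tau> i < u" "u \<le> \<tau> (Suc i)"
proof -
  have "\<exists>i<n. \<tau> i < u \<and> u \<le> \<tau> (Suc i)"
    using assms
  proof (induction n)
    case (Suc n)
    then show ?case by (cases "u \<le> \<tau> n") (auto intro: less_SucI)
  qed simp
  then show thesis using that by blast
qed

definition uniform_grid :: "real \<Rightarrow> nat \<Rightarrow> nat \<Rightarrow> real" where
  "uniform_grid T n i = real i * (T / real n)"

lemma uniform_grid_0: "uniform_grid T n 0 = 0"
  by (simp add: uniform_grid_def)

lemma uniform_grid_end: "0 < n \<Longrightarrow> uniform_grid T n n = T"
  by (simp add: uniform_grid_def)

lemma uniform_grid_diff: "uniform_grid T n (Suc i) - uniform_grid T n i = T / real n"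
  by (simp add: uniform_grid_def algebra_simps add_divide_distrib)

lemma uniform_grid_nonneg: "0 \<le> T \<Longrightarrow> 0 \<le> uniform_grid T n i"
  by (simp add: uniform_grid_def)

lemma uniform_grid_mono: "0 \<le> T \<Longrightarrow> uniform_grid T n i \<le> uniform_grid T n (Suc i)"
  unfolding uniform_grid_def by (intro mult_right_mono) auto

lemma uniform_grid_le_end:
  assumes "0 \<le> T" "i \<le> n"
  shows "uniform_grid T n i \<le> T"
proof -
  have "real i * T \<le> real n * T" using assms by (intro mult_right_mono) auto
  then show ?thesis using assms by (cases "n = 0") (auto simp: uniform_grid_def field_simps)
qed

lemma (in usual_filtered_prob_space) step_data_uniform_grid:
  assumes T: "0 < T" and "0 < n" and H: "adapted F H" "\<And>t. 0 \<le> t \<Longrightarrow> square_integrable M (H t)"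
  shows "step_data M F n (uniform_grid T n) (\<lambda>i. H (uniform_grid T n i))"
proof -
  have "uniform_grid T n i < uniform_grid T n (Suc i)" for i
    using uniform_grid_diff[of T n i] T \<open>0 < n\<close>
      by (metis diff_gt_0_iff_gt divide_pos_pos of_nat_0_less_iff)
  then show ?thesis
    using H T uniform_grid_nonneg[of T n] by (simp add: step_data_def adapted_def square_integrable_def)
qed

lemma (in usual_filtered_prob_space) left_endpoint_step_process_error:
  assumes T: "0 < T" and n: "0 < n" and K: "0 \<le> K"
    and H: "adapted F H" "jointly_measurable M H" "\<And>t. 0 \<le> t \<Longrightarrow> square_integrable M (H t)"
    and Lipschitz: "\<And>s t. 0 \<le> s \<Longrightarrow> s \<le> t \<Longrightarrow> t \<le> T \<Longrightarrow>
      (\<integral>\<^sup>+w. ennreal ((H t w - H s w)\<^sup>2) \<partial>M) \<le> ennreal (K * (t - s))"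
  defines "\<tau> \<equiv> uniform_grid T n"
  shows "(\<integral>\<^sup>+w. (\<integral>\<^sup>+u\<in>{0..T}. ennreal ((step_process n \<tau> (\<lambda>i. H (\<tau> i)) u w - H u w)\<^sup>2) \<partial>lborel) \<partial>M)
    \<le> ennreal (K * T\<^sup>2 / real n)"
proof -
  let ?P = "step_process n \<tau> (\<lambda>i. H (\<tau> i))"
  have steps: "step_data M F n \<tau> (\<lambda>i. H (\<tau> i))"
    unfolding \<tau>_def using T n H by (intro step_data_uniform_grid)
  have "(\<lambda>(w, u). ?P u w) \<in> borel_measurable (M \<Otimes>\<^sub>M lborel_on {0..T})"
    by (rule step_process_measurable[OF steps])
  moreover have "(\<lambda>(w, u). H u w) \<in> borel_measurable (M \<Otimes>\<^sub>M lborel_on {0..T})"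
    by (intro jointly_measurable_lborel_on H) auto
  ultimately have "(\<lambda>(w, u). ennreal ((?P u w - H u w)\<^sup>2)) \<in> borel_measurable (M \<Otimes>\<^sub>M lborel_on {0..T})"
    by (simp add: split_beta')
  moreover have "(\<integral>\<^sup>+w. ennreal ((?P u w - H u w)\<^sup>2) \<partial>M) \<le> ennreal (K * (T / real n))"
    if u: "0 < u" "u \<le> T" for u
  proof -
    obtain i where i: "i < n" "\<tau> i < u" "u \<le> \<tau> (Suc i)"
      using grid_cell[of \<tau> u n] u n by (auto simp: \<tau>_def uniform_grid_0 uniform_grid_end)
    have "?P u w = H (\<tau> i) w" for w by (rule step_process_eq_coefficient[OF steps i])
    then have "(\<integral>\<^sup>+w. ennreal ((?P u w - H u w)\<^sup>2) \<partial>M) \<le> ennreal (K * (u - \<tau> i))"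
      using Lipschitz[of "\<tau> i" u] i u T by (simp add: power2_commute \<tau>_def uniform_grid_nonneg)
    also have "\<dots> \<le> ennreal (K * (T / real n))"
      using i K uniform_grid_diff[of T n i] unfolding \<tau>_def by (intro ennreal_leI mult_left_mono) auto
    finally show ?thesis .
  qed
  ultimately show ?thesis
    using nn_integral_time_le[of "\<lambda>w u. ennreal ((?P u w - H u w)\<^sup>2)" 0 T "K * (T / real n)"] T K
    by (simp add: power2_eq_square mult.assoc)
qed

section \<open>Geometric Brownian motion\<close>

text \<open>Evaluated at an increment over a cell of length \<open>v\<close>, the remainder is centred with variance
  \<open>O(v\<^sup>2)\<close>, so the sum over a grid of mesh \<open>v\<close> has variance \<open>O(v)\<close>.\<close>

definition exp_tilt_remainder :: "real \<Rightarrow> real \<Rightarrow> real \<Rightarrow> real" where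
  "exp_tilt_remainder \<theta> v y = \<theta> * y + 1 - exp_tilt \<theta> v y"

lemma exp_tilt_remainder_measurable [measurable]: "exp_tilt_remainder \<theta> v \<in> borel_measurable borel"
  unfolding exp_tilt_remainder_def by measurable

context brownian
begin

definition gbm :: "real \<Rightarrow> real \<Rightarrow> real \<Rightarrow> real \<Rightarrow> 'a \<Rightarrow> real" where
  "gbm x \<theta> \<delta> t w = x * exp (\<delta> * t) * exp_martingale \<theta> t w"

lemma gbm_nonneg: "0 \<le> x \<Longrightarrow> 0 \<le> gbm x \<theta> \<delta> t w"
  by (simp add: gbm_def)

lemma gbm_0: "w \<in> space M \<Longrightarrow> gbm x \<theta> \<delta> 0 w = x"
  by (simp add: gbm_def exp_martingale_0)

lemma gbm_scale: "c * gbm x \<theta> \<delta> t w = gbm (c * x) \<theta> \<delta> t w"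
  by (simp add: gbm_def)

lemma gbm_adapted: "adapted F (gbm x \<theta> \<delta>)"
  using exp_martingale_adapted[of \<theta>] unfolding adapted_def gbm_def by auto

lemma gbm_continuous: "w \<in> space M \<Longrightarrow> continuous_on {0..} (\<lambda>t. gbm x \<theta> \<delta> t w)"
  unfolding gbm_def by (intro continuous_intros exp_martingale_continuous)

lemma gbm_jointly_measurable: "jointly_measurable M (gbm x \<theta> \<delta>)"
  by (intro continuous_imp_jointly_measurable adapted_measurable_M[OF gbm_adapted] gbm_continuous)

lemma gbm_square_integrable: "0 \<le> t \<Longrightarrow> square_integrable M (gbm x \<theta> \<delta> t)"
  unfolding gbm_def by (intro square_integrable_cmult exp_martingale_square_integrable)

lemma gbm_square_bound:
  assumes "0 \<le> s" "s \<le> T"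
  shows "expectation (\<lambda>w. (gbm x \<theta> \<delta> s w)\<^sup>2) \<le> x\<^sup>2 * exp (2 * (\<bar>\<delta>\<bar> * T) + \<theta>\<^sup>2 * T)"
proof -
  have "expectation (\<lambda>w. (gbm x \<theta> \<delta> s w)\<^sup>2) = (x * exp (\<delta> * s))\<^sup>2 * exp (\<theta>\<^sup>2 * s)"
    using has_bochner_integral_mult_right[OF exp_martingale_square_mean[OF assms(1), of \<theta>],
        of "(x * exp (\<delta> * s))\<^sup>2"]
    by (simp add: gbm_def power_mult_distrib has_bochner_integral_iff)
  also have "\<dots> = x\<^sup>2 * exp (2 * (\<delta> * s) + \<theta>\<^sup>2 * s)"
    by (simp only: power_mult_distrib exp_add exp_double mult.assoc)
  also have "\<dots> \<le> x\<^sup>2 * exp (2 * (\<bar>\<delta>\<bar> * T) + \<theta>\<^sup>2 * T)"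
  proof -
    have "\<delta> * s \<le> \<bar>\<delta>\<bar> * T" using assms by (intro mult_mono) auto
    moreover have "\<theta>\<^sup>2 * s \<le> \<theta>\<^sup>2 * T" using assms by (intro mult_left_mono) auto
    ultimately show ?thesis by (intro mult_left_mono) auto
  qed
  finally show ?thesis .
qed

lemma gbm_L2_loc: "gbm x \<theta> \<delta> \<in> L2_loc M F"
proof -
  let ?S = "gbm x \<theta> \<delta>"
  have "(\<integral>\<^sup>+w. (\<integral>\<^sup>+t\<in>{0..R}. ennreal (\<bar>?S t w\<bar>\<^sup>2) \<partial>lborel) \<partial>M) < \<infinity>" if "0 < R" for R
  proof -
    let ?C = "x\<^sup>2 * exp (2 * (\<bar>\<delta>\<bar> * R) + \<theta>\<^sup>2 * R)"
    have "(\<lambda>(w, t). ?S t w) \<in> borel_measurable (M \<Otimes>\<^sub>M lborel_on {0..R})"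
      by (intro jointly_measurable_lborel_on gbm_jointly_measurable) auto
    then have "(\<integral>\<^sup>+w. (\<integral>\<^sup>+t\<in>{0..R}. ennreal (\<bar>?S t w\<bar>\<^sup>2) \<partial>lborel) \<partial>M) \<le> ennreal (?C * (R - 0))"
      using that gbm_square_bound[of _ R x \<theta> \<delta>]
      by (intro nn_integral_time_le) (auto simp: split_beta' nn_integral_square
          gbm_square_integrable ennreal_leI)
    also have "\<dots> < \<infinity>" by simp
    finally show ?thesis .
  qed
  then show ?thesis by (simp add: L2_loc_def gbm_adapted gbm_jointly_measurable)
qed

lemma gbm_L1_loc_nonneg:
  assumes x: "0 \<le> x"
  shows "gbm x \<theta> \<delta> \<in> L1_loc_nonneg M F"
proof -
  let ?S = "gbm x \<theta> \<delta>"
  have "(\<integral>\<^sup>+w. (\<integral>\<^sup>+t\<in>{0..R}. ennreal \<bar>?S t w\<bar> \<partial>lborel) \<partial>M) < \<infinity>" if "0 < R" for R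
  proof -
    have "(\<integral>\<^sup>+w. ennreal \<bar>?S t w\<bar> \<partial>M) \<le> ennreal (x * exp (\<bar>\<delta>\<bar> * R))" if "0 < t" "t \<le> R" for t
    proof -
      have "(\<integral>\<^sup>+w. ennreal \<bar>?S t w\<bar> \<partial>M) = ennreal (x * exp (\<delta> * t))"
        using has_bochner_integral_mult_right[OF exp_martingale_mean[of t \<theta>],
            of "x * exp (\<delta> * t)"] x that
        by (simp add: gbm_def abs_mult nn_integral_eq_integral has_bochner_integral_iff)
      also have "\<dots> \<le> ennreal (x * exp (\<bar>\<delta>\<bar> * R))"
        using x that by (intro ennreal_leI mult_left_mono) (auto intro: mult_mono)
      finally show ?thesis .
    qed
    moreover have "(\<lambda>(w, t). ?S t w) \<in> borel_measurable (M \<Otimes>\<^sub>M lborel_on {0..R})"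
      by (intro jointly_measurable_lborel_on gbm_jointly_measurable) auto
    ultimately have "(\<integral>\<^sup>+w. (\<integral>\<^sup>+t\<in>{0..R}. ennreal \<bar>?S t w\<bar> \<partial>lborel) \<partial>M)
        \<le> ennreal (x * exp (\<bar>\<delta>\<bar> * R) * (R - 0))"
      using that x by (intro nn_integral_time_le) (auto simp: split_beta')
    also have "\<dots> < \<infinity>" by simp
    finally show ?thesis .
  qed
  then show ?thesis
    by (simp add: L1_loc_nonneg_def L1_loc_def gbm_adapted gbm_jointly_measurable gbm_nonneg x)
qed

lemma exp_martingale_difference_bound:
  assumes "0 \<le> s" "s \<le> t" "t \<le> T"
  shows "(\<integral>\<^sup>+w. ennreal ((a * exp_martingale \<theta> t w - b * exp_martingale \<theta> s w)\<^sup>2) \<partial>M)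
    \<le> ennreal (exp (\<theta>\<^sup>2 * T) * (a\<^sup>2 * (\<theta>\<^sup>2 * exp (\<theta>\<^sup>2 * T)) * (t - s) + (a - b)\<^sup>2))"
proof -
  have "\<theta>\<^sup>2 * (t - s) \<le> \<theta>\<^sup>2 * T" "\<theta>\<^sup>2 * s \<le> \<theta>\<^sup>2 * T" using assms by (auto intro!: mult_left_mono)
  moreover have "0 \<le> \<theta>\<^sup>2 * (t - s)" using assms by simp
  ultimately have growth: "exp (\<theta>\<^sup>2 * (t - s)) - 1 \<le> \<theta>\<^sup>2 * (t - s) * exp (\<theta>\<^sup>2 * T)"
    "0 \<le> exp (\<theta>\<^sup>2 * (t - s)) - 1" "exp (\<theta>\<^sup>2 * s) \<le> exp (\<theta>\<^sup>2 * T)"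
    using exp_minus_one_le[of "\<theta>\<^sup>2 * (t - s)" "\<theta>\<^sup>2 * T"] by auto
  have "(\<integral>\<^sup>+w. ennreal ((a * exp_martingale \<theta> t w - b * exp_martingale \<theta> s w)\<^sup>2) \<partial>M)
      = ennreal (exp (\<theta>\<^sup>2 * s) * (a\<^sup>2 * (exp (\<theta>\<^sup>2 * (t - s)) - 1) + (a - b)\<^sup>2))"
    using exp_martingale_difference_square_mean[OF assms(1,2), of a \<theta> b]
    by (subst nn_integral_eq_integral) (auto simp: has_bochner_integral_iff)
  also have "\<dots> \<le> ennreal (exp (\<theta>\<^sup>2 * T) * (a\<^sup>2 * (\<theta>\<^sup>2 * (t - s) * exp (\<theta>\<^sup>2 * T)) + (a - b)\<^sup>2))"
    using growth by (intro ennreal_leI mult_mono add_right_mono mult_left_mono add_nonneg_nonneg) auto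
  finally show ?thesis by (simp add: mult_ac)
qed

lemma gbm_mean_square_Lipschitz:
  obtains K where "0 \<le> K"
    and "\<And>s t. 0 \<le> s \<Longrightarrow> s \<le> t \<Longrightarrow> t \<le> T \<Longrightarrow>
      (\<integral>\<^sup>+w. ennreal ((gbm x \<theta> \<delta> t w - gbm x \<theta> \<delta> s w)\<^sup>2) \<partial>M) \<le> ennreal (K * (t - s))"
proof -
  define A where "A = (x * exp (\<bar>\<delta>\<bar> * T))\<^sup>2"
  define B where "B = \<theta>\<^sup>2 * exp (\<theta>\<^sup>2 * T)"
  define K where "K = exp (\<theta>\<^sup>2 * T) * (A * B + A * (\<delta>\<^sup>2 * \<bar>T\<bar>))"
  have AB: "0 \<le> A" "0 \<le> B" by (auto simp: A_def B_def)
  show thesis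
  proof (rule that)
    show "0 \<le> K" unfolding K_def using AB by (intro mult_nonneg_nonneg add_nonneg_nonneg) auto
    fix s t assume st: "0 \<le> s" "s \<le> t" "t \<le> T"
    let ?a = "x * exp (\<delta> * t)" and ?b = "x * exp (\<delta> * s)"
    have "(?a - ?b)\<^sup>2 = x\<^sup>2 * \<bar>exp (\<delta> * t) - exp (\<delta> * s)\<bar>\<^sup>2"
      by (simp add: power_mult_distrib flip: right_diff_distrib)
    also have "\<dots> \<le> x\<^sup>2 * (\<bar>\<delta>\<bar> * (t - s) * exp (\<bar>\<delta>\<bar> * T))\<^sup>2"
      using abs_exp_mult_diff_le[OF st] by (intro mult_left_mono power_mono) auto
    also have "\<dots> = A * (\<delta>\<^sup>2 * (t - s)) * (t - s)"
      by (simp add: A_def power_mult_distrib) (simp add: power2_eq_square)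
    also have "\<dots> \<le> A * (\<delta>\<^sup>2 * \<bar>T\<bar>) * (t - s)"
      using st AB by (intro mult_left_mono mult_right_mono) auto
    finally have "(?a - ?b)\<^sup>2 \<le> A * (\<delta>\<^sup>2 * \<bar>T\<bar>) * (t - s)" .
    moreover have "?a\<^sup>2 * B * (t - s) \<le> A * B * (t - s)"
      unfolding A_def using square_mult_exp_le[of t T x \<delta>] st AB by (intro mult_right_mono) auto
    ultimately have "?a\<^sup>2 * B * (t - s) + (?a - ?b)\<^sup>2 \<le> (A * B + A * (\<delta>\<^sup>2 * \<bar>T\<bar>)) * (t - s)"
      using st by (simp add: distrib_right)
    then have "exp (\<theta>\<^sup>2 * T) * (?a\<^sup>2 * B * (t - s) + (?a - ?b)\<^sup>2) \<le> K * (t - s)"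
      unfolding K_def mult.assoc by (intro mult_left_mono) auto
    then show "(\<integral>\<^sup>+w. ennreal ((gbm x \<theta> \<delta> t w - gbm x \<theta> \<delta> s w)\<^sup>2) \<partial>M) \<le> ennreal (K * (t - s))"
      using exp_martingale_difference_bound[OF st, of ?a \<theta> ?b]
      unfolding gbm_def B_def by (meson ennreal_leI order_trans)
  qed
qed

lemma gbm_discounted_mean_square_Lipschitz:
  obtains K where "0 \<le> K"
    and "\<And>s t. 0 \<le> s \<Longrightarrow> s \<le> t \<Longrightarrow> t \<le> T \<Longrightarrow>
      (\<integral>\<^sup>+w. ennreal ((gbm x \<theta> \<delta> s w - exp (- \<delta> * (t - s)) * gbm x \<theta> \<delta> t w)\<^sup>2) \<partial>M)
        \<le> ennreal (K * (t - s))"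
proof -
  define B where "B = \<theta>\<^sup>2 * exp (\<theta>\<^sup>2 * T)"
  define K where "K = exp (\<theta>\<^sup>2 * T) * ((x * exp (\<bar>\<delta>\<bar> * T))\<^sup>2 * B)"
  have B: "0 \<le> B" by (simp add: B_def)
  show thesis
  proof (rule that)
    show "0 \<le> K" unfolding K_def using B by simp
    fix s t assume st: "0 \<le> s" "s \<le> t" "t \<le> T"
    let ?b = "x * exp (\<delta> * s)"
    have "exp (- \<delta> * (t - s)) * gbm x \<theta> \<delta> t w = ?b * exp_martingale \<theta> t w" for w
      by (simp add: gbm_def algebra_simps flip: exp_add)
    then have "(gbm x \<theta> \<delta> s w - exp (- \<delta> * (t - s)) * gbm x \<theta> \<delta> t w)\<^sup>2
        = (?b * exp_martingale \<theta> t w - ?b * exp_martingale \<theta> s w)\<^sup>2" for w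
      by (simp only: power2_commute gbm_def)
    moreover have "exp (\<theta>\<^sup>2 * T) * (?b\<^sup>2 * B * (t - s)) \<le> K * (t - s)"
      unfolding K_def mult.assoc[of "exp _"] using square_mult_exp_le[of s T x \<delta>] st B
      by (intro mult_left_mono mult_right_mono) auto
    ultimately show "(\<integral>\<^sup>+w. ennreal ((gbm x \<theta> \<delta> s w - exp (- \<delta> * (t - s)) * gbm x \<theta> \<delta> t w)\<^sup>2) \<partial>M)
        \<le> ennreal (K * (t - s))"
      using exp_martingale_difference_bound[OF st, of ?b \<theta> ?b]
      by (simp add: B_def) (meson ennreal_leI order_trans)
  qed
qed

section \<open>The Ito integral of geometric Brownian motion\<close>

definition gbm_martingale_part :: "real \<Rightarrow> real \<Rightarrow> real \<Rightarrow> real \<Rightarrow> 'a \<Rightarrow> real" where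
  "gbm_martingale_part x \<theta> \<delta> t w
    = gbm x \<theta> \<delta> t w - x - \<delta> * (LINT s:{0..t}|lborel. gbm x \<theta> \<delta> s w)"

text \<open>The factor \<open>exp (- \<delta> (b - s))\<close> turns \<open>gbm x \<theta> \<delta> b\<close> into \<open>x exp (\<delta> s)\<close> times the exponential
  martingale at \<open>b\<close>, so that the integrand is a multiple of a martingale difference.\<close>

definition gbm_drift_error :: "real \<Rightarrow> real \<Rightarrow> real \<Rightarrow> real \<Rightarrow> real \<Rightarrow> 'a \<Rightarrow> real" where
  "gbm_drift_error x \<theta> \<delta> a b w
    = (LINT s:{a..b}|lborel. gbm x \<theta> \<delta> s w - exp (- \<delta> * (b - s)) * gbm x \<theta> \<delta> b w)"

lemma gbm_martingale_part_adapted: "adapted F (gbm_martingale_part x \<theta> \<delta>)"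
proof -
  have "(\<lambda>w. LINT s:{0..t}|lborel. gbm x \<theta> \<delta> s w) \<in> borel_measurable (F t)" if "0 \<le> t" for t
    using that by (intro adapted_set_integral gbm_adapted gbm_continuous)
  then show ?thesis
    using gbm_adapted[of x \<theta> \<delta>] unfolding adapted_def gbm_martingale_part_def by auto
qed

lemma gbm_martingale_part_continuous:
  "w \<in> space M \<Longrightarrow> continuous_on {0..} (\<lambda>t. gbm_martingale_part x \<theta> \<delta> t w)"
  unfolding gbm_martingale_part_def
  by (intro continuous_intros gbm_continuous continuous_on_set_integral_atLeast)

lemma gbm_martingale_part_0:
  assumes w: "w \<in> space M"
  shows "gbm_martingale_part x \<theta> \<delta> 0 w = 0"
proof -
  have "(LINT s:{0..0}|lborel. gbm x \<theta> \<delta> s w) = 0"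
    using set_integral_continuous_eq_integral[OF gbm_continuous[OF w, of x \<theta> \<delta>], of 0 0]
    by simp
  then show ?thesis by (simp add: gbm_martingale_part_def gbm_0 w del: atLeastAtMost_singleton)
qed

lemma gbm_martingale_part_diff:
  assumes w: "w \<in> space M" and ab: "0 \<le> a" "a \<le> b"
  shows "gbm_martingale_part x \<theta> \<delta> b w - gbm_martingale_part x \<theta> \<delta> a w
    = gbm x \<theta> \<delta> b w - gbm x \<theta> \<delta> a w - \<delta> * (LINT s:{a..b}|lborel. gbm x \<theta> \<delta> s w)"
  unfolding gbm_martingale_part_def set_integral_continuous_combine[OF gbm_continuous[OF w] ab]
  by (simp add: algebra_simps)

lemma gbm_drift_error_eq:
  assumes w: "w \<in> space M" and ab: "0 \<le> a" "a \<le> b"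
  shows "\<delta> * gbm_drift_error x \<theta> \<delta> a b w
    = \<delta> * (LINT s:{a..b}|lborel. gbm x \<theta> \<delta> s w)
      - gbm x \<theta> \<delta> b w + gbm x \<theta> \<delta> a w * exp_tilt \<theta> (b - a) (W b w - W a w)"
proof -
  let ?S = "\<lambda>s. gbm x \<theta> \<delta> s w"
  have S: "set_integrable lborel {a..b} ?S"
    using ab
    by (intro borel_integrable_atLeastAtMost' continuous_on_subset[OF gbm_continuous[OF w]]) auto
  have discount: "set_integrable lborel {a..b} (\<lambda>s. exp (- \<delta> * (b - s)))"
    by (intro borel_integrable_atLeastAtMost' continuous_intros)
  have "has_bochner_integral (lborel_on {a..b}) (\<lambda>s. \<delta> * exp (- \<delta> * (b - s)))
      (exp (- \<delta> * (b - b)) - exp (- \<delta> * (b - a)))"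
    by (intro integral_has_real_derivative_Icc ab)
      (auto intro!: derivative_eq_intros continuous_intros)
  then have "\<delta> * (LINT s:{a..b}|lborel. exp (- \<delta> * (b - s))) = 1 - exp (- \<delta> * (b - a))"
    by (auto simp: set_lebesgue_integral_lborel_on has_bochner_integral_iff)
  moreover have "gbm_drift_error x \<theta> \<delta> a b w
      = (LINT s:{a..b}|lborel. ?S s) - (LINT s:{a..b}|lborel. exp (- \<delta> * (b - s))) * ?S b"
    unfolding gbm_drift_error_def
    by (simp only: set_integral_diff(2)[OF S set_integrable_mult_left[OF discount]]
        set_integral_mult_left)
  ultimately have "\<delta> * gbm_drift_error x \<theta> \<delta> a b w
      = \<delta> * (LINT s:{a..b}|lborel. ?S s) - (1 - exp (- \<delta> * (b - a))) * ?S b"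
    by (simp only: right_diff_distrib mult.assoc[symmetric])
  moreover have "exp (- \<delta> * (b - a)) * ?S b = ?S a * exp_tilt \<theta> (b - a) (W b w - W a w)"
    unfolding gbm_def exp_martingale_split[of \<theta> b w a]
    by (simp add: algebra_simps flip: exp_add)
  ultimately show ?thesis by (simp only: left_diff_distrib)
qed

lemma gbm_increment_expansion:
  assumes "w \<in> space M" "0 \<le> a" "a \<le> b"
  shows "\<theta> * gbm x \<theta> \<delta> a w * (W b w - W a w)
    = (gbm_martingale_part x \<theta> \<delta> b w - gbm_martingale_part x \<theta> \<delta> a w)
      + gbm x \<theta> \<delta> a w * exp_tilt_remainder \<theta> (b - a) (W b w - W a w)
      + \<delta> * gbm_drift_error x \<theta> \<delta> a b w"
  unfolding gbm_martingale_part_diff[OF assms] gbm_drift_error_eq[OF assms] exp_tilt_remainder_def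
  by (simp add: algebra_simps)

lemma
  assumes st: "0 \<le> s" "s \<le> t"
  shows exp_tilt_remainder_mean:
      "has_bochner_integral M (\<lambda>w. exp_tilt_remainder \<theta> (t - s) (W t w - W s w)) 0"
    and exp_tilt_remainder_square_mean:
      "has_bochner_integral M (\<lambda>w. (exp_tilt_remainder \<theta> (t - s) (W t w - W s w))\<^sup>2)
        (exp (\<theta>\<^sup>2 * (t - s)) - 1 - \<theta>\<^sup>2 * (t - s))"
proof -
  let ?D = "\<lambda>w. W t w - W s w"
  let ?E = "\<lambda>w. exp_tilt \<theta> (t - s) (?D w)"
  have total_mass: "has_bochner_integral M (\<lambda>w. 1::real) 1"
    by (simp add: has_bochner_integral_iff prob_space)
  note moments = increment_mean[OF st] increment_second_moment[OF st] exp_tilt_increment_mean[OF st]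
    exp_tilt_increment_mult_mean[OF st] exp_tilt_increment_square_mean[OF st]
  have "has_bochner_integral M (\<lambda>w. \<theta> * ?D w + 1 - ?E w) (\<theta> * 0 + 1 - 1)"
    by (intro has_bochner_integral_add has_bochner_integral_diff has_bochner_integral_mult_right
        moments total_mass)
  then show "has_bochner_integral M (\<lambda>w. exp_tilt_remainder \<theta> (t - s) (?D w)) 0"
    by (simp add: exp_tilt_remainder_def)
  have "has_bochner_integral M
      (\<lambda>w. \<theta>\<^sup>2 * (?D w)\<^sup>2 + 1 + (?E w)\<^sup>2 + 2 * \<theta> * ?D w - 2 * \<theta> * (?E w * ?D w) - 2 * ?E w)
      (\<theta>\<^sup>2 * (t - s) + 1 + exp (\<theta>\<^sup>2 * (t - s)) + 2 * \<theta> * 0 - 2 * \<theta> * (\<theta> * (t - s)) - 2 * 1)"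
    by (intro has_bochner_integral_add has_bochner_integral_diff has_bochner_integral_mult_right
        moments total_mass)
  moreover have "\<theta>\<^sup>2 * d\<^sup>2 + 1 + e\<^sup>2 + 2 * \<theta> * d - 2 * \<theta> * (e * d) - 2 * e = (\<theta> * d + 1 - e)\<^sup>2" for d e
    by algebra
  ultimately show "has_bochner_integral M (\<lambda>w. (exp_tilt_remainder \<theta> (t - s) (?D w))\<^sup>2)
      (exp (\<theta>\<^sup>2 * (t - s)) - 1 - \<theta>\<^sup>2 * (t - s))"
    by (simp add: exp_tilt_remainder_def power2_eq_square algebra_simps)
qed

lemma gbm_remainder_sum_error:
  fixes T :: real and n :: nat
  assumes T: "0 \<le> T" and n: "0 < n"
  defines "\<tau> \<equiv> uniform_grid T n"
  shows "(\<integral>\<^sup>+w. ennreal ((\<Sum>i<n. gbm x \<theta> \<delta> (\<tau> i) w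
      * exp_tilt_remainder \<theta> (T / real n) (W (\<tau> (Suc i)) w - W (\<tau> i) w))\<^sup>2) \<partial>M)
    \<le> ennreal (x\<^sup>2 * exp (2 * (\<bar>\<delta>\<bar> * T) + \<theta>\<^sup>2 * T) * ((\<theta>\<^sup>2 * T)\<^sup>2 * exp (\<theta>\<^sup>2 * T)) / real n)"
proof -
  let ?S = "gbm x \<theta> \<delta>" and ?y = "\<theta>\<^sup>2 * (T / real n)"
  let ?C = "x\<^sup>2 * exp (2 * (\<bar>\<delta>\<bar> * T) + \<theta>\<^sup>2 * T)"
  have \<tau>: "0 \<le> \<tau> i" "\<tau> i \<le> \<tau> (Suc i)" "\<tau> (Suc i) - \<tau> i = T / real n" for i
    using T by (auto simp: \<tau>_def uniform_grid_nonneg uniform_grid_mono uniform_grid_diff)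
  have "T / real n \<le> T / 1" using T n by (intro divide_left_mono) auto
  then have y: "0 \<le> ?y" "?y \<le> \<theta>\<^sup>2 * T" using T by (simp, intro mult_left_mono) auto
  have "has_bochner_integral M
      (\<lambda>w. (\<Sum>i<n. ?S (\<tau> i) w * exp_tilt_remainder \<theta> (T / real n) (W (\<tau> (Suc i)) w - W (\<tau> i) w))\<^sup>2)
      (\<Sum>i<n. expectation (\<lambda>w. (?S (\<tau> i) w)\<^sup>2) * (exp ?y - 1 - ?y))"
  proof (rule sum_orthogonal_increments_square_mean)
    show "has_bochner_integral M (\<lambda>w. exp_tilt_remainder \<theta> (T / real n)
        (W (\<tau> (Suc i)) w - W (\<tau> i) w)) 0"
      "has_bochner_integral M (\<lambda>w. (exp_tilt_remainder \<theta> (T / real n) (W (\<tau> (Suc i)) w - W (\<tau> i) w))\<^sup>2)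
        (exp ?y - 1 - ?y)" for i
      using exp_tilt_remainder_mean[OF \<tau>(1,2)] exp_tilt_remainder_square_mean[OF \<tau>(1,2)]
      by (auto simp: \<tau>(3))
  qed (use \<tau>(1,2) gbm_adapted[of x \<theta> \<delta>] gbm_square_integrable[of _ x \<theta> \<delta>]
      in \<open>auto simp: adapted_def square_integrable_def\<close>)
  moreover have "(\<Sum>i<n. expectation (\<lambda>w. (?S (\<tau> i) w)\<^sup>2) * (exp ?y - 1 - ?y))
      \<le> (\<Sum>i<n. ?C * (?y\<^sup>2 * exp (\<theta>\<^sup>2 * T)))"
  proof (intro sum_mono mult_mono)
    fix i assume "i \<in> {..<n}"
    then have "\<tau> i \<le> T" using T by (simp add: \<tau>_def uniform_grid_le_end)
    then show "expectation (\<lambda>w. (?S (\<tau> i) w)\<^sup>2) \<le> ?C" by (intro gbm_square_bound \<tau>)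
    show "exp ?y - 1 - ?y \<le> ?y\<^sup>2 * exp (\<theta>\<^sup>2 * T)" by (rule exp_second_order_remainder_le[OF y])
    show "0 \<le> exp ?y - 1 - ?y" using exp_ge_add_one_self[of ?y] by linarith
  qed auto
  moreover have "(\<Sum>i<n. ?C * (?y\<^sup>2 * exp (\<theta>\<^sup>2 * T))) = ?C * ((\<theta>\<^sup>2 * T)\<^sup>2 * exp (\<theta>\<^sup>2 * T)) / real n"
    using n by (simp add: power2_eq_square field_simps)
  ultimately show ?thesis
    by (subst nn_integral_eq_integral) (auto simp: has_bochner_integral_iff intro!: ennreal_leI)
qed

lemma gbm_drift_error_process_measurable:
  assumes "0 \<le> a" "a \<le> b"
  shows "(\<lambda>(w, s). gbm x \<theta> \<delta> s w - exp (- \<delta> * (b - s)) * gbm x \<theta> \<delta> b w)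
    \<in> borel_measurable (M \<Otimes>\<^sub>M lborel_on {a..b})"
proof -
  have b: "0 \<le> b" and ab: "{a..b} \<subseteq> {0..}" using assms by auto
  note [measurable] = jointly_measurable_lborel_on[OF gbm_jointly_measurable[of x \<theta> \<delta>] ab]
    measurable_compose[OF measurable_snd measurable_ident_lborel_on, of M "{a..b}"]
    adapted_measurable_M[OF gbm_adapted b, of x \<theta> \<delta>]
  have "(\<lambda>p. (\<lambda>(w, s). gbm x \<theta> \<delta> s w) p - exp (- \<delta> * (b - snd p)) * gbm x \<theta> \<delta> b (fst p))
    \<in> borel_measurable (M \<Otimes>\<^sub>M lborel_on {a..b})"
    by measurable
  then show ?thesis by (simp add: split_beta')
qed

lemma gbm_drift_error_measurable:
  assumes "0 \<le> a" "a \<le> b"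
  shows "gbm_drift_error x \<theta> \<delta> a b \<in> borel_measurable M"
  using sigma_finite_measure.borel_measurable_lebesgue_integral[OF sigma_finite_measure_lborel_on
      gbm_drift_error_process_measurable[OF assms]]
  by (simp add: gbm_drift_error_def[abs_def] set_lebesgue_integral_lborel_on)

lemma gbm_drift_sum_error:
  fixes T :: real and n :: nat
  assumes T: "0 \<le> T" and n: "0 < n" and K: "0 \<le> K"
    and Lipschitz: "\<And>s t. 0 \<le> s \<Longrightarrow> s \<le> t \<Longrightarrow> t \<le> T \<Longrightarrow>
      (\<integral>\<^sup>+w. ennreal ((gbm x \<theta> \<delta> s w - exp (- \<delta> * (t - s)) * gbm x \<theta> \<delta> t w)\<^sup>2) \<partial>M)
        \<le> ennreal (K * (t - s))"
  defines "\<tau> \<equiv> uniform_grid T n"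
  shows "(\<integral>\<^sup>+w. ennreal ((\<delta> * (\<Sum>i<n. gbm_drift_error x \<theta> \<delta> (\<tau> i) (\<tau> (Suc i)) w))\<^sup>2) \<partial>M)
    \<le> ennreal (\<delta>\<^sup>2 * (K * T ^ 3) / real n)"
proof -
  let ?h = "T / real n" and ?sum = "\<lambda>w. \<Sum>i<n. gbm_drift_error x \<theta> \<delta> (\<tau> i) (\<tau> (Suc i)) w"
  have \<tau>: "0 \<le> \<tau> i" "\<tau> i \<le> \<tau> (Suc i)" "\<tau> (Suc i) - \<tau> i = ?h" for i
    using T by (auto simp: \<tau>_def uniform_grid_nonneg uniform_grid_mono uniform_grid_diff)
  have "(\<integral>\<^sup>+w. ennreal ((gbm_drift_error x \<theta> \<delta> (\<tau> i) (\<tau> (Suc i)) w)\<^sup>2) \<partial>M) \<le> ennreal (K * ?h * ?h\<^sup>2)"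
    if "i < n" for i
  proof -
    have \<tau>_le: "\<tau> (Suc i) \<le> T"
      using T that by (simp add: \<tau>_def uniform_grid_le_end)
    have "(\<integral>\<^sup>+w. ennreal ((gbm x \<theta> \<delta> s w - exp (- \<delta> * (\<tau> (Suc i) - s)) * gbm x \<theta> \<delta> (\<tau> (Suc i)) w)\<^sup>2) \<partial>M)
        \<le> ennreal (K * ?h)" if "\<tau> i < s" "s \<le> \<tau> (Suc i)" for s
    proof -
      have "K * (\<tau> (Suc i) - s) \<le> K * ?h" using that \<tau>(3)[of i] K by (intro mult_left_mono) auto
      then show ?thesis
        using Lipschitz[of s "\<tau> (Suc i)"] that \<tau>(1)[of i] \<tau>_le by (auto intro: order_trans ennreal_leI)
    qed
    then have "(\<integral>\<^sup>+w. ennreal ((gbm_drift_error x \<theta> \<delta> (\<tau> i) (\<tau> (Suc i)) w)\<^sup>2) \<partial>M)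
        \<le> ennreal (K * ?h * (\<tau> (Suc i) - \<tau> i)\<^sup>2)"
      unfolding gbm_drift_error_def using T K
      by (intro nn_integral_square_time_integral_le gbm_drift_error_process_measurable \<tau>) auto
    then show ?thesis by (simp only: \<tau>(3))
  qed
  then have "(\<integral>\<^sup>+w. ennreal ((?sum w)\<^sup>2) \<partial>M) \<le> ennreal ((real n)\<^sup>2 * (K * ?h * ?h\<^sup>2))"
    using T K by (intro nn_integral_square_sum_le gbm_drift_error_measurable \<tau>) auto
  also have "(real n)\<^sup>2 * (K * ?h * ?h\<^sup>2) = K * T ^ 3 / real n"
    using n by (simp add: power2_eq_square power3_eq_cube field_simps)
  finally have sum_bound: "(\<integral>\<^sup>+w. ennreal ((?sum w)\<^sup>2) \<partial>M) \<le> ennreal (K * T ^ 3 / real n)" .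
  have "(\<integral>\<^sup>+w. ennreal ((\<delta> * ?sum w)\<^sup>2) \<partial>M) = ennreal (\<delta>\<^sup>2) * (\<integral>\<^sup>+w. ennreal ((?sum w)\<^sup>2) \<partial>M)"
    by (simp only: power_mult_distrib ennreal_mult zero_le_power2)
      (intro nn_integral_cmult measurable_compose[OF _ measurable_ennreal] borel_measurable_power
        borel_measurable_sum gbm_drift_error_measurable \<tau>)
  also have "\<dots> \<le> ennreal (\<delta>\<^sup>2) * ennreal (K * T ^ 3 / real n)"
    by (intro mult_left_mono sum_bound) simp
  also have "\<dots> = ennreal (\<delta>\<^sup>2 * (K * T ^ 3) / real n)"
    using T K by (subst ennreal_mult[symmetric]) auto
  finally show ?thesis .
qed

lemma gbm_step_integral_expansion:
  fixes T :: real and n :: nat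
  assumes w: "w \<in> space M" and T: "0 < T" and n: "0 < n"
  defines "\<tau> \<equiv> uniform_grid T n"
  shows "step_integral W n \<tau> (\<lambda>i. gbm (\<theta> * x) \<theta> \<delta> (\<tau> i)) T w - gbm_martingale_part x \<theta> \<delta> T w
    = (\<Sum>i<n. gbm x \<theta> \<delta> (\<tau> i) w
        * exp_tilt_remainder \<theta> (T / real n) (W (\<tau> (Suc i)) w - W (\<tau> i) w))
      + \<delta> * (\<Sum>i<n. gbm_drift_error x \<theta> \<delta> (\<tau> i) (\<tau> (Suc i)) w)"
proof -
  let ?J = "gbm_martingale_part x \<theta> \<delta>"
  have \<tau>: "0 \<le> \<tau> i" "\<tau> i \<le> \<tau> (Suc i)" "\<tau> (Suc i) - \<tau> i = T / real n" for i
    using T by (auto simp: \<tau>_def uniform_grid_nonneg uniform_grid_mono uniform_grid_diff)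
  have \<tau>_le: "\<tau> i \<le> T" if "i \<le> n" for i
    using T that by (simp add: \<tau>_def uniform_grid_le_end)
  let ?R = "\<lambda>i. gbm x \<theta> \<delta> (\<tau> i) w * exp_tilt_remainder \<theta> (T / real n) (W (\<tau> (Suc i)) w - W (\<tau> i) w)"
  let ?D = "\<lambda>i. gbm_drift_error x \<theta> \<delta> (\<tau> i) (\<tau> (Suc i)) w"
  have "step_integral W n \<tau> (\<lambda>i. gbm (\<theta> * x) \<theta> \<delta> (\<tau> i)) T w
      = (\<Sum>i<n. \<theta> * gbm x \<theta> \<delta> (\<tau> i) w * (W (\<tau> (Suc i)) w - W (\<tau> i) w))"
    unfolding step_integral_def using \<tau>_le by (intro sum.cong) (auto simp: gbm_scale)
  also have "\<dots> = (\<Sum>i<n. (?J (\<tau> (Suc i)) w - ?J (\<tau> i) w) + ?R i + \<delta> * ?D i)"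
    using gbm_increment_expansion[OF w \<tau>(1,2)] by (intro sum.cong refl) (simp only: \<tau>(3))
  also have "\<dots> = (\<Sum>i<n. ?J (\<tau> (Suc i)) w - ?J (\<tau> i) w) + (\<Sum>i<n. ?R i) + \<delta> * (\<Sum>i<n. ?D i)"
    by (simp only: sum.distrib sum_distrib_left)
  also have "(\<Sum>i<n. ?J (\<tau> (Suc i)) w - ?J (\<tau> i) w) = ?J T w"
    using sum_lessThan_telescope[of "\<lambda>i. ?J (\<tau> i) w" n] n w
    by (simp add: \<tau>_def uniform_grid_0 uniform_grid_end gbm_martingale_part_0)
  finally show ?thesis by simp
qed

lemma gbm_step_integral_error:
  fixes T :: real
  assumes T: "0 < T"
  obtains C where "\<And>n. 0 < n \<Longrightarrow>
    (\<integral>\<^sup>+w. ennreal ((step_integral W n (uniform_grid T n) (\<lambda>i. gbm (\<theta> * x) \<theta> \<delta> (uniform_grid T n i)) T w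
      - gbm_martingale_part x \<theta> \<delta> T w)\<^sup>2) \<partial>M) \<le> ennreal (C / real n)"
proof -
  obtain K where K: "0 \<le> K" "\<And>s t. 0 \<le> s \<Longrightarrow> s \<le> t \<Longrightarrow> t \<le> T \<Longrightarrow>
      (\<integral>\<^sup>+w. ennreal ((gbm x \<theta> \<delta> s w - exp (- \<delta> * (t - s)) * gbm x \<theta> \<delta> t w)\<^sup>2) \<partial>M)
        \<le> ennreal (K * (t - s))"
    by (rule gbm_discounted_mean_square_Lipschitz[of T x \<theta> \<delta>]) (rule that)
  define A where "A = x\<^sup>2 * exp (2 * (\<bar>\<delta>\<bar> * T) + \<theta>\<^sup>2 * T) * ((\<theta>\<^sup>2 * T)\<^sup>2 * exp (\<theta>\<^sup>2 * T))"
  define B where "B = \<delta>\<^sup>2 * (K * T ^ 3)"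
  have AB: "0 \<le> A" "0 \<le> B" using T K(1) by (auto simp: A_def B_def)
  show thesis
  proof (rule that[of "2 * (A + B)"])
    fix n :: nat assume n: "0 < n"
    let ?\<tau> = "uniform_grid T n"
    define R where "R w = (\<Sum>i<n. gbm x \<theta> \<delta> (?\<tau> i) w
        * exp_tilt_remainder \<theta> (T / real n) (W (?\<tau> (Suc i)) w - W (?\<tau> i) w))" for w
    define D where "D w = (\<Sum>i<n. gbm_drift_error x \<theta> \<delta> (?\<tau> i) (?\<tau> (Suc i)) w)" for w
    have \<tau>: "0 \<le> ?\<tau> i" "?\<tau> i \<le> ?\<tau> (Suc i)" for i
      using T by (auto simp: uniform_grid_nonneg uniform_grid_mono)
    have [measurable]: "R \<in> borel_measurable M"
      unfolding R_def
      by (intro borel_measurable_sum borel_measurable_times borel_measurable_diff \<tau> W_measurable_M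
          adapted_measurable_M[OF gbm_adapted] measurable_compose[OF _ exp_tilt_remainder_measurable])
    have [measurable]: "D \<in> borel_measurable M"
      unfolding D_def by (intro borel_measurable_sum gbm_drift_error_measurable \<tau>)
    have "(\<integral>\<^sup>+w. ennreal ((R w)\<^sup>2) \<partial>M) \<le> ennreal (A / real n)"
      unfolding R_def A_def using T n by (intro gbm_remainder_sum_error) auto
    moreover have "(\<integral>\<^sup>+w. ennreal ((\<delta> * D w)\<^sup>2) \<partial>M) \<le> ennreal (B / real n)"
      unfolding D_def B_def using T n K by (intro gbm_drift_sum_error) auto
    ultimately have "(\<integral>\<^sup>+w. ennreal ((R w + \<delta> * D w)\<^sup>2) \<partial>M) \<le> ennreal (2 * (A / real n + B / real n))"
      using AB by (intro nn_integral_square_add_le) auto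
    moreover have "step_integral W n ?\<tau> (\<lambda>i. gbm (\<theta> * x) \<theta> \<delta> (?\<tau> i)) T w - gbm_martingale_part x \<theta> \<delta> T w
        = R w + \<delta> * D w" if "w \<in> space M" for w
      unfolding R_def D_def by (rule gbm_step_integral_expansion[OF that T n])
    ultimately show "(\<integral>\<^sup>+w. ennreal ((step_integral W n ?\<tau> (\<lambda>i. gbm (\<theta> * x) \<theta> \<delta> (?\<tau> i)) T w
        - gbm_martingale_part x \<theta> \<delta> T w)\<^sup>2) \<partial>M) \<le> ennreal (2 * (A + B) / real n)"
      by (simp add: add_divide_distrib cong: nn_integral_cong_simp)
  qed
qed

lemma gbm_ito_integral_approximation:
  fixes T x \<theta> \<delta> :: real
  assumes T: "0 < T"
  defines "\<tau> \<equiv> \<lambda>k. uniform_grid T (Suc k)" and "\<xi> \<equiv> \<lambda>k i. gbm (\<theta> * x) \<theta> \<delta> (uniform_grid T (Suc k) i)"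
  shows "step_data M F (Suc k) (\<tau> k) (\<xi> k)"
    and "(\<lambda>k. \<integral>\<^sup>+w. (\<integral>\<^sup>+t\<in>{0..T}.
        ennreal ((step_process (Suc k) (\<tau> k) (\<xi> k) t w - gbm (\<theta> * x) \<theta> \<delta> t w)\<^sup>2) \<partial>lborel) \<partial>M) \<longlonglongrightarrow> 0"
    and "(\<lambda>k. \<integral>\<^sup>+w. ennreal ((step_integral W (Suc k) (\<tau> k) (\<xi> k) T w
        - gbm_martingale_part x \<theta> \<delta> T w)\<^sup>2) \<partial>M) \<longlonglongrightarrow> 0"
proof -
  let ?H = "gbm (\<theta> * x) \<theta> \<delta>"
  show "step_data M F (Suc k) (\<tau> k) (\<xi> k)"
    unfolding \<tau>_def \<xi>_def
    by (intro step_data_uniform_grid T zero_less_Suc gbm_adapted gbm_square_integrable)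
  obtain K where K: "0 \<le> K" "\<And>s t. 0 \<le> s \<Longrightarrow> s \<le> t \<Longrightarrow> t \<le> T \<Longrightarrow>
      (\<integral>\<^sup>+w. ennreal ((?H t w - ?H s w)\<^sup>2) \<partial>M) \<le> ennreal (K * (t - s))"
    by (rule gbm_mean_square_Lipschitz[of T "\<theta> * x" \<theta> \<delta>]) (rule that)
  show "(\<lambda>k. \<integral>\<^sup>+w. (\<integral>\<^sup>+t\<in>{0..T}.
      ennreal ((step_process (Suc k) (\<tau> k) (\<xi> k) t w - ?H t w)\<^sup>2) \<partial>lborel) \<partial>M) \<longlonglongrightarrow> 0"
    unfolding \<tau>_def \<xi>_def
    by (rule tendsto_0_of_le_divide, rule left_endpoint_step_process_error[OF T _ K(1) _ _ _ K(2)])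
      (auto intro: gbm_adapted gbm_jointly_measurable gbm_square_integrable)
  obtain C where "\<And>n. 0 < n \<Longrightarrow> (\<integral>\<^sup>+w. ennreal ((step_integral W n (uniform_grid T n)
      (\<lambda>i. ?H (uniform_grid T n i)) T w - gbm_martingale_part x \<theta> \<delta> T w)\<^sup>2) \<partial>M) \<le> ennreal (C / real n)"
    by (rule gbm_step_integral_error[OF T, of \<theta> x \<delta>]) (rule that)
  then show "(\<lambda>k. \<integral>\<^sup>+w. ennreal ((step_integral W (Suc k) (\<tau> k) (\<xi> k) T w
      - gbm_martingale_part x \<theta> \<delta> T w)\<^sup>2) \<partial>M) \<longlonglongrightarrow> 0"
    unfolding \<tau>_def \<xi>_def by (rule tendsto_0_of_le_divide)
qed

lemma gbm_ito_integral: "ito_integral M F W (gbm (\<theta> * x) \<theta> \<delta>) (gbm_martingale_part x \<theta> \<delta>)"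
  unfolding ito_integral_def
proof (intro conjI allI impI)
  show "gbm (\<theta> * x) \<theta> \<delta> \<in> L2_loc M F" by (rule gbm_L2_loc)
  show "adapted F (gbm_martingale_part x \<theta> \<delta>)" by (rule gbm_martingale_part_adapted)
  show "continuous_paths M (gbm_martingale_part x \<theta> \<delta>)"
    unfolding continuous_paths_def by (intro AE_I2 gbm_martingale_part_continuous)
  fix T :: real assume "0 \<le> T"
  show "\<exists>n \<tau> \<xi>. (\<forall>k::nat. step_data M F (n k) (\<tau> k) (\<xi> k)) \<and>
      (\<lambda>k. \<integral>\<^sup>+w. (\<integral>\<^sup>+t\<in>{0..T}.
        ennreal ((step_process (n k) (\<tau> k) (\<xi> k) t w - gbm (\<theta> * x) \<theta> \<delta> t w)\<^sup>2) \<partial>lborel) \<partial>M)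
        \<longlonglongrightarrow> 0 \<and>
      (\<lambda>k. \<integral>\<^sup>+w. ennreal ((step_integral W (n k) (\<tau> k) (\<xi> k) T w - gbm_martingale_part x \<theta> \<delta> T w)\<^sup>2) \<partial>M)
        \<longlonglongrightarrow> 0"
  proof (cases "T = 0")
    case True
    have "(\<integral>\<^sup>+w. ennreal ((step_integral W 0 (\<lambda>_. 0) (\<lambda>_ _. 0) T w
        - gbm_martingale_part x \<theta> \<delta> T w)\<^sup>2) \<partial>M)
        = (\<integral>\<^sup>+w. 0 \<partial>M)"
      by (intro nn_integral_cong) (simp add: True step_integral_def gbm_martingale_part_0)
    moreover have "(\<integral>\<^sup>+t\<in>{0..T}. f t \<partial>lborel) = 0" for f :: "real \<Rightarrow> ennreal"
      using AE_lborel_singleton[of 0]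
      by (subst nn_integral_cong_AE[where v="\<lambda>_. 0"])
        (auto elim!: eventually_mono simp: True indicator_def)
    ultimately show ?thesis
      by (intro exI[of _ "\<lambda>_. 0"] exI[of _ "\<lambda>_ _. 0"] exI[of _ "\<lambda>_ _ _. 0"]) (simp add: step_data_def)
  next
    case False
    with \<open>0 \<le> T\<close> have "0 < T" by simp
    from gbm_ito_integral_approximation[OF this] show ?thesis
      by (intro exI[of _ Suc] exI conjI allI)
  qed
qed

end

section \<open>Disutility and its tangent inequality\<close>

definition disutility :: "real \<Rightarrow> real \<Rightarrow> real \<Rightarrow> real \<Rightarrow> ennreal" where
  "disutility \<rho> \<gamma> s y = e2ennreal (- (ereal (exp (- \<rho> * s)) * utility \<gamma> y))"

definition total_disutility :: "'a measure \<Rightarrow> real \<Rightarrow> real \<Rightarrow> (real \<Rightarrow> 'a \<Rightarrow> real) \<Rightarrow> ennreal" where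
  "total_disutility M \<rho> \<gamma> c = (\<integral>\<^sup>+w. (\<integral>\<^sup>+s\<in>{0..}. disutility \<rho> \<gamma> s (c s w) \<partial>lborel) \<partial>M)"

lemma objective_eq_total_disutility: "objective M \<rho> \<gamma> c = - enn2ereal (total_disutility M \<rho> \<gamma> c)"
  by (simp add: objective_def total_disutility_def disutility_def)

lemma disutility_0: "disutility \<rho> \<gamma> s 0 = \<infinity>"
  by (simp add: disutility_def utility_def)

lemma disutility_pos:
  assumes "0 < y"
  shows "disutility \<rho> \<gamma> s y = ennreal (exp (- \<rho> * s) * (y powr (1 - \<gamma>) / (\<gamma> - 1)))"
proof -
  have "- (y powr (1 - \<gamma>) / (1 - \<gamma>)) = y powr (1 - \<gamma>) / (\<gamma> - 1)"
    by (metis minus_diff_eq minus_divide_right)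
  moreover have "- (ereal e * ereal u) = ereal (e * - u)" for e u by simp
  ultimately have "- (ereal (exp (- \<rho> * s)) * utility \<gamma> y)
      = ereal (exp (- \<rho> * s) * (y powr (1 - \<gamma>) / (\<gamma> - 1)))"
    using assms by (simp only: utility_def if_False less_imp_neq[symmetric] not_False_eq_True)
  then show ?thesis by (simp add: disutility_def)
qed

lemma disutility_process_measurable:
  assumes c: "jointly_measurable M c"
  shows "(\<lambda>(w, s). disutility \<rho> \<gamma> s (c s w)) \<in> borel_measurable (M \<Otimes>\<^sub>M lborel_on {0..})"
proof -
  note [measurable] = jointly_measurable_lborel_on[OF c order.refl]
    measurable_compose[OF measurable_snd measurable_ident_lborel_on, of M "{0..}"]
  have disutility: "(\<lambda>p. disutility \<rho> \<gamma> (fst p) (snd p)) \<in> borel_measurable (borel \<Otimes>\<^sub>M borel)"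
    unfolding disutility_def utility_def by measurable
  have "(\<lambda>p. (snd p, (\<lambda>(w, s). c s w) p)) \<in> measurable (M \<Otimes>\<^sub>M lborel_on {0..}) (borel \<Otimes>\<^sub>M borel)"
    by measurable
  from measurable_compose[OF this disutility] show ?thesis by (simp add: split_beta')
qed

lemma Bernoulli_powr_neg:
  fixes z p :: real
  assumes "0 < z" "p \<le> 0"
  shows "1 + p * (z - 1) \<le> z powr p"
proof -
  have "p * (z - 1) \<le> p * ln z" using assms ln_le_minus_one[of z] by (simp add: mult_left_mono_neg)
  also have "1 + p * ln z \<le> exp (p * ln z)" by (rule exp_ge_add_one_self)
  finally show ?thesis using assms by (simp add: powr_def)
qed

lemma power_utility_tangent:
  fixes \<gamma> y z :: real
  assumes "0 < y" "0 < z" "1 < \<gamma>"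
  shows "\<gamma> * (z powr (1 - \<gamma>) / (\<gamma> - 1)) \<le> y powr (1 - \<gamma>) / (\<gamma> - 1) + z powr (- \<gamma>) * y"
proof -
  have z_powr: "z powr (1 - \<gamma>) = z powr (- \<gamma>) * z"
    using assms by (simp add: powr_diff powr_minus field_simps)
  have "1 + (1 - \<gamma>) * (y / z - 1) \<le> (y / z) powr (1 - \<gamma>)"
    using assms by (intro Bernoulli_powr_neg) auto
  also have "\<dots> = y powr (1 - \<gamma>) / z powr (1 - \<gamma>)" using assms by (simp add: powr_divide)
  finally have "z powr (1 - \<gamma>) * (1 + (1 - \<gamma>) * (y / z - 1)) \<le> y powr (1 - \<gamma>)"
    using assms by (simp add: field_simps)
  moreover have "z powr (1 - \<gamma>) * (1 + (1 - \<gamma>) * (y / z - 1))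
      = \<gamma> * z powr (1 - \<gamma>) - (\<gamma> - 1) * (z powr (- \<gamma>) * y)"
    unfolding z_powr using assms by (simp add: field_simps)
  ultimately have "\<gamma> * z powr (1 - \<gamma>) \<le> y powr (1 - \<gamma>) + (\<gamma> - 1) * (z powr (- \<gamma>) * y)" by simp
  then have "\<gamma> * z powr (1 - \<gamma>) / (\<gamma> - 1)
      \<le> (y powr (1 - \<gamma>) + (\<gamma> - 1) * (z powr (- \<gamma>) * y)) / (\<gamma> - 1)"
    using assms by (intro divide_right_mono) auto
  then show ?thesis using assms by (simp add: add_divide_distrib)
qed

lemma disutility_tangent:
  assumes \<gamma>: "1 < \<gamma>" and z: "0 < z" and y: "0 \<le> y"
  shows "ennreal \<gamma> * disutility \<rho> \<gamma> s z
    \<le> disutility \<rho> \<gamma> s y + ennreal (exp (- \<rho> * s) * z powr (- \<gamma>) * y)"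
proof (cases "y = 0")
  case True
  then show ?thesis by (simp add: disutility_0)
next
  case False
  with y have "0 < y" by simp
  let ?e = "exp (- \<rho> * s)"
  have "ennreal \<gamma> * disutility \<rho> \<gamma> s z = ennreal (?e * (\<gamma> * (z powr (1 - \<gamma>) / (\<gamma> - 1))))"
    unfolding disutility_pos[OF z] using \<gamma>
    by (subst ennreal_mult'[symmetric]) (auto simp: mult.left_commute)
  also have "\<dots> \<le> ennreal (?e * (y powr (1 - \<gamma>) / (\<gamma> - 1) + z powr (- \<gamma>) * y))"
    using power_utility_tangent[OF \<open>0 < y\<close> z \<gamma>] by (intro ennreal_leI mult_left_mono) auto
  also have "\<dots> = disutility \<rho> \<gamma> s y + ennreal (?e * z powr (- \<gamma>) * y)"
    unfolding disutility_pos[OF \<open>0 < y\<close>] distrib_left mult.assoc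
    using \<gamma> y by (intro ennreal_plus) auto
  finally show ?thesis .
qed

lemma (in prob_space) total_disutility_tangent:
  assumes \<gamma>: "1 < \<gamma>" and y: "0 \<le> y"
    and c: "jointly_measurable M c" "\<And>s w. 0 \<le> s \<Longrightarrow> w \<in> space M \<Longrightarrow> 0 \<le> c s w"
    and z: "jointly_measurable M z" "\<And>s w. 0 < z s w"
    and p: "(\<lambda>(w, s). ennreal (p s w * c s w)) \<in> borel_measurable (M \<Otimes>\<^sub>M lborel_on {0..})"
    and marginal: "\<And>s w. exp (- \<rho> * s) * z s w powr (- \<gamma>) = y * p s w"
  shows "ennreal \<gamma> * total_disutility M \<rho> \<gamma> z
    \<le> total_disutility M \<rho> \<gamma> c
      + ennreal y * (\<integral>\<^sup>+w. (\<integral>\<^sup>+s\<in>{0..}. ennreal (p s w * c s w) \<partial>lborel) \<partial>M)"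
proof -
  let ?Q = "M \<Otimes>\<^sub>M lborel_on {0..}"
  note measurable_c = disutility_process_measurable[OF c(1), of \<rho> \<gamma>]
  note measurable_z = disutility_process_measurable[OF z(1), of \<rho> \<gamma>]
  note [measurable] = measurable_c measurable_z p
  have "ennreal \<gamma> * disutility \<rho> \<gamma> s (z s w)
      \<le> disutility \<rho> \<gamma> s (c s w) + ennreal y * ennreal (p s w * c s w)"
    if "w \<in> space M" "0 \<le> s" for w s
    using disutility_tangent[OF \<gamma> z(2) c(2)[OF that(2,1)], of \<rho> s s w] y
    unfolding marginal by (simp add: ennreal_mult' mult.assoc)
  then have "(\<integral>\<^sup>+q. ennreal \<gamma> * (\<lambda>(w, s). disutility \<rho> \<gamma> s (z s w)) q \<partial>?Q)
      \<le> (\<integral>\<^sup>+q. (\<lambda>(w, s). disutility \<rho> \<gamma> s (c s w)) q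
        + ennreal y * (\<lambda>(w, s). ennreal (p s w * c s w)) q \<partial>?Q)"
    by (intro nn_integral_mono) (auto simp: space_pair_measure)
  then show ?thesis
    unfolding total_disutility_def
    by (subst (1 2 3) nn_integral_pair_lborel_on(1))
      (simp_all add: nn_integral_cmult nn_integral_add measurable_c measurable_z p)
qed

section \<open>The Merton problem\<close>

context brownian
begin

lemma gbm_powr:
  assumes "0 < z"
  shows "gbm z \<theta> \<delta> s w powr p = z powr p * exp (p * ((\<delta> - \<theta>\<^sup>2 / 2) * s + \<theta> * W s w))"
proof -
  have "gbm z \<theta> \<delta> s w = z * exp ((\<delta> - \<theta>\<^sup>2 / 2) * s + \<theta> * W s w)"
    unfolding gbm_def exp_martingale_def exp_tilt_def
    by (simp add: mult.assoc algebra_simps flip: exp_add)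
  then have "gbm z \<theta> \<delta> s w powr p = z powr p * exp ((\<delta> - \<theta>\<^sup>2 / 2) * s + \<theta> * W s w) powr p"
    using assms by (simp add: powr_mult)
  then show ?thesis by (simp add: powr_def)
qed

lemma gbm_powr_mean:
  assumes "0 < z" "0 \<le> s"
  shows "has_bochner_integral M (\<lambda>w. gbm z \<theta> \<delta> s w powr p)
    (z powr p * exp ((p * (\<delta> - \<theta>\<^sup>2 / 2) + (p * \<theta>)\<^sup>2 / 2) * s))"
proof -
  let ?A = "z powr p * exp (p * (\<delta> - \<theta>\<^sup>2 / 2) * s)"
  have "has_bochner_integral M (\<lambda>w. ?A * exp ((p * \<theta>) * W s w)) (?A * exp ((p * \<theta>)\<^sup>2 * s / 2))"
    by (intro has_bochner_integral_mult_right exp_W_mean assms)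
  moreover have "gbm z \<theta> \<delta> s w powr p = ?A * exp ((p * \<theta>) * W s w)" for w
    unfolding gbm_powr[OF assms(1)] by (simp add: distrib_left exp_add mult.assoc)
  moreover have "?A * exp ((p * \<theta>)\<^sup>2 * s / 2)
      = z powr p * exp ((p * (\<delta> - \<theta>\<^sup>2 / 2) + (p * \<theta>)\<^sup>2 / 2) * s)"
    by (simp add: distrib_right exp_add)
  ultimately show ?thesis by (simp only:)
qed

lemma gbm_total_disutility:
  assumes \<gamma>: "1 < \<gamma>" and z: "0 < z" and k: "0 < k"
    and decay: "- \<rho> + (1 - \<gamma>) * (\<delta> - \<theta>\<^sup>2 / 2) + ((1 - \<gamma>) * \<theta>)\<^sup>2 / 2 = - k"
  shows "total_disutility M \<rho> \<gamma> (gbm z \<theta> \<delta>) = ennreal (z powr (1 - \<gamma>) / (\<gamma> - 1) / k)"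
proof -
  let ?A = "z powr (1 - \<gamma>) / (\<gamma> - 1)"
  have mean: "(\<integral>\<^sup>+w. disutility \<rho> \<gamma> s (gbm z \<theta> \<delta> s w) \<partial>M)
      = ennreal (?A * exp (- k * s))" if "0 \<le> s" for s
  proof -
    let ?growth = "(1 - \<gamma>) * (\<delta> - \<theta>\<^sup>2 / 2) + ((1 - \<gamma>) * \<theta>)\<^sup>2 / 2"
    have "has_bochner_integral M (\<lambda>w. exp (- \<rho> * s) / (\<gamma> - 1) * gbm z \<theta> \<delta> s w powr (1 - \<gamma>))
        (exp (- \<rho> * s) / (\<gamma> - 1) * (z powr (1 - \<gamma>) * exp (?growth * s)))"
      by (intro has_bochner_integral_mult_right gbm_powr_mean z that)
    moreover have "exp (- \<rho> * s) / (\<gamma> - 1) * (z powr (1 - \<gamma>) * exp (?growth * s)) = ?A * exp (- k * s)"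
    proof -
      have "- \<rho> * s + ?growth * s = - k * s"
        unfolding decay[symmetric] by (simp only: distrib_right add.assoc)
      then have "exp (- k * s) = exp (- \<rho> * s) * exp (?growth * s)" by (metis exp_add)
      then show ?thesis by (simp only: times_divide_eq_left times_divide_eq_right mult_ac)
    qed
    moreover have "0 < gbm z \<theta> \<delta> s w" for w using z by (simp add: gbm_def)
    ultimately show ?thesis
      using \<gamma> by (simp add: disutility_pos nn_integral_eq_integral has_bochner_integral_iff)
  qed
  have "total_disutility M \<rho> \<gamma> (gbm z \<theta> \<delta>)
      = (\<integral>\<^sup>+s\<in>{0..}. (\<integral>\<^sup>+w. disutility \<rho> \<gamma> s (gbm z \<theta> \<delta> s w) \<partial>M) \<partial>lborel)"
    unfolding total_disutility_def
    by (intro nn_integral_pair_lborel_on(2) disutility_process_measurable gbm_jointly_measurable) simp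
  also have "\<dots> = (\<integral>\<^sup>+s. ennreal (?A * exp (- k * s)) * indicator {0..} s \<partial>lborel)"
    by (intro nn_integral_cong) (simp add: indicator_def mean)
  also have "\<dots> = ennreal (0 - (- (?A / k) * exp (- k * 0)))"
  proof (rule nn_integral_FTC_atLeast)
    show "((\<lambda>s. - (?A / k) * exp (- k * s)) has_real_derivative ?A * exp (- k * s)) (at s)" for s
      using k \<gamma> by (auto intro!: derivative_eq_intros)
    show "0 \<le> ?A * exp (- k * s)" for s using \<gamma> by simp
    have "((\<lambda>s. exp (- k * s)) \<longlongrightarrow> 0) at_top"
      using k by (intro filterlim_compose[OF exp_at_bot]
          filterlim_tendsto_neg_mult_at_bot[OF tendsto_const] filterlim_ident) auto
    then show "((\<lambda>s. - (?A / k) * exp (- k * s)) \<longlongrightarrow> 0) at_top"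
      by (rule tendsto_mult_right_zero)
  qed simp
  finally show ?thesis by simp
qed

lemma gbm_wealth_process:
  assumes \<sigma>: "\<sigma> \<noteq> 0" and \<delta>: "\<delta> = r + lam * \<theta> - k"
  shows "wealth_process M F W r \<sigma> lam x (gbm (k * x) \<theta> \<delta>) (gbm (\<theta> / \<sigma> * x) \<theta> \<delta>) (gbm x \<theta> \<delta>)"
  unfolding wealth_process_def
proof (intro conjI exI)
  show "adapted F (gbm x \<theta> \<delta>)" by (rule gbm_adapted)
  show "continuous_paths M (gbm x \<theta> \<delta>)"
    unfolding continuous_paths_def by (intro AE_I2 gbm_continuous)
  show "ito_integral M F W (\<lambda>t w. \<sigma> * gbm (\<theta> / \<sigma> * x) \<theta> \<delta> t w) (gbm_martingale_part x \<theta> \<delta>)"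
    using gbm_ito_integral[of \<theta> x \<delta>] \<sigma> by (simp add: gbm_scale)
  have drift: "r * gbm x \<theta> \<delta> s w + \<sigma> * lam * gbm (\<theta> / \<sigma> * x) \<theta> \<delta> s w - gbm (k * x) \<theta> \<delta> s w
      = \<delta> * gbm x \<theta> \<delta> s w" for s w
    using \<sigma> by (simp add: gbm_def \<delta> algebra_simps)
  show "AE w in M. \<forall>t\<ge>0.
      set_integrable lborel {0..t} (\<lambda>s. r * gbm x \<theta> \<delta> s w + \<sigma> * lam * gbm (\<theta> / \<sigma> * x) \<theta> \<delta> s w
        - gbm (k * x) \<theta> \<delta> s w) \<and>
      gbm x \<theta> \<delta> t w = x + (LINT s:{0..t}|lborel. r * gbm x \<theta> \<delta> s w
        + \<sigma> * lam * gbm (\<theta> / \<sigma> * x) \<theta> \<delta> s w - gbm (k * x) \<theta> \<delta> s w) + gbm_martingale_part x \<theta> \<delta> t w"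
    unfolding drift
  proof (intro AE_I2 allI impI conjI)
    fix w t assume w: "w \<in> space M"
    show "set_integrable lborel {0..t} (\<lambda>s. \<delta> * gbm x \<theta> \<delta> s w)"
      by (intro set_integrable_mult_right borel_integrable_atLeastAtMost'
          continuous_on_subset[OF gbm_continuous[OF w]]) auto
  qed (simp add: gbm_martingale_part_def)
qed

lemma gbm_admissible:
  assumes "\<sigma> \<noteq> 0" "\<delta> = r + lam * \<theta> - k" "0 \<le> x" "0 \<le> k"
  shows "(gbm (k * x) \<theta> \<delta>, gbm (\<theta> / \<sigma> * x) \<theta> \<delta>) \<in> admissible M F W r \<sigma> lam x"
  using gbm_wealth_process[OF assms(1,2), of x] gbm_L1_loc_nonneg[of "k * x" \<theta> \<delta>]
    gbm_L2_loc gbm_nonneg[OF assms(3)] assms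
  unfolding admissible_def by auto

end

locale merton_problem = brownian M F W
  for M :: "'a measure" and F :: "real \<Rightarrow> 'a measure" and W :: "real \<Rightarrow> 'a \<Rightarrow> real" +
  fixes r \<sigma> lam \<rho> \<gamma> :: real
  assumes \<sigma>_pos: "0 < \<sigma>" and \<gamma>_gt_1: "1 < \<gamma>"
    and well_posed: "(1 - \<gamma>) * (r + lam\<^sup>2 / (2 * \<gamma>)) < \<rho>"
begin

definition consumption_rate :: real where
  "consumption_rate = (\<rho> - (1 - \<gamma>) * (r + lam\<^sup>2 / (2 * \<gamma>))) / \<gamma>"

definition optimal_consumption :: "real \<Rightarrow> real \<Rightarrow> 'a \<Rightarrow> real" where
  "optimal_consumption x
    = gbm (consumption_rate * x) (lam / \<gamma>) (r + lam * (lam / \<gamma>) - consumption_rate)"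

definition optimal_disutility :: "real \<Rightarrow> real" where
  "optimal_disutility x = (consumption_rate * x) powr (- \<gamma>) * x / (\<gamma> - 1)"

lemma consumption_rate_pos: "0 < consumption_rate"
  using well_posed \<gamma>_gt_1 by (simp add: consumption_rate_def)

lemma discount_rate_eq: "\<rho> = \<gamma> * consumption_rate + (1 - \<gamma>) * (r + lam\<^sup>2 / (2 * \<gamma>))"
  using \<gamma>_gt_1 by (simp add: consumption_rate_def)

lemma optimal_consumption_pos: "0 < x \<Longrightarrow> 0 < optimal_consumption x s w"
  using consumption_rate_pos by (simp add: optimal_consumption_def gbm_def)

lemma optimal_consumption_jointly_measurable: "jointly_measurable M (optimal_consumption x)"
  unfolding optimal_consumption_def by (rule gbm_jointly_measurable)

lemma optimal_consumption_admissible: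
  assumes "0 < x"
  obtains \<pi> where "(optimal_consumption x, \<pi>) \<in> admissible M F W r \<sigma> lam x"
proof
  show "(optimal_consumption x,
      gbm (lam / \<gamma> / \<sigma> * x) (lam / \<gamma>) (r + lam * (lam / \<gamma>) - consumption_rate))
      \<in> admissible M F W r \<sigma> lam x"
    unfolding optimal_consumption_def using assms \<sigma>_pos consumption_rate_pos
    by (intro gbm_admissible) auto
qed

lemma total_disutility_optimal_consumption:
  assumes x: "0 < x"
  shows "total_disutility M \<rho> \<gamma> (optimal_consumption x) = ennreal (optimal_disutility x)"
proof -
  let ?\<theta> = "lam / \<gamma>" and ?z = "consumption_rate * x"
  have z: "0 < ?z" using consumption_rate_pos x by simp
  have "- \<rho> + (1 - \<gamma>) * (r + lam * ?\<theta> - k - ?\<theta>\<^sup>2 / 2) + ((1 - \<gamma>) * ?\<theta>)\<^sup>2 / 2 = - k"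
    if "\<rho> = \<gamma> * k + (1 - \<gamma>) * (r + lam\<^sup>2 / (2 * \<gamma>))" for k
    unfolding that using \<gamma>_gt_1 by (simp add: power2_eq_square field_simps)
  from gbm_total_disutility[OF \<gamma>_gt_1 z consumption_rate_pos this[OF discount_rate_eq]]
  have "total_disutility M \<rho> \<gamma> (optimal_consumption x)
      = ennreal (?z powr (1 - \<gamma>) / (\<gamma> - 1) / consumption_rate)"
    by (simp add: optimal_consumption_def)
  also have "?z powr (1 - \<gamma>) = ?z powr (- \<gamma>) * ?z"
    using z by (simp add: powr_diff powr_minus field_simps)
  finally show ?thesis using consumption_rate_pos by (simp add: optimal_disutility_def mult.commute)
qed

lemma optimal_consumption_marginal_disutility:
  assumes x: "0 < x"
  shows "exp (- \<rho> * s) * optimal_consumption x s w powr (- \<gamma>)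
    = (consumption_rate * x) powr (- \<gamma>) * state_price r lam s w"
proof -
  let ?\<theta> = "lam / \<gamma>" and ?y = "(consumption_rate * x) powr (- \<gamma>)"
  let ?\<nu> = "r + lam * ?\<theta> - consumption_rate - ?\<theta>\<^sup>2 / 2"
  have "- \<rho> - \<gamma> * (r + lam * ?\<theta> - k - ?\<theta>\<^sup>2 / 2) = - r - lam\<^sup>2 / 2"
    if "\<rho> = \<gamma> * k + (1 - \<gamma>) * (r + lam\<^sup>2 / (2 * \<gamma>))" for k
    unfolding that using \<gamma>_gt_1 by (simp add: power2_eq_square field_simps)
  note coefficient = this[OF discount_rate_eq]
  have "- \<rho> * s + - \<gamma> * (?\<nu> * s + ?\<theta> * W s w) = (- \<rho> - \<gamma> * ?\<nu>) * s - (\<gamma> * ?\<theta>) * W s w"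
    by (simp add: left_diff_distrib right_diff_distrib distrib_left mult.assoc)
  also have "\<dots> = - r * s + (- lam * W s w - (- lam)\<^sup>2 * s / 2)"
    unfolding coefficient using \<gamma>_gt_1 by (simp add: left_diff_distrib)
  finally have "exp (- \<rho> * s) * exp (- \<gamma> * (?\<nu> * s + ?\<theta> * W s w)) = state_price r lam s w"
    unfolding state_price_def exp_martingale_def exp_tilt_def by (simp only: exp_add[symmetric])
  moreover have "optimal_consumption x s w powr (- \<gamma>) = ?y * exp (- \<gamma> * (?\<nu> * s + ?\<theta> * W s w))"
    unfolding optimal_consumption_def using consumption_rate_pos x by (intro gbm_powr) simp
  ultimately show ?thesis by (simp only: mult.left_commute[of _ ?y])
qed

lemma admissible_total_disutility_ge:
  assumes x: "0 < x" and admissible_c: "(c, \<pi>) \<in> admissible M F W r \<sigma> lam x"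
  shows "ennreal (optimal_disutility x) \<le> total_disutility M \<rho> \<gamma> c"
proof -
  let ?y = "(consumption_rate * x) powr (- \<gamma>)" and ?V = "optimal_disutility x"
  obtain X where wealth_X: "wealth_process M F W r \<sigma> lam x c \<pi> X" "AE w in M. \<forall>t\<ge>0. 0 \<le> X t w"
    and c: "c \<in> L1_loc_nonneg M F"
    using admissible_c unfolding admissible_def by blast
  then have c': "jointly_measurable M c" "\<And>s w. 0 \<le> s \<Longrightarrow> w \<in> space M \<Longrightarrow> 0 \<le> c s w"
    by (auto simp: L1_loc_nonneg_def L1_loc_def)
  have V: "0 \<le> ?V" "?y * x = (\<gamma> - 1) * ?V"
    using \<gamma>_gt_1 x by (simp_all add: optimal_disutility_def)
  have "ennreal \<gamma> * ennreal ?V \<le> total_disutility M \<rho> \<gamma> c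
      + ennreal ?y * (\<integral>\<^sup>+w. (\<integral>\<^sup>+s\<in>{0..}. ennreal (state_price r lam s w * c s w) \<partial>lborel) \<partial>M)"
    unfolding total_disutility_optimal_consumption[OF x, symmetric]
    using x by (intro total_disutility_tangent \<gamma>_gt_1 c' optimal_consumption_jointly_measurable
        optimal_consumption_pos state_price_mult_measurable
        optimal_consumption_marginal_disutility) auto
  also have "\<dots> \<le> total_disutility M \<rho> \<gamma> c + ennreal ?y * ennreal x"
    by (intro add_left_mono mult_left_mono budget_constraint[OF wealth_X c]) auto
  also have "ennreal ?y * ennreal x = ennreal ((\<gamma> - 1) * ?V)"
    using x V(2) by (simp add: ennreal_mult'[symmetric])
  finally have "ennreal \<gamma> * ennreal ?V \<le> total_disutility M \<rho> \<gamma> c + ennreal ((\<gamma> - 1) * ?V)" .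
  moreover have "ennreal \<gamma> * ennreal ?V = ennreal ((\<gamma> - 1) * ?V + ?V)"
    using \<gamma>_gt_1 by (simp add: ennreal_mult'[symmetric] algebra_simps)
  moreover have "\<dots> = ennreal ((\<gamma> - 1) * ?V) + ennreal ?V"
    using V(1) \<gamma>_gt_1 by (intro ennreal_plus) auto
  ultimately have "ennreal ((\<gamma> - 1) * ?V) + ennreal ?V
      \<le> ennreal ((\<gamma> - 1) * ?V) + total_disutility M \<rho> \<gamma> c"
    by (simp only: add.commute)
  then show ?thesis
    by (simp only: ennreal_add_left_cancel_le ennreal_neq_top infinity_ennreal_def simp_thms)
qed

lemma value_function_eq:
  assumes x: "0 < x"
  shows "value_function M F W r \<sigma> lam \<rho> \<gamma> x
    = ereal (consumption_rate powr (- \<gamma>) * (x powr (1 - \<gamma>) / (1 - \<gamma>)))"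
proof -
  let ?V = "optimal_disutility x"
  have "value_function M F W r \<sigma> lam \<rho> \<gamma> x = - enn2ereal (ennreal ?V)"
    unfolding value_function_def
  proof (rule antisym)
    show "(SUP (c, \<pi>)\<in>admissible M F W r \<sigma> lam x. objective M \<rho> \<gamma> c) \<le> - enn2ereal (ennreal ?V)"
    proof (rule SUP_least, clarify)
      fix c \<pi> assume "(c, \<pi>) \<in> admissible M F W r \<sigma> lam x"
      from admissible_total_disutility_ge[OF x this]
      have "enn2ereal (ennreal ?V) \<le> enn2ereal (total_disutility M \<rho> \<gamma> c)"
        by (rule less_eq_ennreal.rep_eq[THEN iffD1])
      then show "objective M \<rho> \<gamma> c \<le> - enn2ereal (ennreal ?V)"
        by (simp only: objective_eq_total_disutility ereal_minus_le_minus)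
    qed
    obtain \<pi> where admissible_c: "(optimal_consumption x, \<pi>) \<in> admissible M F W r \<sigma> lam x"
      using optimal_consumption_admissible[OF x] .
    show "- enn2ereal (ennreal ?V) \<le> (SUP (c, \<pi>)\<in>admissible M F W r \<sigma> lam x. objective M \<rho> \<gamma> c)"
      using SUP_upper[OF admissible_c, of "\<lambda>(c, \<pi>). objective M \<rho> \<gamma> c"]
      by (simp only: prod.case objective_eq_total_disutility total_disutility_optimal_consumption[OF x])
  qed
  also have "\<dots> = ereal (- ?V)" using \<gamma>_gt_1 x by (simp add: optimal_disutility_def)
  also have "- ?V = consumption_rate powr (- \<gamma>) * (x powr (1 - \<gamma>) / (1 - \<gamma>))"
  proof -
    have "(consumption_rate * x) powr (- \<gamma>) * x = consumption_rate powr (- \<gamma>) * x powr (1 - \<gamma>)"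
      using consumption_rate_pos x by (simp add: powr_mult powr_diff powr_minus field_simps)
    then show ?thesis
      unfolding optimal_disutility_def by (metis minus_diff_eq minus_divide_right times_divide_eq_right)
  qed
  finally show ?thesis .
qed

end

lemma value_function_cong_AE:
  assumes eq: "AE w in M. \<forall>t. W t w = W' t w"
  shows "value_function M F W r \<sigma> lam \<rho> \<gamma> x = value_function M F W' r \<sigma> lam \<rho> \<gamma> x"
proof -
  have "ito_integral M F V' H I"
    if "ito_integral M F V H I" "AE w in M. \<forall>t. V t w = V' t w" for V V' H I
    using that by (intro ito_integral_cong_AE[OF that(1)]) (auto simp: ito_integral_def)
  moreover have "AE w in M. \<forall>t. W' t w = W t w" using eq by eventually_elim simp
  ultimately have "ito_integral M F W H I \<longleftrightarrow> ito_integral M F W' H I" for H I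
    using eq by blast
  then show ?thesis unfolding value_function_def admissible_def wealth_process_def by simp
qed

lemma (in prob_space) indep_set_vimage_cong_AE:
  fixes f g :: "'a \<Rightarrow> real"
  assumes independent: "indep_set A {f -` B \<inter> space M | B. B \<in> sets borel}"
    and eq: "AE w in M. f w = g w" and [measurable]: "f \<in> borel_measurable M" "g \<in> borel_measurable M"
  shows "indep_set A {g -` B \<inter> space M | B. B \<in> sets borel}"
  unfolding indep_sets2_eq
proof (intro conjI ballI)
  show A: "A \<subseteq> events" using independent by (simp add: indep_sets2_eq)
  show "{g -` B \<inter> space M | B. B \<in> sets borel} \<subseteq> events" by auto
  fix a b assume a: "a \<in> A" and "b \<in> {g -` B \<inter> space M | B. B \<in> sets borel}"
  then obtain B where b: "b = g -` B \<inter> space M" and B [measurable]: "B \<in> sets borel" by blast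
  let ?b = "f -` B \<inter> space M"
  have "a \<in> events" "b \<in> events" "?b \<in> events" using a A by (auto simp: b)
  then have "prob (a \<inter> b) = prob (a \<inter> ?b)" "prob b = prob ?b"
    using eq by (auto intro!: measure_eq_AE elim!: eventually_mono simp: b)
  moreover have "prob (a \<inter> ?b) = prob a * prob ?b"
    using B by (intro indep_setD[OF independent a]) blast
  ultimately show "prob (a \<inter> b) = prob a * prob b" by simp
qed

lemma (in usual_filtered_prob_space) brownian_version:
  assumes brownian_W: "brownian_motion M F W"
  obtains W' where "brownian M F W'" "AE w in M. \<forall>t. W t w = W' t w"
proof -
  have adapted_W: "adapted F W"
    and dist: "\<And>s t. 0 \<le> s \<Longrightarrow> s < t \<Longrightarrow>
      distributed M lborel (\<lambda>w. W t w - W s w) (normal_density 0 (sqrt (t - s)))"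
    and independent: "\<And>s t. 0 \<le> s \<Longrightarrow> s < t \<Longrightarrow>
      indep_set (sets (F s)) {(\<lambda>w. W t w - W s w) -` B \<inter> space M | B. B \<in> sets borel}"
    and paths: "AE w in M. continuous_on {0..} (\<lambda>t. W t w) \<and> W 0 w = 0"
    using brownian_W unfolding brownian_motion_def continuous_paths_def by auto
  obtain W' where W': "adapted F W'" "\<And>w. w \<in> space M \<Longrightarrow> continuous_on {0..} (\<lambda>t. W' t w) \<and> W' 0 w = 0"
    and eq: "AE w in M. \<forall>t. W t w = W' t w"
    using adapted_AE_modification[OF adapted_W, of "\<lambda>f. continuous_on {0..} f \<and> f 0 = 0"] paths by auto
  have "brownian M F W'"
  proof unfold_locales
    show "adapted F W'" by fact
    show "continuous_on {0..} (\<lambda>t. W' t w)" "W' 0 w = 0" if "w \<in> space M" for w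
      using W'(2)[OF that] by auto
    fix s t :: real assume st: "0 \<le> s" "s < t"
    let ?D = "\<lambda>w. W t w - W s w" and ?D' = "\<lambda>w. W' t w - W' s w"
    have [measurable]: "?D \<in> borel_measurable M" "?D' \<in> borel_measurable M"
      using adapted_measurable_M[OF adapted_W] adapted_measurable_M[OF W'(1)] st by auto
    have D: "AE w in M. ?D w = ?D' w" using eq by eventually_elim simp
    then have "distr M lborel ?D = distr M lborel ?D'" by (intro distr_cong_AE) auto
    then show "distributed M lborel ?D' (normal_density 0 (sqrt (t - s)))"
      using dist[OF st] unfolding distributed_def by simp
    show "indep_set (sets (F s)) {?D' -` B \<inter> space M | B. B \<in> sets borel}"
      by (rule indep_set_vimage_cong_AE[OF independent[OF st] D]) measurable
  qed
  then show thesis using eq by (rule that)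
qed

theorem proposition3p4:
  fixes M :: "'a measure" and F :: "real \<Rightarrow> 'a measure" and W :: "real \<Rightarrow> 'a \<Rightarrow> real"
    and r \<mu> \<rho> \<sigma> lam \<gamma> a :: real
  assumes "usual_filtered_prob_space M F"
    and "brownian_motion M F W"
    and "\<sigma> > 0"
    and "lam = (\<mu> - r) / \<sigma>"
    and "\<gamma> > 1"
    and "\<rho> > (1 - \<gamma>) * (r + lam\<^sup>2 / (2 * \<gamma>))"
    and "a = ((\<rho> - (1 - \<gamma>) * (r + lam\<^sup>2 / (2 * \<gamma>))) / \<gamma>) powr (- \<gamma>)"
  shows "a > 0 \<and>
    (\<forall>x>0. value_function M F W r \<sigma> lam \<rho> \<gamma> x = ereal (a * (x powr (1 - \<gamma>) / (1 - \<gamma>)))) \<and>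
    (\<forall>b>0. (\<forall>x>0. value_function M F W r \<sigma> lam \<rho> \<gamma> x = ereal (b * (x powr (1 - \<gamma>) / (1 - \<gamma>))))
       \<longrightarrow> b = a)"
proof -
  interpret usual_filtered_prob_space M F by fact
  obtain W' where "brownian M F W'" and W': "AE w in M. \<forall>t. W t w = W' t w"
    using brownian_version[OF assms(2)] .
  then interpret merton_problem M F W' r \<sigma> lam \<rho> \<gamma>
    using assms by (simp add: merton_problem_def merton_problem_axioms_def)
  have a: "a = consumption_rate powr (- \<gamma>)" using assms(7) by (simp add: consumption_rate_def)
  have value_eq: "value_function M F W r \<sigma> lam \<rho> \<gamma> x = ereal (a * (x powr (1 - \<gamma>) / (1 - \<gamma>)))" if "x > 0" for x
    unfolding value_function_cong_AE[OF W'] a by (rule value_function_eq[OF that])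
  have "b = a" if "\<forall>x>0. value_function M F W r \<sigma> lam \<rho> \<gamma> x = ereal (b * (x powr (1 - \<gamma>) / (1 - \<gamma>)))" for b
  proof -
    have "ereal (b * (1 powr (1 - \<gamma>) / (1 - \<gamma>))) = ereal (a * (1 powr (1 - \<gamma>) / (1 - \<gamma>)))"
      using that[rule_format, of 1] value_eq[of 1] by (simp only: zero_less_one)
    then show ?thesis using assms(5) by simp
  qed
  moreover have "a > 0" using consumption_rate_pos by (simp add: a)
  ultimately show ?thesis using value_eq by blast
qed

end
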